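(* Let $p\in[2,\infty)$ and $1/p+1/q=1$. Let $K_1,K_2$ be non-negative integrable functions on $[0,T]\times\Omega$, let $\lambda$ be a positive and $\mu$ a non-negative deterministic integrable function on $[0,T]$, and assume: (1) (monotonicity) almost surely, for all $x,y\in V$ and $t\in[0,T]$, $2\langle A_t(x)-A_t(y),x-y\rangle+\|B_t(x)-B_t(y)\|_2^2+\int_E\|F_t(x,\xi)-F_t(y,\xi)\|_H^2\,\nu(d\xi)\le 0$; (2) (coercivity) almost surely, for all $x\in V$ and $t\in[0,T]$, $2\langle A_t(x),x\rangle+\|B_t(x)\|_2^2+\int_E\|F_t(x,\xi)\|_H^2\,\nu(d\xi)+\lambda(t)\|x\|_V^p\le K_1(t)+\mu(t)\|x\|_H^2$; (3) (growth) there is $\alpha>0$ such that almost surely, for all $x\in V$ and $t\in[0,T]$, $\|A_t(x)\|_{V^*}^q\le \alpha\lambda^q(t)\|x\|_V^p+K_2(t)\lambda^{q-1}(t)$; (4) (hemicontinuity) almost surely, for all $x,y,z\in V$ and $t\in[0,T]$, $\lim_{\epsilon\to0}\langle A_t(x+\epsilon y),z\rangle=\langle A_t(x),z\rangle$; (5) $\zeta\in L^2(\Omega,\mathcal F_0;H)$; (6) there is an increasing sequence $E^1\subset E^2\subset\cdots$ of compact subsets of $E$ of finite $\nu$-measure with $\bigcup_{l\ge1}E^l=E$. Consider the two implicit schemes defined in the context (built with the sets $E^l$ of (6)). Then there is a natural number $m_0\ge1$ such that for every $m\ge m_0$ and $l\ge1$ the recursive equation of the first implicit scheme (without space projection) has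 a unique solution $u^{m,l}(t_i)$ that is $\mathcal F_{t_i}$-measurable and satisfies $\mathbb E\|u^{m,l}(t_i)\|_V^p<\infty$ for each $i=1,2,\dots,m$. Similarly, there is a natural number $m_0$ such that for every $m\ge m_0$ and $n,l\ge1$ the recursive equation of the second implicit scheme (with space projection $\Pi_n$) has a unique solution $u^{n,m,l}(t_i)$ that is $\mathcal F_{t_i}$-measurable and satisfies $\mathbb E\|u^{n,m,l}(t_i)\|_V^p<\infty$ for each $i=1,2,\dots,m$.
   Context: Setting. $V$ is a reflexive separable real Banach space embedded densely and continuously in a Hilbert space $H$; identifying $H$ with its dual gives the Gelfand triple $V\hookrightarrow H\hookrightarrow V^*$. $\langle\cdot,\cdot\rangle$ is the duality between $V$ and $V^*$, $(\cdot,\cdot)_H$ the inner product of $H$. $T>0$. $(\Omega,\mathcal F,(\mathcal F_t),\mathbb P)$ is a complete filtered probability space satisfying the usual conditions. $W$ is an adapted cylindrical Wiener process in a Hilbert space $U$ (with countable orthonormal basis $\{g_1,g_2,\dots\}$), with $W_t-W_s$ independent of $\mathcal F_s$ for $t>s$. $E$ is a metric space which is a countable union of compact sets, $\mathcal E$ its Borel $\sigma$-field. $N$ is an adapted time-homogeneous Poisson random measure on $[0,T]\times E$, independent of $W$, with $\sigma$-finite intensity measure $\nu$ on $(E,\mathcal E)$, with $N((s,t],\cdot)$ independent of $\mathcal F_s$; $\tilde N=N-dt\otimes\nu$ is the compensated measure. $L_2(U,H)$ is the space of Hilbert–Schmidt operators, with norm $\|\cdot\|_2$. $\mathcal{BF}$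 is the progressively measurable $\sigma$-field and $\mathcal P$ the predictable $\sigma$-field on $[0,T]\times\Omega$. The coefficients $A:[0,T]\times\Omega\times V\to V^*$ and $B:[0,T]\times\Omega\times V\to L_2(U,H)$ are $\mathcal{BF}\otimes\mathcal B(V)$-measurable, and $F:[0,T]\times\Omega\times V\times E\to H$ is $\mathcal P\otimes\mathcal B(V)\otimes\mathcal E$-measurable. Discretization. $V_1\subseteq V_2\subseteq\cdots$ are finite-dimensional subspaces of $V$ with $\bigcup_nV_n$ dense in $V$. If $e_1,\dots,e_{l_n}$ is a basis of $V_n$ orthonormal in $H$, then $\Pi_n:V^*\to V_n$ is $\Pi_nx=\sum_{k=1}^{l_n}\langle e_k,x\rangle e_k$; it extends the $H$-orthogonal projection onto $V_n$. $W^l_t=\sum_{k=1}^l(W_t,g_k)_Ug_k$. For each $l$, $\{E^l_1,\dots,E^l_{r_l}\}\subset\mathcal E$ is a partition of $E^l$ finer than $\{E^1,E^2\setminus E^1,\dots,E^l\setminus E^{l-1}\}$, each $E^l_j$ having diameter less than $\varepsilon_l$, where $\varepsilon_l\downarrow0$. Set $\delta_m=T/m$, $t_i=i\delta_m$ (depending on $m$). Discretized coefficients: for $x\in V$, $$A^m_{t_i}(x)=\frac1{\delta_m}\int_{t_{i-1}}^{t_i}A_s(x)ds,\quad 1\le i\le m.$$ $\tilde B^m_{t_1}$ and $\tilde F^{m,l}_{t_1}$ are identically $0$ (also when evaluated at the possibly non-$V$-valued initial value), and for $2\le i\le m$, $x\in V$, $$\tilde B^m_{t_i}(x)=\frac1{\delta_m}\int_{t_{i-2}}^{t_{i-1}}B_s(x)ds,$$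 $$\tilde F^{m,l}_{t_i}(x,\xi)=\frac1{\delta_m\nu(E^l_j)}\int_{t_{i-2}}^{t_{i-1}}\int_{E^l_j}F_s(x,\eta)\nu(d\eta)ds\ \text{ if }\xi\in E^l_j,\qquad \tilde F^{m,l}_{t_i}(x,\xi)=0\ \text{ if }\xi\in E\setminus E^l$$ (with $0/0:=0$). First implicit scheme (unknowns $u^{m,l}(t_i)\in V$ for $i\ge1$): $u^{m,l}(t_0)=\zeta$ and for $1\le i\le m$ $$u^{m,l}(t_i)=u^{m,l}(t_{i-1})+\delta_mA^m_{t_i}(u^{m,l}(t_i))+\tilde B^m_{t_i}(u^{m,l}(t_{i-1}))(W^l_{t_i}-W^l_{t_{i-1}})+\int_E\tilde F^{m,l}_{t_i}(u^{m,l}(t_{i-1}),\xi)\tilde N((t_{i-1},t_i],d\xi).$$ Second implicit scheme (unknowns $u^{n,m,l}(t_i)\in V_n$): $u^{n,m,l}(t_0)=\Pi_n\zeta$ and for $1\le i\le m$ $$u^{n,m,l}(t_i)=u^{n,m,l}(t_{i-1})+\delta_m\Pi_nA^m_{t_i}(u^{n,m,l}(t_i))+\Pi_n\tilde B^m_{t_i}(u^{n,m,l}(t_{i-1}))(W^l_{t_i}-W^l_{t_{i-1}})+\int_E\Pi_n\tilde F^{m,l}_{t_i}(u^{n,m,l}(t_{i-1}),\xi)\tilde N((t_{i-1},t_i],d\xi).$$ *)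

theory Defs
  imports "HOL-Probability.Probability"
begin

section \<open>Gelfand triple and operators\<close>

definition reflexive_space :: "'v::real_normed_vector itself \<Rightarrow> bool" where
  "reflexive_space _ \<longleftrightarrow>
     (\<forall>\<Phi> :: ('v \<Rightarrow>\<^sub>L real) \<Rightarrow>\<^sub>L real. \<exists>x. \<forall>\<phi>. blinfun_apply \<Phi> \<phi> = blinfun_apply \<phi> x)"

definition dense_embedding :: "('v::real_normed_vector \<Rightarrow>\<^sub>L 'h::real_normed_vector) \<Rightarrow> bool" where
  "dense_embedding \<iota> \<longleftrightarrow> inj (blinfun_apply \<iota>) \<and> closure (range (blinfun_apply \<iota>)) = UNIV"

text \<open>The embedding of \<open>H\<close> into the dual of \<open>V\<close>: the element \<open>h\<close> is identified with the
  functional sending \<open>v\<close> to the inner product of \<open>\<iota> v\<close> and \<open>h\<close>.\<close>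

definition H_to_dual ::
    "('v::real_normed_vector \<Rightarrow>\<^sub>L 'h::real_inner) \<Rightarrow> 'h \<Rightarrow> ('v \<Rightarrow>\<^sub>L real)" where
  "H_to_dual \<iota> h = blinfun_inner_left h o\<^sub>L \<iota>"

text \<open>A countable orthonormal basis is a family \<open>g\<close> indexed by \<open>J\<close>, which is either all the
  positive integers or an initial segment of them (when \<open>U\<close> is finite-dimensional).\<close>

definition orthonormal_basis :: "nat set \<Rightarrow> (nat \<Rightarrow> 'u::real_inner) \<Rightarrow> bool" where
  "orthonormal_basis J g \<longleftrightarrow>
     (J = {1..} \<or> (\<exists>d. J = {1..d})) \<and>
     (\<forall>j\<in>J. \<forall>k\<in>J. g j \<bullet> g k = (if j = k then 1 else 0)) \<and>
     closure (span (g ` J)) = UNIV"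

definition hs_ops :: "nat set \<Rightarrow> (nat \<Rightarrow> 'u::real_normed_vector)
    \<Rightarrow> ('u \<Rightarrow>\<^sub>L 'h::real_normed_vector) set" where
  "hs_ops J g = {S. (\<lambda>k. (norm (blinfun_apply S (g k)))\<^sup>2) summable_on J}"

definition hs_norm :: "nat set \<Rightarrow> (nat \<Rightarrow> 'u::real_normed_vector)
    \<Rightarrow> ('u \<Rightarrow>\<^sub>L 'h::real_normed_vector) \<Rightarrow> real" where
  "hs_norm J g S = sqrt (\<Sum>\<^sub>\<infinity>k\<in>J. (norm (blinfun_apply S (g k)))\<^sup>2)"

text \<open>The Borel sigma-algebra of the space of Hilbert--Schmidt operators, for the topology of the
  Hilbert--Schmidt norm (not the operator-norm topology of the ambient type).\<close>

definition hs_borel :: "nat set \<Rightarrow> (nat \<Rightarrow> 'u::real_normed_vector)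
    \<Rightarrow> ('u \<Rightarrow>\<^sub>L 'h::real_normed_vector) measure" where
  "hs_borel J g = sigma (hs_ops J g)
     {G. G \<subseteq> hs_ops J g \<and>
         (\<forall>S\<in>G. \<exists>r>0. \<forall>R\<in>hs_ops J g. hs_norm J g (R - S) < r \<longrightarrow> R \<in> G)}"

text \<open>Integral of an operator-valued function, defined by evaluation: it sends \<open>x\<close> to the Bochner
  integral of \<open>f s x\<close>. The Bochner integral of the library is only available for
  second countable types, which \<open>('b \<Rightarrow>\<^sub>L 'c)\<close> is not. As evaluations are
  continuous and linear, this is the value of the Bochner integral in the dual of \<open>V\<close> (for
  \<open>'c = real\<close>) and in the space of Hilbert--Schmidt operators whenever the latter exists.\<close>

definition op_integral :: "'a measure
    \<Rightarrow> ('a \<Rightarrow> 'b::real_normed_vector \<Rightarrow>\<^sub>L 'c::{banach, second_countable_topology})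
    \<Rightarrow> 'b \<Rightarrow>\<^sub>L 'c" where
  "op_integral M f =
     (if bounded_linear (\<lambda>x. \<integral>s. blinfun_apply (f s) x \<partial>M)
      then Blinfun (\<lambda>x. \<integral>s. blinfun_apply (f s) x \<partial>M) else 0)"

lemma op_integral_apply:
  fixes f :: "'a \<Rightarrow> 'b::real_normed_vector \<Rightarrow>\<^sub>L 'c::{banach, second_countable_topology}"
  assumes "\<And>x. (\<lambda>s. blinfun_apply (f s) x) \<in> borel_measurable M"
    and h: "integrable M h" and le: "AE s in M. norm (f s) \<le> h s"
  shows "blinfun_apply (op_integral M f) x = (\<integral>s. blinfun_apply (f s) x \<partial>M)"
proof -
  have bd: "AE s in M. norm (blinfun_apply (f s) y) \<le> norm y * h s" for y
    using le
  proof eventually_elim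
    case (elim s)
    have "norm (blinfun_apply (f s) y) \<le> norm (f s) * norm y" by (rule norm_blinfun)
    also have "\<dots> \<le> h s * norm y" using elim by (intro mult_right_mono) auto
    finally show ?case by (simp add: mult.commute)
  qed
  have int: "integrable M (\<lambda>s. blinfun_apply (f s) y)" for y
  proof (rule Bochner_Integration.integrable_bound)
    show "integrable M (\<lambda>s. norm y * h s)" using h by simp
    show "AE s in M. norm (blinfun_apply (f s) y) \<le> norm (norm y * h s)"
      using bd[of y] by eventually_elim simp
  qed (rule assms(1))
  have "bounded_linear (\<lambda>x. \<integral>s. blinfun_apply (f s) x \<partial>M)"
  proof (rule bounded_linear_intro[where K = "integral\<^sup>L M h"])
    fix y
    have "norm (\<integral>s. blinfun_apply (f s) y \<partial>M) \<le> (\<integral>s. norm (blinfun_apply (f s) y) \<partial>M)"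
      by (rule integral_norm_bound)
    also have "\<dots> \<le> (\<integral>s. norm y * h s \<partial>M)"
      using int[of y] h bd[of y] by (intro integral_mono_AE) auto
    finally have "norm (\<integral>s. blinfun_apply (f s) y \<partial>M) \<le> (\<integral>s. norm y * h s \<partial>M)" .
    then show "norm (\<integral>s. blinfun_apply (f s) y \<partial>M) \<le> norm y * integral\<^sup>L M h"
      by simp
  qed (simp_all add: blinfun.add_right blinfun.scaleR_right int)
  then show ?thesis
    by (simp add: op_integral_def bounded_linear_Blinfun_apply)
qed


section \<open>Filtrations and driving noises\<close>

definition usual_filtration :: "real \<Rightarrow> 'w measure \<Rightarrow> (real \<Rightarrow> 'w measure) \<Rightarrow> bool" where
  "usual_filtration T M Fl \<longleftrightarrow>
     prob_space M \<and> complete_measure M \<and>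
     (\<forall>t\<in>{0..T}. subalgebra M (Fl t)) \<and>
     (\<forall>s\<in>{0..T}. \<forall>t\<in>{s..T}. sets (Fl s) \<subseteq> sets (Fl t)) \<and>
     (\<forall>t\<in>{0..<T}. sets (Fl t) = (\<Inter>s\<in>{t<..T}. sets (Fl s))) \<and>
     null_sets M \<subseteq> sets (Fl 0)"

definition progressive_sigma ::
    "real \<Rightarrow> 'w measure \<Rightarrow> (real \<Rightarrow> 'w measure) \<Rightarrow> (real \<times> 'w) measure" where
  "progressive_sigma T M Fl = sigma ({0..T} \<times> space M)
     {\<Gamma>. \<Gamma> \<subseteq> {0..T} \<times> space M \<and>
         (\<forall>t\<in>{0..T}. \<Gamma> \<inter> ({0..t} \<times> space M)
            \<in> sets (restrict_space borel {0..t} \<Otimes>\<^sub>M Fl t))}"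

definition predictable_sigma ::
    "real \<Rightarrow> 'w measure \<Rightarrow> (real \<Rightarrow> 'w measure) \<Rightarrow> (real \<times> 'w) measure" where
  "predictable_sigma T M Fl = sigma ({0..T} \<times> space M)
     ({{0} \<times> D | D. D \<in> sets (Fl 0)} \<union>
      {{s<..t} \<times> D | s t D. 0 \<le> s \<and> s < t \<and> t \<le> T \<and> D \<in> sets (Fl s)})"

definition generated_sets ::
    "'w measure \<Rightarrow> 'i set \<Rightarrow> ('i \<Rightarrow> 'w \<Rightarrow> 'b::topological_space) \<Rightarrow> 'w set set" where
  "generated_sets M I X =
     sigma_sets (space M) {X i -` D \<inter> space M | i D. i \<in> I \<and> D \<in> sets borel}"

text \<open>A cylindrical process \<open>W\<close> is not \<open>U\<close>-valued; \<open>W t \<omega> u\<close> stands for the inner product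
  of \<open>W\<^sub>t(\<omega>)\<close> and \<open>u\<close>.\<close>

definition cylindrical_wiener ::
    "real \<Rightarrow> 'w measure \<Rightarrow> (real \<Rightarrow> 'w measure) \<Rightarrow> (real \<Rightarrow> 'w \<Rightarrow> 'u::real_inner \<Rightarrow> real) \<Rightarrow> bool"
where
  "cylindrical_wiener T M Fl W \<longleftrightarrow>
     (\<forall>t\<in>{0..T}. \<forall>u. (\<lambda>\<omega>. W t \<omega> u) \<in> borel_measurable (Fl t)) \<and>
     (\<forall>t\<in>{0..T}. \<forall>a b u v. AE \<omega> in M.
        W t \<omega> (a *\<^sub>R u + b *\<^sub>R v) = a * W t \<omega> u + b * W t \<omega> v) \<and>
     (\<forall>u. AE \<omega> in M. W 0 \<omega> u = 0 \<and> continuous_on {0..T} (\<lambda>t. W t \<omega> u)) \<and>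
     (\<forall>s t u. 0 \<le> s \<and> s < t \<and> t \<le> T \<and> u \<noteq> 0 \<longrightarrow>
        distributed M lborel (\<lambda>\<omega>. W t \<omega> u - W s \<omega> u)
          (\<lambda>z. ennreal (normal_density 0 (sqrt (t - s) * norm u) z))) \<and>
     (\<forall>s t. 0 \<le> s \<and> s < t \<and> t \<le> T \<longrightarrow>
        prob_space.indep_set M (sets (Fl s)) (generated_sets M UNIV (\<lambda>u \<omega>. W t \<omega> u - W s \<omega> u)))"

text \<open>The projection of \<open>W\<close> onto the span of the first \<open>l\<close> basis vectors.\<close>

definition wiener_trunc :: "nat set \<Rightarrow> (nat \<Rightarrow> 'u::real_inner)
    \<Rightarrow> (real \<Rightarrow> 'w \<Rightarrow> 'u \<Rightarrow> real) \<Rightarrow> nat \<Rightarrow> real \<Rightarrow> 'w \<Rightarrow> 'u" where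
  "wiener_trunc J g W l t \<omega> = (\<Sum>k\<in>J \<inter> {1..l}. W t \<omega> (g k) *\<^sub>R g k)"

abbreviation (input) time_mark :: "real \<Rightarrow> 'e measure \<Rightarrow> (real \<times> 'e) measure" where
  "time_mark T \<nu> \<equiv> restrict_space lborel {0..T} \<Otimes>\<^sub>M \<nu>"

definition poisson_random_measure :: "real \<Rightarrow> 'w measure \<Rightarrow> (real \<Rightarrow> 'w measure)
    \<Rightarrow> 'e measure \<Rightarrow> ('w \<Rightarrow> (real \<times> 'e) measure) \<Rightarrow> bool" where
  "poisson_random_measure T M Fl \<nu> N \<longleftrightarrow>
     (\<forall>\<omega>\<in>space M. sets (N \<omega>) = sets (time_mark T \<nu>) \<and>
        (\<forall>D\<in>sets (time_mark T \<nu>). emeasure (N \<omega>) D \<in> insert \<infinity> (range of_nat))) \<and>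
     (\<forall>t\<in>{0..T}. \<forall>D\<in>sets (time_mark T \<nu>). D \<subseteq> {0..t} \<times> UNIV \<longrightarrow>
        (\<lambda>\<omega>. emeasure (N \<omega>) D) \<in> borel_measurable (Fl t)) \<and>
     (\<forall>D\<in>sets (time_mark T \<nu>).
        if emeasure (time_mark T \<nu>) D = \<infinity> then AE \<omega> in M. emeasure (N \<omega>) D = \<infinity>
        else \<forall>k. measure M {\<omega> \<in> space M. emeasure (N \<omega>) D = of_nat k} =
                 measure (time_mark T \<nu>) D ^ k / fact k * exp (- measure (time_mark T \<nu>) D)) \<and>
     (\<forall>D::nat \<Rightarrow> (real \<times> 'e) set. range D \<subseteq> sets (time_mark T \<nu>) \<and> disjoint_family D \<longrightarrow>
        prob_space.indep_vars M (\<lambda>_. borel) (\<lambda>i \<omega>. emeasure (N \<omega>) (D i)) UNIV) \<and>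
     (\<forall>s t. 0 \<le> s \<and> s < t \<and> t \<le> T \<longrightarrow>
        prob_space.indep_set M (sets (Fl s))
          (generated_sets M (sets \<nu>) (\<lambda>\<Gamma> \<omega>. emeasure (N \<omega>) ({s<..t} \<times> \<Gamma>))))"

definition independent_noises :: "real \<Rightarrow> 'w measure \<Rightarrow> 'e measure
    \<Rightarrow> (real \<Rightarrow> 'w \<Rightarrow> 'u::real_inner \<Rightarrow> real) \<Rightarrow> ('w \<Rightarrow> (real \<times> 'e) measure) \<Rightarrow> bool" where
  "independent_noises T M \<nu> W N \<longleftrightarrow> prob_space.indep_set M
     (generated_sets M ({0..T} \<times> UNIV) (\<lambda>(t, u) \<omega>. W t \<omega> u))
     (generated_sets M (sets (time_mark T \<nu>)) (\<lambda>D \<omega>. emeasure (N \<omega>) D))"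

text \<open>The integral of \<open>f\<close> against the compensated measure of \<open>(s, t]\<close>, for one realisation
  \<open>n\<close> of the Poisson random measure. It is only used for step functions \<open>f\<close> supported in a set of
  finite \<open>\<nu>\<close>-measure, where almost surely both integrals are finite sums.\<close>

definition compensated_integral :: "'e measure \<Rightarrow> (real \<times> 'e) measure \<Rightarrow> real \<Rightarrow> real
    \<Rightarrow> ('e \<Rightarrow> 'b::{banach, second_countable_topology}) \<Rightarrow> 'b" where
  "compensated_integral \<nu> n s t f =
     (LINT z:{s<..t} \<times> UNIV|n. f (snd z)) - (t - s) *\<^sub>R (LINT \<xi>|\<nu>. f \<xi>)"


section \<open>Discretisation\<close>

definition grid :: "real \<Rightarrow> nat \<Rightarrow> nat \<Rightarrow> real" where
  "grid T m i = real i * (T / real m)"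

definition A_disc ::
    "real \<Rightarrow> (real \<Rightarrow> 'w \<Rightarrow> 'v::real_normed_vector \<Rightarrow> ('v \<Rightarrow>\<^sub>L real))
     \<Rightarrow> nat \<Rightarrow> nat \<Rightarrow> 'w \<Rightarrow> 'v \<Rightarrow> ('v \<Rightarrow>\<^sub>L real)" where
  "A_disc T A m i \<omega> x = (1 / (T / real m)) *\<^sub>R
     op_integral (restrict_space lborel {grid T m (i - 1)..grid T m i}) (\<lambda>s. A s \<omega> x)"

definition B_disc ::
    "real \<Rightarrow> (real \<Rightarrow> 'w \<Rightarrow> 'v \<Rightarrow> ('u::real_normed_vector \<Rightarrow>\<^sub>L 'h::{banach, second_countable_topology}))
     \<Rightarrow> nat \<Rightarrow> nat \<Rightarrow> 'w \<Rightarrow> 'v \<Rightarrow> ('u \<Rightarrow>\<^sub>L 'h)" where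
  "B_disc T B m i \<omega> x = (if i \<le> 1 then 0 else (1 / (T / real m)) *\<^sub>R
     op_integral (restrict_space lborel {grid T m (i - 2)..grid T m (i - 1)}) (\<lambda>s. B s \<omega> x))"

text \<open>\<open>P\<close> is the set of cells of a finite partition of \<open>E\<^sup>l\<close>. Since the cells are disjoint, the sum
  consists of the term of the cell containing \<open>\<xi>\<close>, and it is \<open>0\<close> outside \<open>E\<^sup>l\<close>; division by
  \<open>0\<close> being \<open>0\<close>, cells of measure zero contribute \<open>0\<close>.\<close>

definition F_disc ::
    "real \<Rightarrow> 'e measure
     \<Rightarrow> (real \<Rightarrow> 'w \<Rightarrow> 'v \<Rightarrow> 'e \<Rightarrow> 'h::{banach, second_countable_topology})
     \<Rightarrow> 'e set set \<Rightarrow> nat \<Rightarrow> nat \<Rightarrow> 'w \<Rightarrow> 'v \<Rightarrow> 'e \<Rightarrow> 'h" where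
  "F_disc T \<nu> F P m i \<omega> x \<xi> = (if i \<le> 1 then 0 else
     (\<Sum>C\<in>P. indicator C \<xi> *\<^sub>R (1 / ((T / real m) * measure \<nu> C)) *\<^sub>R
        (LINT s:{grid T m (i - 2)..grid T m (i - 1)}|lborel. LINT \<eta>:C|\<nu>. F s \<omega> x \<eta>)))"

text \<open>\<open>e\<close> enumerates a basis of the finite-dimensional subspace from index \<open>1\<close> to \<open>d\<close>.\<close>

definition Pi_proj :: "nat \<Rightarrow> (nat \<Rightarrow> 'v::real_normed_vector) \<Rightarrow> ('v \<Rightarrow>\<^sub>L real) \<Rightarrow> 'v" where
  "Pi_proj d e \<phi> = (\<Sum>k=1..d. blinfun_apply \<phi> (e k) *\<^sub>R e k)"

text \<open>The equation is one in the dual of \<open>V\<close>. The unknown \<open>u i\<close> is \<open>V\<close>-valued and only constrained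
  for \<open>1 \<le> i \<le> m\<close>; the initial value \<open>\<zeta>\<close> lives in \<open>H\<close> and takes the place of \<open>u 0\<close>.
  For \<open>i = 1\<close> the argument \<open>u 0 \<omega>\<close> of the noise coefficients is immaterial, as these vanish.\<close>

definition solves_scheme ::
    "real \<Rightarrow> 'w measure \<Rightarrow> ('v::real_normed_vector \<Rightarrow>\<^sub>L 'h::{real_inner, banach, second_countable_topology})
     \<Rightarrow> (real \<Rightarrow> 'w \<Rightarrow> 'v \<Rightarrow> ('v \<Rightarrow>\<^sub>L real))
     \<Rightarrow> (real \<Rightarrow> 'w \<Rightarrow> 'v \<Rightarrow> ('u::real_inner \<Rightarrow>\<^sub>L 'h))
     \<Rightarrow> (real \<Rightarrow> 'w \<Rightarrow> 'v \<Rightarrow> 'e \<Rightarrow> 'h)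
     \<Rightarrow> nat set \<Rightarrow> (nat \<Rightarrow> 'u) \<Rightarrow> (real \<Rightarrow> 'w \<Rightarrow> 'u \<Rightarrow> real)
     \<Rightarrow> 'e measure \<Rightarrow> ('w \<Rightarrow> (real \<times> 'e) measure) \<Rightarrow> (nat \<Rightarrow> 'e set set) \<Rightarrow> ('w \<Rightarrow> 'h)
     \<Rightarrow> nat \<Rightarrow> nat \<Rightarrow> (nat \<Rightarrow> 'w \<Rightarrow> 'v) \<Rightarrow> bool" where
  "solves_scheme T M \<iota> A B F J g W \<nu> N P \<zeta> m l u \<longleftrightarrow>
     (\<forall>i\<in>{1..m}. AE \<omega> in M.
        H_to_dual \<iota> (blinfun_apply \<iota> (u i \<omega>)) =
          H_to_dual \<iota> (if i = 1 then \<zeta> \<omega> else blinfun_apply \<iota> (u (i - 1) \<omega>))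
          + (T / real m) *\<^sub>R A_disc T A m i \<omega> (u i \<omega>)
          + H_to_dual \<iota> (blinfun_apply (B_disc T B m i \<omega> (u (i - 1) \<omega>))
              (wiener_trunc J g W l (grid T m i) \<omega> - wiener_trunc J g W l (grid T m (i - 1)) \<omega>))
          + H_to_dual \<iota> (compensated_integral \<nu> (N \<omega>) (grid T m (i - 1)) (grid T m i)
              (F_disc T \<nu> F (P l) m i \<omega> (u (i - 1) \<omega>))))"

definition solves_projected_scheme ::
    "real \<Rightarrow> 'w measure \<Rightarrow> ('v::{banach, second_countable_topology} \<Rightarrow>\<^sub>L 'h::{real_inner, banach, second_countable_topology})
     \<Rightarrow> (real \<Rightarrow> 'w \<Rightarrow> 'v \<Rightarrow> ('v \<Rightarrow>\<^sub>L real))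
     \<Rightarrow> (real \<Rightarrow> 'w \<Rightarrow> 'v \<Rightarrow> ('u::real_inner \<Rightarrow>\<^sub>L 'h))
     \<Rightarrow> (real \<Rightarrow> 'w \<Rightarrow> 'v \<Rightarrow> 'e \<Rightarrow> 'h)
     \<Rightarrow> nat set \<Rightarrow> (nat \<Rightarrow> 'u) \<Rightarrow> (real \<Rightarrow> 'w \<Rightarrow> 'u \<Rightarrow> real)
     \<Rightarrow> 'e measure \<Rightarrow> ('w \<Rightarrow> (real \<times> 'e) measure) \<Rightarrow> (nat \<Rightarrow> 'e set set) \<Rightarrow> ('w \<Rightarrow> 'h)
     \<Rightarrow> nat \<Rightarrow> (nat \<Rightarrow> 'v) \<Rightarrow> nat \<Rightarrow> nat \<Rightarrow> (nat \<Rightarrow> 'w \<Rightarrow> 'v) \<Rightarrow> bool" where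
  "solves_projected_scheme T M \<iota> A B F J g W \<nu> N P \<zeta> d e m l u \<longleftrightarrow>
     (\<forall>i\<in>{0..m}. \<forall>\<omega>\<in>space M. u i \<omega> \<in> span (e ` {1..d})) \<and>
     (AE \<omega> in M. u 0 \<omega> = Pi_proj d e (H_to_dual \<iota> (\<zeta> \<omega>))) \<and>
     (\<forall>i\<in>{1..m}. AE \<omega> in M.
        u i \<omega> = u (i - 1) \<omega>
          + (T / real m) *\<^sub>R Pi_proj d e (A_disc T A m i \<omega> (u i \<omega>))
          + Pi_proj d e (H_to_dual \<iota> (blinfun_apply (B_disc T B m i \<omega> (u (i - 1) \<omega>))
              (wiener_trunc J g W l (grid T m i) \<omega> - wiener_trunc J g W l (grid T m (i - 1)) \<omega>)))
          + compensated_integral \<nu> (N \<omega>) (grid T m (i - 1)) (grid T m i)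
              (\<lambda>\<xi>. Pi_proj d e (H_to_dual \<iota> (F_disc T \<nu> F (P l) m i \<omega> (u (i - 1) \<omega>) \<xi>))))"

end

(* The noise enters step i explicitly, so each step asks for the solution u of D u = f with
   D = I - delta A_i, where f is known, measurable at time t_i and square integrable in H. For a
   fine grid the term mu of the coercivity is absorbed by |u|_H^2, so D is monotone, hemicontinuous
   and coercive; strict monotonicity in H gives uniqueness. Existence is the Browder-Minty theorem,
   obtained from finitely many monotonicity inequalities (Debrunner-Flor) and weak compactness of
   balls instead of a Galerkin approximation; this treats V and a finite-dimensional V_n alike,
   as weakly closed subspaces. By Minty's lemma, "u lies in a closed ball" is equivalent to
   countably many inequalities linear in u, which makes u measurable. Coercivity
   bounds lambda_i |u|_V^p by |f|_H^2 and integrable terms; conversely the growth condition and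
   coercivity bound B and F at u by |u|_V^p, and as the noise increments are independent of the past,
   the next right-hand side is again square integrable. *)

theory Submission
  imports Defs
begin

section \<open>Monotone operators on reflexive spaces\<close>

text \<open>The schemes alternate between two scales: the data of a step are square integrable in H,
  its solution has p-th moments in V. The way back to data is open because |x|_H^2 is at most a
  multiple of 1 + |x|_V^p, as p \<ge> 2, and because the noise coefficients of step i average over
  the interval that ends at t_{i-1}: they are known at t_{i-1}, so their squares need only be
  integrable to be multiplied by squared increments. The obstacle is measurability. The dual of V is
  accessed through scalar evaluations, and the solution is picked by choice on each path separately.
  What makes it measurable is that weak compactness reduces its presence in a closed ball to finite
  systems of slightly relaxed inequalities, and for these a countable dense set of candidates is
  enough. The exceptional null set of the assumptions is independent of x and t, so existence,
  uniqueness and a priori bounds are proved path by path, and completeness of the filtration permits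
  changes on null sets.\<close>

definition sublinear :: "('a::real_vector \<Rightarrow> real) \<Rightarrow> bool" where
  "sublinear f \<longleftrightarrow> (\<forall>x y. f (x + y) \<le> f x + f y) \<and> (\<forall>c\<ge>0. \<forall>x. f (c *\<^sub>R x) = c * f x)"

text \<open>A device to force linearity. The result is again sublinear and lies below
  \<open>f\<close>, so a minimal \<open>f\<close> coincides with it for every \<open>y\<close>.
  Taking t = 1 in the infimum then gives \<open>f x \<le> f (x + y) - f y\<close>, the reverse of
  subadditivity.\<close>

definition sublinear_step :: "('a::real_vector \<Rightarrow> real) \<Rightarrow> 'a \<Rightarrow> 'a \<Rightarrow> real" where
  "sublinear_step f y x = (INF t\<in>{0..}. f (x + t *\<^sub>R y) - t * f y)"

lemma sublinear_norm: "sublinear (norm :: 'a::real_normed_vector \<Rightarrow> real)"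
  by (simp add: sublinear_def norm_triangle_ineq)

context
  fixes f :: "'a::real_vector \<Rightarrow> real"
  assumes f: "sublinear f"
begin

lemma sublinear_add: "f (x + y) \<le> f x + f y"
  and sublinear_scale: "c \<ge> 0 \<Longrightarrow> f (c *\<^sub>R x) = c * f x"
  using f by (auto simp: sublinear_def)

lemma sublinear_zero: "f 0 = 0"
  using sublinear_scale[of 0 0] by simp

lemma sublinear_minus: "- f (- x) \<le> f x"
  using sublinear_add[of x "- x"] sublinear_zero by simp

lemma sublinear_step_lower: "t \<ge> 0 \<Longrightarrow> - f (- x) \<le> f (x + t *\<^sub>R y) - t * f y"
  using sublinear_add[of "x + t *\<^sub>R y" "- x"] sublinear_scale[of t y] by simp

lemma sublinear_step_bdd: "bdd_below ((\<lambda>t. f (x + t *\<^sub>R y) - t * f y) ` {0..})"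
  using sublinear_step_lower by (intro bdd_belowI2) auto

lemma sublinear_step_le: "t \<ge> 0 \<Longrightarrow> sublinear_step f y x \<le> f (x + t *\<^sub>R y) - t * f y"
  unfolding sublinear_step_def by (rule cINF_lower[OF sublinear_step_bdd]) simp

lemma sublinear_step_greatest:
  assumes "\<And>t. t \<ge> 0 \<Longrightarrow> c \<le> f (x + t *\<^sub>R y) - t * f y"
  shows "c \<le> sublinear_step f y x"
  unfolding sublinear_step_def using assms by (intro cINF_greatest) auto

lemma sublinear_step_le_self: "sublinear_step f y x \<le> f x"
  using sublinear_step_le[of 0 y x] by simp

lemma sublinear_step_neg: "sublinear_step f y (- y) \<le> - f y"
  using sublinear_step_le[of 1 y "- y"] sublinear_zero by simp

lemma sublinear_sublinear_step: "sublinear (sublinear_step f y)"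
  unfolding sublinear_def
proof (intro conjI allI impI)
  fix x z
  have "sublinear_step f y (x + z) - (f (z + s *\<^sub>R y) - s * f y) \<le> f (x + t *\<^sub>R y) - t * f y"
    if "t \<ge> 0" "s \<ge> 0" for t s
    using sublinear_step_le[of "t + s" y "x + z"] sublinear_add[of "x + t *\<^sub>R y" "z + s *\<^sub>R y"] that
    by (simp add: algebra_simps)
  then have "sublinear_step f y (x + z) - (f (z + s *\<^sub>R y) - s * f y) \<le> sublinear_step f y x"
    if "s \<ge> 0" for s using that by (intro sublinear_step_greatest) auto
  then have "sublinear_step f y (x + z) - sublinear_step f y x \<le> f (z + s *\<^sub>R y) - s * f y"
    if "s \<ge> 0" for s using that by fastforce
  then have "sublinear_step f y (x + z) - sublinear_step f y x \<le> sublinear_step f y z"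
    by (intro sublinear_step_greatest) auto
  then show "sublinear_step f y (x + z) \<le> sublinear_step f y x + sublinear_step f y z"
    by simp
next
  fix c :: real and x assume "c \<ge> 0"
  have half: "sublinear_step f y (c *\<^sub>R x) \<le> c * sublinear_step f y x" if c: "c > 0" for c x
  proof -
    have "sublinear_step f y (c *\<^sub>R x) / c \<le> f (x + t *\<^sub>R y) - t * f y" if t: "t \<ge> 0" for t
    proof -
      have "sublinear_step f y (c *\<^sub>R x) \<le> f (c *\<^sub>R (x + t *\<^sub>R y)) - c * t * f y"
        using sublinear_step_le[of "c * t" y "c *\<^sub>R x"] c t by (simp add: algebra_simps)
      also have "\<dots> = c * (f (x + t *\<^sub>R y) - t * f y)"
        using c by (simp only: sublinear_scale less_imp_le) (simp add: algebra_simps)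
      finally show ?thesis using c by (simp add: divide_le_eq mult.commute)
    qed
    then have "sublinear_step f y (c *\<^sub>R x) / c \<le> sublinear_step f y x"
      by (rule sublinear_step_greatest)
    then show ?thesis using c by (simp add: divide_le_eq mult.commute)
  qed
  show "sublinear_step f y (c *\<^sub>R x) = c * sublinear_step f y x"
  proof (cases "c = 0")
    case True
    have "sublinear_step f y 0 = 0"
      using sublinear_step_le_self[of y 0] sublinear_step_greatest[of 0 0 y]
      by (simp add: sublinear_zero sublinear_scale)
    then show ?thesis using True by simp
  next
    case False
    then have c: "c > 0" using \<open>c \<ge> 0\<close> by simp
    have "sublinear_step f y (inverse c *\<^sub>R c *\<^sub>R x) \<le> inverse c * sublinear_step f y (c *\<^sub>R x)"
      using c by (intro half) simp
    then have "c * sublinear_step f y x \<le> sublinear_step f y (c *\<^sub>R x)"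
      using c by (simp add: field_simps)
    then show ?thesis using half[OF c, of x] by simp
  qed
qed

end

text \<open>Zorn's lemma for the reversed order. The pointwise infimum of a chain is finite, because
  each member satisfies \<open>- f0 (- x) \<le> h x\<close>, and it is subadditive, because of two
  members of a chain the smaller one can replace both.\<close>

lemma minimal_sublinear_exists:
  fixes f0 :: "'a::real_vector \<Rightarrow> real"
  assumes f0: "sublinear f0"
  obtains f where "sublinear f" and "\<And>x. f x \<le> f0 x"
    and "\<And>h. sublinear h \<Longrightarrow> (\<And>x. h x \<le> f x) \<Longrightarrow> h = f"
proof -
  let ?A = "{h. sublinear h \<and> h \<le> f0}" and ?P = "\<lambda>h k::'a \<Rightarrow> real. k \<le> h"
  have "\<exists>m\<in>?A. \<forall>a\<in>?A. ?P m a \<longrightarrow> a = m"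
  proof (rule predicate_Zorn)
    show "partial_order_on ?A (relation_of ?P ?A)"
      by (rule partial_order_on_relation_ofI) auto
  next
    fix C assume C: "C \<in> Chains (relation_of ?P ?A)"
    then have CA: "h \<in> ?A" if "h \<in> C" for h
      using that by (auto simp: Chains_def relation_of_def)
    have tot: "h \<le> k \<or> k \<le> h" if "h \<in> C" "k \<in> C" for h k
      using C that by (auto simp: Chains_def relation_of_def)
    show "\<exists>u\<in>?A. \<forall>a\<in>C. ?P a u"
    proof (cases "C = {}")
      case True
      then show ?thesis using f0 by auto
    next
      case False
      define u where "u x = (INF h\<in>C. h x)" for x
      have bdd: "bdd_below ((\<lambda>h. h x) ` C)" for x
      proof (rule bdd_belowI2)
        fix h assume "h \<in> C"
        then have "sublinear h" "h \<le> f0" using CA by auto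
        then show "- f0 (- x) \<le> h x"
          using sublinear_minus[of h x] by (smt (verit) le_fun_def)
      qed
      have lower: "u x \<le> h x" if "h \<in> C" for h x
        unfolding u_def by (rule cINF_lower[OF bdd that])
      have great: "c \<le> u x" if "\<And>h. h \<in> C \<Longrightarrow> c \<le> h x" for c x
        unfolding u_def using False that by (intro cINF_greatest) auto
      have "sublinear u"
        unfolding sublinear_def
      proof (intro conjI allI impI)
        fix x y
        have *: "u (x + y) \<le> h x + k y" if "h \<in> C" "k \<in> C" for h k
        proof -
          have "\<exists>j\<in>C. j \<le> h \<and> j \<le> k" using tot[OF that] that by blast
          then obtain j where j: "j \<in> C" "j \<le> h" "j \<le> k" by blast
          have "u (x + y) \<le> j x + j y"
            using lower[OF j(1), of "x + y"] sublinear_add[of j x y] CA[OF j(1)] by simp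
          also have "\<dots> \<le> h x + k y" using j by (intro add_mono) (auto simp: le_fun_def)
          finally show ?thesis .
        qed
        then have "u (x + y) - h x \<le> u y" if "h \<in> C" for h
          using that by (intro great) (smt (verit))
        then have "u (x + y) - u y \<le> u x"
          by (intro great) (smt (verit))
        then show "u (x + y) \<le> u x + u y" by simp
      next
        fix c :: real and x assume c: "c \<ge> 0"
        show "u (c *\<^sub>R x) = c * u x"
        proof (cases "c = 0")
          case True
          have "u 0 = (INF h\<in>C. 0)" unfolding u_def
            using CA by (intro INF_cong) (auto simp: sublinear_zero)
          then show ?thesis using True False by simp
        next
          case c0: False
          have "u (c *\<^sub>R x) / c \<le> h x" if "h \<in> C" for h
            using lower[OF that, of "c *\<^sub>R x"] CA[OF that] c c0
            by (simp add: sublinear_scale divide_le_eq mult.commute)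
          then have "u (c *\<^sub>R x) / c \<le> u x" by (rule great)
          moreover have "c * u x \<le> u (c *\<^sub>R x)"
            using CA c lower by (intro great) (auto simp: sublinear_scale intro: mult_left_mono)
          ultimately show ?thesis using c c0 by (simp add: divide_le_eq mult.commute)
        qed
      qed
      moreover have "u \<le> f0"
        using False CA lower by (metis (no_types, lifting) all_not_in_conv le_fun_def mem_Collect_eq order_trans)
      ultimately show ?thesis using lower by (auto simp: le_fun_def)
    qed
  qed
  then obtain m where "sublinear m" "m \<le> f0" "\<And>a. sublinear a \<Longrightarrow> a \<le> f0 \<Longrightarrow> a \<le> m \<Longrightarrow> a = m"
    by auto
  then show ?thesis
    by (intro that[of m]) (auto simp: le_fun_def, metis order_trans)
qed

text \<open>The minimal functional is taken below \<open>sublinear_step norm v\<close> instead of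
  below the norm: this function is at most \<open>- norm v\<close> at \<open>- v\<close>, which
  forces the value at \<open>v\<close> to be at least \<open>norm v\<close>.\<close>

lemma norming_functional:
  fixes v :: "'a::real_normed_vector"
  obtains \<phi> :: "'a \<Rightarrow>\<^sub>L real" where "norm \<phi> \<le> 1" "\<phi> v = norm v"
proof -
  define f0 where "f0 = sublinear_step norm v"
  have "sublinear f0" unfolding f0_def by (rule sublinear_sublinear_step[OF sublinear_norm])
  then obtain f where f: "sublinear f" and le: "\<And>x. f x \<le> f0 x"
    and min: "\<And>h. sublinear h \<Longrightarrow> (\<And>x. h x \<le> f x) \<Longrightarrow> h = f"
    by (rule minimal_sublinear_exists) blast
  have step: "sublinear_step f y = f" for y
    by (intro min sublinear_sublinear_step f sublinear_step_le_self)
  have add: "f (x + y) = f x + f y" for x y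
    using sublinear_step_le[OF f, of 1 y x] sublinear_add[OF f, of x y] step by (simp add: fun_eq_iff)
  have neg: "f (- x) = - f x" for x
    using add[of x "- x"] sublinear_zero[OF f] by simp
  have scale: "f (c *\<^sub>R x) = c * f x" for c x
    using sublinear_scale[OF f, of c x] sublinear_scale[OF f, of "- c" x] neg[of "c *\<^sub>R x"]
    by (cases "c \<ge> 0") auto
  have bd: "\<bar>f x\<bar> \<le> norm x" for x
    using le[of x] le[of "- x"] neg[of x] sublinear_step_le_self[OF sublinear_norm, of v]
    unfolding f0_def by (smt (verit) norm_minus_cancel)
  have lin: "bounded_linear f"
    by (rule bounded_linear_intro[where K = 1]) (simp_all add: add scale bd)
  show ?thesis
  proof
    show "norm (Blinfun f) \<le> 1"
      by (rule norm_blinfun_bound) (simp_all add: bounded_linear_Blinfun_apply[OF lin] bd)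
    have "f v \<ge> norm v"
      using le[of "- v"] neg[of v] sublinear_step_neg[OF sublinear_norm, of v]
      unfolding f0_def by linarith
    then show "Blinfun f v = norm v"
      using bd[of v] by (simp add: bounded_linear_Blinfun_apply[OF lin])
  qed
qed

section \<open>Weak compactness of balls\<close>

text \<open>Banach-Alaoglu in the bidual. Functionals within \<open>r * norm \<phi>\<close> of the
  evaluation at \<open>a\<close> lie in a product of compact intervals; linearity and vanishing on
  \<open>L\<close> are closed conditions there. Reflexivity turns a point of the intersection into a
  vector, and a norming functional returns the bound on \<open>norm (x - a)\<close>. It is used for
  existence and again for measurability.\<close>

lemma weak_fip:
  fixes w :: "'i \<Rightarrow> 'v::real_normed_vector \<Rightarrow>\<^sub>L real" and L :: "('v \<Rightarrow>\<^sub>L real) set"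
  assumes refl: "reflexive_space TYPE('v)"
    and fin: "\<And>J. finite J \<Longrightarrow> J \<subseteq> I \<Longrightarrow>
      \<exists>x. norm (x - a) \<le> r \<and> (\<forall>\<phi>\<in>L. \<phi> x = 0) \<and> (\<forall>i\<in>J. w i x \<le> c i)"
  shows "\<exists>x. norm (x - a) \<le> r \<and> (\<forall>\<phi>\<in>L. \<phi> x = 0) \<and> (\<forall>i\<in>I. w i x \<le> c i)"
proof -
  let ?Q = "PiE UNIV (\<lambda>\<phi> :: 'v \<Rightarrow>\<^sub>L real. cball (blinfun_apply \<phi> a) (r * norm \<phi>))"
  define Lin where "Lin = {\<Phi> :: ('v \<Rightarrow>\<^sub>L real) \<Rightarrow> real. (\<forall>\<phi> \<psi>. \<Phi> (\<phi> + \<psi>) = \<Phi> \<phi> + \<Phi> \<psi>) \<and>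
    (\<forall>s \<phi>. \<Phi> (s *\<^sub>R \<phi>) = s * \<Phi> \<phi>) \<and> (\<forall>\<phi>\<in>L. \<Phi> \<phi> = 0)}"
  have "compactin (product_topology (\<lambda>_. euclidean) UNIV) ?Q"
    by (subst compactin_PiE) (simp add: compact_cball)
  then have Q: "compact ?Q"
    by (simp add: euclidean_product_topology)
  have "closed Lin"
    unfolding Lin_def Ball_def
    by (intro closed_Collect_conj closed_Collect_all closed_Collect_imp closed_Collect_eq
        open_Collect_const) (auto intro!: continuous_intros)
  with Q have comp: "compact (?Q \<inter> Lin)" by (rule compact_Int_closed)
  have ev: "(\<lambda>\<phi>. blinfun_apply \<phi> x) \<in> ?Q \<inter> Lin"
    if x: "norm (x - a) \<le> r" "\<forall>\<phi>\<in>L. \<phi> x = 0" for x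
  proof -
    have "\<bar>\<phi> a - \<phi> x\<bar> \<le> r * norm \<phi>" for \<phi> :: "'v \<Rightarrow>\<^sub>L real"
    proof -
      have "\<bar>\<phi> (x - a)\<bar> \<le> norm \<phi> * norm (x - a)"
        using norm_blinfun[of \<phi> "x - a"] by simp
      also have "\<dots> \<le> norm \<phi> * r" using x(1) by (intro mult_left_mono) auto
      finally show ?thesis by (simp add: blinfun.diff_right mult.commute abs_minus_commute)
    qed
    then show ?thesis using x(2)
      by (auto simp: Lin_def dist_real_def plus_blinfun.rep_eq scaleR_blinfun.rep_eq)
  qed
  have "(?Q \<inter> Lin) \<inter> (\<Inter>i\<in>I. {\<Phi>. \<Phi> (w i) \<le> c i}) \<noteq> {}"
  proof (rule compact_imp_fip_image[OF comp])
    show "closed {\<Phi>. \<Phi> (w i) \<le> c i}" for i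
      by (intro closed_Collect_le) (auto intro!: continuous_intros)
    fix J assume "finite J" "J \<subseteq> I"
    from fin[OF this] obtain x where x: "norm (x - a) \<le> r" "\<forall>\<phi>\<in>L. \<phi> x = 0"
      "\<forall>i\<in>J. w i x \<le> c i" by blast
    then have "(\<lambda>\<phi>. blinfun_apply \<phi> x) \<in> ?Q \<inter> Lin \<inter> (\<Inter>i\<in>J. {\<Phi>. \<Phi> (w i) \<le> c i})"
      using ev[OF x(1,2)] by simp
    then show "?Q \<inter> Lin \<inter> (\<Inter>i\<in>J. {\<Phi>. \<Phi> (w i) \<le> c i}) \<noteq> {}" by blast
  qed
  then obtain \<Phi> where \<Phi>: "\<Phi> \<in> ?Q" "\<Phi> \<in> Lin" and le: "\<And>i. i \<in> I \<Longrightarrow> \<Phi> (w i) \<le> c i" by auto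
  have bd: "\<bar>\<Phi> \<phi> - \<phi> a\<bar> \<le> r * norm \<phi>" for \<phi>
    using \<Phi>(1) by (auto simp: PiE_iff dist_real_def abs_minus_commute)
  have "bounded_linear \<Phi>"
  proof (rule bounded_linear_intro[where K = "r + norm a"])
    fix \<phi> :: "'v \<Rightarrow>\<^sub>L real"
    have "\<bar>\<phi> a\<bar> \<le> norm \<phi> * norm a" using norm_blinfun[of \<phi> a] by simp
    then show "norm (\<Phi> \<phi>) \<le> norm \<phi> * (r + norm a)"
      using bd[of \<phi>] by (simp add: algebra_simps)
  qed (use \<Phi>(2) in \<open>auto simp: Lin_def\<close>)
  then obtain x where x: "\<And>\<phi>. \<Phi> \<phi> = \<phi> x"
    using refl unfolding reflexive_space_def by (metis bounded_linear_Blinfun_apply)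
  obtain \<phi> :: "'v \<Rightarrow>\<^sub>L real" where \<phi>: "norm \<phi> \<le> 1" "\<phi> (x - a) = norm (x - a)"
    by (rule norming_functional)
  have "r \<ge> 0" using fin[of "{}"] by (auto intro: order_trans[OF norm_ge_zero])
  then have "norm (x - a) \<le> r"
    using bd[of \<phi>] x[of \<phi>] \<phi> mult_left_mono[OF \<phi>(1) \<open>r \<ge> 0\<close>] by (simp add: blinfun.diff_right)
  then show ?thesis using x le \<Phi>(2) by (auto simp: Lin_def)
qed

section \<open>Finite systems of monotonicity inequalities\<close>

text \<open>Replaces the squared positive part by a genuine quadratic in the increment, so that the
  first-order condition at a minimiser follows by expanding a square instead of
  differentiating.\<close>

lemma max_zero_power2_le: "(max 0 (a + b))\<^sup>2 \<le> (max 0 a + b :: real)\<^sup>2"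
  by (intro abs_le_square_iff[THEN iffD1]) auto

lemma quadratic_nonneg_imp_linear_nonneg:
  fixes a b :: real
  assumes "\<And>t. 0 < t \<Longrightarrow> t \<le> 1 \<Longrightarrow> 0 \<le> 2 * t * a + t\<^sup>2 * b"
  shows "0 \<le> a"
proof -
  have "((\<lambda>t. 2 * a + t * b) \<longlongrightarrow> 2 * a + 0 * b) (at_right 0)"
    by (intro tendsto_intros)
  moreover
  have "2 * a + t * b \<ge> 0" if "0 < t" "t \<le> 1" for t
  proof -
    have "0 \<le> t * (2 * a + t * b)"
      using assms[OF that] by (simp add: power2_eq_square algebra_simps)
    then show ?thesis using that(1) by (simp add: zero_le_mult_iff)
  qed
  then have "eventually (\<lambda>t. 0 \<le> (2 * a + t * b)) (at_right 0)"
    unfolding eventually_at_right_field by (intro exI[of _ 1]) auto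
  ultimately have "0 \<le> 2 * a + 0 * b"
    by (rule tendsto_lowerbound) simp
  then show ?thesis by simp
qed

text \<open>The point minimises the sum of squared violations \<open>l y\<close> over the compact
  hull. If some violation were positive, the normalised weights \<open>l y / s\<close> would define
  a hull point \<open>z\<close>. The first-order condition in the direction of \<open>z\<close>
  bounds the sum of \<open>l y * w y (z - y)\<close> below by the sum of squares of the
  \<open>l y\<close>, whereas monotonicity makes it nonpositive.\<close>

lemma Debrunner_Flor:
  fixes w :: "'v::real_normed_vector \<Rightarrow> 'v \<Rightarrow>\<^sub>L real"
  assumes Y: "finite Y" "Y \<noteq> {}"
    and mono: "\<And>y z. y \<in> Y \<Longrightarrow> z \<in> Y \<Longrightarrow> 0 \<le> (w y - w z) (y - z)"
  shows "\<exists>x\<in>convex hull Y. \<forall>y\<in>Y. 0 \<le> w y (y - x)"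
proof -
  let ?K = "convex hull Y"
  define h where "h x = (\<Sum>y\<in>Y. (max 0 (w y (x - y)))\<^sup>2)" for x
  have "continuous_on ?K h" unfolding h_def by (intro continuous_intros)
  moreover have "compact ?K" using Y by (simp add: finite_imp_compact_convex_hull)
  ultimately obtain x where x: "x \<in> ?K" and min: "\<And>z. z \<in> ?K \<Longrightarrow> h x \<le> h z"
    using continuous_attains_inf[of ?K h] Y by auto
  define l where "l y = max 0 (w y (x - y))" for y
  have first_order: "0 \<le> (\<Sum>y\<in>Y. l y * w y (z - x))" if z: "z \<in> ?K" for z
  proof (rule quadratic_nonneg_imp_linear_nonneg)
    fix t :: real assume t: "0 < t" "t \<le> 1"
    let ?b = "\<lambda>y. w y (z - x)"
    have "x + t *\<^sub>R (z - x) = (1 - t) *\<^sub>R x + t *\<^sub>R z" by (simp add: algebra_simps)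
    then have "x + t *\<^sub>R (z - x) \<in> ?K" using convexD_alt[OF convex_convex_hull x z] t by simp
    then have "h x \<le> h (x + t *\<^sub>R (z - x))" by (rule min)
    also have "\<dots> \<le> (\<Sum>y\<in>Y. (l y + t * ?b y)\<^sup>2)"
      unfolding h_def
    proof (rule sum_mono)
      fix y
      have "w y (x + t *\<^sub>R (z - x) - y)
          = w y (x - y) + t * ?b y"
        by (simp add: blinfun.diff_right blinfun.add_right blinfun.scaleR_right algebra_simps)
      then show "(max 0 (w y (x + t *\<^sub>R (z - x) - y)))\<^sup>2 \<le> (l y + t * ?b y)\<^sup>2"
        unfolding l_def using max_zero_power2_le by simp
    qed
    also have "\<dots> = h x + 2 * t * (\<Sum>y\<in>Y. l y * ?b y) + t\<^sup>2 * (\<Sum>y\<in>Y. (?b y)\<^sup>2)"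
      unfolding h_def l_def[symmetric]
      by (simp add: power2_eq_square algebra_simps sum.distrib sum_distrib_left)
    finally show "0 \<le> 2 * t * (\<Sum>y\<in>Y. l y * ?b y) + t\<^sup>2 * (\<Sum>y\<in>Y. (?b y)\<^sup>2)" by simp
  qed
  have l0: "l y \<ge> 0" for y by (simp add: l_def)
  define s where "s = sum l Y"
  have "s = 0"
  proof (rule ccontr)
    assume "s \<noteq> 0"
    then have s: "s > 0" unfolding s_def using l0 by (simp add: sum_nonneg less_le)
    define z where "z = (\<Sum>y\<in>Y. (l y / s) *\<^sub>R y)"
    have "z \<in> ?K" unfolding z_def
      using s l0 Y by (intro convex_sum) (auto simp: hull_inc s_def simp flip: sum_divide_distrib)
    have sz: "(\<Sum>y\<in>Y. l y *\<^sub>R y) = s *\<^sub>R z"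
      unfolding z_def using s by (simp add: scaleR_sum_right)
    have "l y * w y (x - y) = (l y)\<^sup>2" for y
      by (auto simp: l_def max_def power2_eq_square)
    then have sq: "(\<Sum>y\<in>Y. l y * w y (x - y)) = (\<Sum>y\<in>Y. (l y)\<^sup>2)" by simp
    have "l y * w y (z - y)
        = l y * w y (z - x) + l y * w y (x - y)" for y
      by (simp add: blinfun.diff_right algebra_simps)
    then have "(\<Sum>y\<in>Y. l y * w y (z - y))
        = (\<Sum>y\<in>Y. l y * w y (z - x)) + (\<Sum>y\<in>Y. (l y)\<^sup>2)"
      by (simp add: sum.distrib sq)
    then have ge: "(\<Sum>y\<in>Y. l y * w y (z - y)) \<ge> (\<Sum>y\<in>Y. (l y)\<^sup>2)"
      using first_order[OF \<open>z \<in> ?K\<close>] by simp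
    define d where "d = (\<Sum>y\<in>Y. \<Sum>v\<in>Y. l y * l v * w y (v - y))"
    have "s * (\<Sum>y\<in>Y. l y * w y (z - y)) = d"
    proof -
      have "s * w y (z - y) = (\<Sum>v\<in>Y. l v * w y (v - y))" for y
      proof -
        have "s * w y (z - y) = w y (s *\<^sub>R z) - s * w y y"
          by (simp add: blinfun.diff_right blinfun.scaleR_right algebra_simps)
        also have "\<dots> = (\<Sum>v\<in>Y. l v * w y v) - (\<Sum>v\<in>Y. l v * w y y)"
          unfolding sz[symmetric] by (simp add: blinfun.sum_right blinfun.scaleR_right sum_distrib_right s_def)
        finally show ?thesis
          by (simp add: blinfun.diff_right right_diff_distrib sum_subtractf)
      qed
      then show ?thesis
        unfolding d_def by (simp add: sum_distrib_left mult.assoc mult.left_commute[of s])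
    qed
    \<comment> \<open>Interchanging \<open>y\<close> and \<open>v\<close> and adding both forms of
      the double sum produces the monotonicity differences with a minus sign.\<close>
    moreover have "d \<le> 0"
    proof -
      have "d = (\<Sum>y\<in>Y. \<Sum>v\<in>Y. l y * l v * w v (y - v))"
        unfolding d_def by (subst sum.swap) (simp add: mult.commute)
      then have "d + d = (\<Sum>y\<in>Y. \<Sum>v\<in>Y. - (l y * l v * (w y - w v) (y - v)))"
        by (subst (1) d_def) (simp add: blinfun.diff_left blinfun.diff_right algebra_simps flip: sum.distrib)
      also have "\<dots> \<le> 0"
        using l0 mono by (intro sum_nonpos) simp
      finally show ?thesis by simp
    qed
    ultimately have "(\<Sum>y\<in>Y. l y * w y (z - y)) \<le> 0"
      using s by (metis mult_le_0_iff not_less)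
    then have "(\<Sum>y\<in>Y. (l y)\<^sup>2) \<le> 0" using ge by simp
    then have "(\<Sum>y\<in>Y. (l y)\<^sup>2) = 0" by (simp add: antisym sum_nonneg)
    then have "\<forall>y\<in>Y. l y = 0" using Y by (simp add: sum_nonneg_eq_0_iff)
    then show False using s by (simp add: s_def)
  qed
  then have "\<forall>y\<in>Y. l y = 0" unfolding s_def using Y l0 by (simp add: sum_nonneg_eq_0_iff)
  then have "\<forall>y\<in>Y. 0 \<le> w y (y - x)"
    by (auto simp: l_def max_def blinfun.diff_right split: if_splits)
  then show ?thesis using x by blast
qed

section \<open>The Browder-Minty theorem on weakly closed subspaces\<close>

text \<open>Describing a subspace by functionals makes membership a condition on the values of an
  element of the bidual, which is how \<open>weak_fip\<close> preserves it. The empty set gives all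
  of V, and \<open>span_functionals\<close> a Galerkin space.\<close>

definition annihilated :: "('v::real_normed_vector \<Rightarrow>\<^sub>L real) set \<Rightarrow> 'v set" where
  "annihilated L = {x. \<forall>\<phi>\<in>L. \<phi> x = 0}"

lemma subspace_annihilated: "subspace (annihilated L)"
  by (auto simp: subspace_def annihilated_def blinfun.add_right blinfun.scaleR_right)

definition monotone_operator :: "('v::real_normed_vector \<Rightarrow> 'v \<Rightarrow>\<^sub>L real) \<Rightarrow> bool" where
  "monotone_operator D \<longleftrightarrow> (\<forall>x y. 0 \<le> (D x - D y) (x - y))"

definition hemicontinuous :: "('v::real_normed_vector \<Rightarrow> 'v \<Rightarrow>\<^sub>L real) \<Rightarrow> bool" where
  "hemicontinuous D \<longleftrightarrow> (\<forall>x y z. ((\<lambda>r. (D (x + r *\<^sub>R y)) z) \<longlongrightarrow> D x z) (at 0))"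

lemma hemicontinuous_at_right:
  "hemicontinuous D \<Longrightarrow> ((\<lambda>r. (D (x + r *\<^sub>R y)) z) \<longlongrightarrow> D x z) (at_right 0)"
  unfolding hemicontinuous_def by (meson filterlim_at_split)

text \<open>Minty's trick: test the inequality at \<open>y = x + t *\<^sub>R (z - x)\<close>, divide
  by t and let t tend to 0. Hemicontinuity moves the argument of \<open>D\<close> from
  \<open>y\<close> back to \<open>x\<close>.\<close>

lemma Minty:
  assumes hemi: "hemicontinuous D" and K: "convex K" "x \<in> K" "z \<in> K"
    and le: "\<And>y. y \<in> K \<Longrightarrow> 0 \<le> (D y - f) (y - x)"
  shows "0 \<le> (D x - f) (z - x)"
proof -
  have "((\<lambda>t. (D (x + t *\<^sub>R (z - x))) (z - x) - f (z - x))
      \<longlongrightarrow> D x (z - x) - f (z - x)) (at_right 0)"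
    by (intro tendsto_intros hemicontinuous_at_right hemi)
  moreover have "0 \<le> (D (x + t *\<^sub>R (z - x))) (z - x) - f (z - x)"
    if t: "0 < t" "t \<le> 1" for t
  proof -
    have "x + t *\<^sub>R (z - x) = (1 - t) *\<^sub>R x + t *\<^sub>R z" by (simp add: algebra_simps)
    then have "x + t *\<^sub>R (z - x) \<in> K" using convexD_alt[OF K] t by simp
    from le[OF this] have "0 \<le> t * (D (x + t *\<^sub>R (z - x)) - f) (z - x)"
      by (simp add: blinfun.scaleR_right)
    then show ?thesis using t by (simp add: zero_le_mult_iff blinfun.diff_left)
  qed
  then have "eventually (\<lambda>t. 0 \<le> (D (x + t *\<^sub>R (z - x))) (z - x) - f (z - x)) (at_right 0)"
    unfolding eventually_at_right_field by (intro exI[of _ 1]) auto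
  ultimately have "0 \<le> D x (z - x) - f (z - x)"
    by (rule tendsto_lowerbound) simp
  then show ?thesis by (simp add: blinfun.diff_left)
qed

lemma Minty_subspace:
  assumes hemi: "hemicontinuous D" and S: "subspace S" "x \<in> S" "v \<in> S"
    and le: "\<And>y. y \<in> S \<Longrightarrow> 0 \<le> (D y - f) (y - x)"
  shows "D x v = f v"
proof -
  have "0 \<le> (D x - f) (x + v - x)" "0 \<le> (D x - f) (x - v - x)"
    by (rule Minty[OF hemi subspace_imp_convex[OF S(1)] S(2) _ le];
        use S in \<open>auto intro: subspace_add subspace_diff\<close>)+
  then show ?thesis by (simp add: blinfun.diff_left blinfun.minus_right)
qed

text \<open>A solution of the variational inequality on a ball of radius \<open>R\<close> lies in its interior by
  coercivity, and therefore solves the equation.\<close>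

lemma Browder_Minty:
  fixes D :: "'v::real_normed_vector \<Rightarrow> 'v \<Rightarrow>\<^sub>L real" and f :: "'v \<Rightarrow>\<^sub>L real"
  assumes refl: "reflexive_space TYPE('v)"
    and mono: "monotone_operator D" and hemi: "hemicontinuous D"
    and R: "R > 0" "\<And>x. norm x = R \<Longrightarrow> f x < D x x"
  shows "\<exists>x\<in>annihilated L. \<forall>v\<in>annihilated L. D x v = f v"
proof -
  let ?S = "annihilated L" and ?K = "annihilated L \<inter> cball 0 R"
  note S = subspace_annihilated[of L]
  have convK: "convex ?K" using S by (intro convex_Int subspace_imp_convex convex_cball)
  have "\<exists>x. norm (x - 0) \<le> R \<and> (\<forall>\<phi>\<in>L. \<phi> x = 0) \<and>
      (\<forall>y\<in>?K. (D y - f) x \<le> (D y - f) y)"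
  \<comment> \<open>A finite subset of the ball is served by \<open>Debrunner_Flor\<close> for
    \<open>D y - f\<close>, where \<open>f\<close> cancels in the monotonicity differences; the hull
    stays in the convex set \<open>?K\<close>.\<close>
  proof (rule weak_fip[OF refl])
    fix Y assume Y: "finite Y" "Y \<subseteq> ?K"
    show "\<exists>x. norm (x - 0) \<le> R \<and> (\<forall>\<phi>\<in>L. \<phi> x = 0) \<and>
      (\<forall>y\<in>Y. (D y - f) x \<le> (D y - f) y)"
    proof (cases "Y = {}")
      case True
      then show ?thesis using R(1) by (intro exI[of _ 0]) simp
    next
      case False
      obtain x where "x \<in> convex hull Y" "\<forall>y\<in>Y. 0 \<le> (D y - f) (y - x)"
        using Debrunner_Flor[OF Y(1) False, of "\<lambda>y. D y - f"] mono
        unfolding monotone_operator_def by auto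
      moreover have "convex hull Y \<subseteq> ?K" using Y(2) convK by (rule hull_minimal)
      ultimately show ?thesis
        by (intro exI[of _ x]) (auto simp: annihilated_def blinfun.diff_right)
    qed
  qed
  then obtain x where xS: "x \<in> ?S" and xR: "norm x \<le> R"
    and le: "\<And>y. y \<in> ?K \<Longrightarrow> 0 \<le> (D y - f) (y - x)"
    by (auto simp: annihilated_def blinfun.diff_right)
  have var: "0 \<le> (D x - f) (z - x)" if "z \<in> ?K" for z
    by (rule Minty[OF hemi convK _ that le]) (use xS xR in auto)
  have "D x x \<le> f x"
    using var[of 0] R(1) subspace_0[OF S] by (simp add: blinfun.diff_left blinfun.minus_right)
  then have x_less: "norm x < R" using R(2)[of x] xR by force
  have ge: "0 \<le> (D x - f) v" if v: "v \<in> ?S" for v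
  proof -
    \<comment> \<open>A step so short that \<open>x + t *\<^sub>R v\<close> remains in the ball; the
      added 1 covers \<open>v = 0\<close>.\<close>
    define t where "t = (R - norm x) / (norm v + 1)"
    have t: "t > 0" unfolding t_def using x_less by (intro divide_pos_pos add_nonneg_pos) auto
    have "t * norm v \<le> R - norm x"
      unfolding t_def using x_less by (simp add: pos_divide_le_eq add_nonneg_pos mult_left_mono)
    then have "norm (x + t *\<^sub>R v) \<le> R"
      using t by (intro order_trans[OF norm_triangle_ineq]) simp
    then have "x + t *\<^sub>R v \<in> ?K" using xS v S by (simp add: subspace_add subspace_scale)
    from var[OF this] show ?thesis
      using t by (simp add: blinfun.scaleR_right zero_le_mult_iff)
  qed
  have "D x v = f v" if v: "v \<in> ?S" for v
    using ge[OF v] ge[of "- v"] subspace_neg[OF S v]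
    by (simp add: blinfun.diff_left blinfun.minus_right)
  then show ?thesis using xS by blast
qed

section \<open>Demicontinuity and measurability of the solution\<close>

definition demicontinuous :: "('v::real_normed_vector \<Rightarrow> 'v \<Rightarrow>\<^sub>L real) \<Rightarrow> bool" where
  "demicontinuous D \<longleftrightarrow> (\<forall>X x z. X \<longlonglongrightarrow> x \<longrightarrow>
     (\<lambda>n. (D (X n)) z) \<longlonglongrightarrow> D x z)"

text \<open>Monotonicity between \<open>X n\<close> and \<open>x + t *\<^sub>R z\<close> bounds
  \<open>t * D (X n) z\<close> by \<open>D (X n) (X n - x)\<close>, which vanishes in the limit by
  local boundedness, plus terms tending to \<open>t * E z\<close>, where \<open>E\<close> is
  \<open>D\<close> at \<open>x + t *\<^sub>R z\<close>. Hemicontinuity makes \<open>E z\<close>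
  close to \<open>D x z\<close> for small t. The lower estimate is the upper one for
  \<open>- z\<close>.\<close>

lemma monotone_imp_demicontinuous:
  fixes D :: "'v::real_normed_vector \<Rightarrow> 'v \<Rightarrow>\<^sub>L real"
  assumes mono: "monotone_operator D" and hemi: "hemicontinuous D"
    and bdd: "\<And>\<rho>. \<exists>C. \<forall>x. norm x \<le> \<rho> \<longrightarrow> norm (D x) \<le> C"
  shows "demicontinuous D"
  unfolding demicontinuous_def
proof (intro allI impI)
  fix X :: "nat \<Rightarrow> 'v" and x z assume X: "X \<longlonglongrightarrow> x"
  obtain \<rho> where "\<forall>n. norm (X n) \<le> \<rho>"
    using convergent_imp_Bseq[OF convergentI[OF X]] unfolding Bseq_def by blast
  moreover obtain C where "\<forall>x. norm x \<le> \<rho> \<longrightarrow> norm (D x) \<le> C" using bdd by blast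
  ultimately have C: "norm (D (X n)) \<le> C" for n by simp
  have upper: "\<forall>\<^sub>F n in sequentially. (D (X n)) z < D x z + \<epsilon>"
    if \<epsilon>: "\<epsilon> > 0" for z \<epsilon>
  proof -
    have "\<forall>\<^sub>F t in at_right 0. dist ((D (x + t *\<^sub>R z)) z) (D x z) < \<epsilon>"
      using hemicontinuous_at_right[OF hemi] \<epsilon> by (rule tendstoD)
    moreover have "\<forall>\<^sub>F t in at_right (0::real). t > 0" by (simp add: eventually_at_right_less)
    ultimately have "\<forall>\<^sub>F t in at_right 0. t > 0 \<and> (D (x + t *\<^sub>R z)) z < D x z + \<epsilon>"
      by eventually_elim (auto simp: dist_real_def)
    then obtain t where t: "t > 0" "(D (x + t *\<^sub>R z)) z < D x z + \<epsilon>"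
      using eventually_happens'[OF trivial_limit_at_right_real] by blast
    define E where "E = D (x + t *\<^sub>R z)"
    have "(\<lambda>n. C * norm (X n - x) - E (X n - x - t *\<^sub>R z))
        \<longlonglongrightarrow> C * norm (x - x) - E (x - x - t *\<^sub>R z)"
      by (intro tendsto_intros X)
    then have lim: "(\<lambda>n. C * norm (X n - x) - E (X n - x - t *\<^sub>R z)) \<longlonglongrightarrow> t * E z"
      by (simp add: blinfun.minus_right blinfun.scaleR_right)
    have "t * E z < t * (D x z + \<epsilon>)"
      using t unfolding E_def by simp
    with lim have "\<forall>\<^sub>F n in sequentially.
        C * norm (X n - x) - E (X n - x - t *\<^sub>R z) < t * (D x z + \<epsilon>)"
      by (rule order_tendstoD(2))
    then show ?thesis
    proof eventually_elim
      case (elim n)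
      have "0 \<le> (D (X n) - E) (X n - (x + t *\<^sub>R z))"
        using mono unfolding monotone_operator_def E_def by blast
      then have "t * (D (X n)) z
          \<le> (D (X n)) (X n - x) - E (X n - x - t *\<^sub>R z)"
        by (simp add: blinfun.diff_left blinfun.diff_right blinfun.add_right blinfun.scaleR_right algebra_simps)
      also have "(D (X n)) (X n - x) \<le> C * norm (X n - x)"
        using norm_blinfun[of "D (X n)" "X n - x"] mult_right_mono[OF C[of n], of "norm (X n - x)"]
        by simp
      finally have "t * (D (X n)) z < t * (D x z + \<epsilon>)"
        using elim by simp
      then show ?case using t by simp
    qed
  qed
  show "(\<lambda>n. (D (X n)) z) \<longlonglongrightarrow> D x z"
  proof (rule tendstoI)
    fix \<epsilon> :: real assume \<epsilon>: "\<epsilon> > 0"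
    from upper[OF \<epsilon>, of z] upper[OF \<epsilon>, of "- z"]
    show "\<forall>\<^sub>F n in sequentially. dist ((D (X n)) z) (D x z) < \<epsilon>"
      by eventually_elim (auto simp: dist_real_def blinfun.minus_right)
  qed
qed

lemma demicontinuous_tendsto:
  assumes D: "demicontinuous D" and X: "X \<longlonglongrightarrow> x"
    and bdd: "\<And>n. norm (D (X n)) \<le> C"
  shows "(\<lambda>n. (D (X n) - f) (X n - z)) \<longlonglongrightarrow> (D x - f) (x - z)"
proof -
  have 1: "(\<lambda>n. (D (X n)) (X n - x)) \<longlonglongrightarrow> 0"
  proof (rule Lim_null_comparison)
    have "norm ((D (X n)) (X n - x)) \<le> C * norm (X n - x)" for n
      using norm_blinfun[of "D (X n)" "X n - x"] mult_right_mono[OF bdd[of n], of "norm (X n - x)"]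
      by simp
    then show "\<forall>\<^sub>F n in sequentially. norm ((D (X n)) (X n - x)) \<le> C * norm (X n - x)"
      by simp
    have "(\<lambda>n. C * norm (X n - x)) \<longlonglongrightarrow> C * norm (x - x)" by (intro tendsto_intros X)
    then show "(\<lambda>n. C * norm (X n - x)) \<longlonglongrightarrow> 0" by simp
  qed
  have 2: "(\<lambda>n. (D (X n)) (x - z)) \<longlonglongrightarrow> D x (x - z)"
    using D X unfolding demicontinuous_def by blast
  have 3: "(\<lambda>n. f (X n - z)) \<longlonglongrightarrow> f (x - z)"
    by (intro tendsto_intros X)
  show ?thesis
    using tendsto_diff[OF tendsto_add[OF 1 2] 3]
    by (simp add: blinfun.diff_left blinfun.diff_right algebra_simps)
qed

text \<open>The dense points lie in \<open>S\<close> itself. This yields countably many test points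
  inside the subspace and countably many candidates inside its intersection with a ball.\<close>

lemma countable_dense_subset:
  fixes S :: "'a::{metric_space, second_countable_topology} set"
  obtains T where "countable T" "T \<subseteq> S" "S \<subseteq> closure T"
proof -
  obtain B :: "'a set set" where B: "countable B" "topological_basis B"
    using ex_countable_basis by blast
  define pick where "pick b = (SOME x. x \<in> b \<inter> S)" for b
  define T where "T = pick ` {b\<in>B. b \<inter> S \<noteq> {}}"
  have pick: "pick b \<in> b \<inter> S" if "b \<inter> S \<noteq> {}" for b
    unfolding pick_def by (rule someI_ex) (use that in blast)
  show ?thesis
  proof
    show "countable T" unfolding T_def by (rule countable_image, rule countable_subset[OF _ B(1)]) auto
    show "T \<subseteq> S" unfolding T_def using pick by auto
    show "S \<subseteq> closure T"
    proof
      fix x assume x: "x \<in> S"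
      show "x \<in> closure T"
        unfolding closure_iff_nhds_not_empty
      proof (intro allI impI)
        fix A V assume "x \<in> V" "open V" "V \<subseteq> A"
        then obtain b where b: "b \<in> B" "x \<in> b" "b \<subseteq> V"
          by (meson topological_basisE[OF B(2)])
        then have "b \<inter> S \<noteq> {}" using x by blast
        then have "pick b \<in> T \<inter> A" using pick[of b] b \<open>V \<subseteq> A\<close> by (auto simp: T_def)
        then show "T \<inter> A \<noteq> {}" by blast
      qed
    qed
  qed
qed

text \<open>An open set is a countable union of closed balls with centres in a countable dense set
  and rational radii. Closed balls are preferred to open ones because they are weakly compact in the
  application.\<close>

lemma borel_measurable_cballI:
  fixes u :: "'w \<Rightarrow> 'a::{metric_space, second_countable_topology}"
  assumes "\<And>a r. {\<omega>\<in>space M. dist a (u \<omega>) \<le> r} \<in> sets M"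
  shows "u \<in> borel_measurable M"
proof (rule borel_measurableI)
  fix U :: "'a set" assume U: "open U"
  obtain T :: "'a set" where T: "countable T" "T \<subseteq> UNIV" "UNIV \<subseteq> closure T"
    by (rule countable_dense_subset)
  define I where "I = {(a, q) \<in> T \<times> \<rat>. cball a q \<subseteq> U}"
  have "countable I"
    by (rule countable_subset[of _ "T \<times> \<rat>"]) (use T countable_rat in \<open>auto simp: I_def\<close>)
  have "\<exists>(a, q)\<in>I. x \<in> cball a q" if x: "x \<in> U" for x
  proof -
    obtain \<epsilon> where \<epsilon>: "\<epsilon> > 0" "cball x \<epsilon> \<subseteq> U" using U x open_contains_cball by blast
    obtain a where a: "a \<in> T" "dist a x < \<epsilon> / 3"
    proof -
      have "x \<in> closure T" using T(3) by blast
      then have "\<forall>e>0. \<exists>y\<in>T. dist y x < e" by (simp add: closure_approachable)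
      moreover have "\<epsilon> / 3 > 0" using \<epsilon>(1) by simp
      ultimately have "\<exists>y\<in>T. dist y x < \<epsilon> / 3" by blast
      then show ?thesis using that by blast
    qed
    \<comment> \<open>A radius above \<epsilon>/3 keeps \<open>x\<close> in the ball around
      \<open>a\<close>; below \<epsilon>/2 it keeps that ball within distance \<epsilon> of
      \<open>x\<close>, as \<epsilon>/3 + \<epsilon>/2 < \<epsilon>.\<close>
    obtain q where q: "q \<in> \<rat>" "\<epsilon> / 3 < q" "q < \<epsilon> / 2"
      using Rats_dense_in_real[of "\<epsilon> / 3" "\<epsilon> / 2"] \<epsilon>(1) by auto
    have "cball a q \<subseteq> cball x \<epsilon>"
    proof
      fix y assume "y \<in> cball a q"
      then show "y \<in> cball x \<epsilon>" using a(2) q(3) dist_triangle[of x y a] \<epsilon>(1)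
        by (simp add: dist_commute)
    qed
    then have "(a, q) \<in> I" using a(1) q(1) \<epsilon>(2) by (auto simp: I_def)
    moreover have "x \<in> cball a q" using a(2) q(2) by simp
    ultimately show ?thesis by blast
  qed
  moreover have "cball a q \<subseteq> U" if "(a, q) \<in> I" for a q using that by (simp add: I_def)
  ultimately have "u -` U \<inter> space M = (\<Union>i\<in>I. {\<omega>\<in>space M. dist (fst i) (u \<omega>) \<le> snd i})"
    by (fastforce simp: subset_eq)
  also have "\<dots> \<in> sets M"
    using assms by (intro sets.countable_UN'[OF \<open>countable I\<close>]) blast
  finally show "u -` U \<inter> space M \<in> sets M" .
qed

text \<open>On \<open>G\<close> the solution is the only point of the subspace satisfying all Minty
  inequalities. By weak compactness a closed ball contains it if and only if every finite system of
  these inequalities, relaxed by slacks, can be satisfied in the ball; the slacks allow the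
  candidates to be drawn from a countable dense set. What remains are countable operations on scalar
  measurable functions.\<close>

lemma monotone_solution_measurable:
  fixes D :: "'w \<Rightarrow> 'v::{real_normed_vector, second_countable_topology} \<Rightarrow> 'v \<Rightarrow>\<^sub>L real"
    and f :: "'w \<Rightarrow> 'v \<Rightarrow>\<^sub>L real" and u :: "'w \<Rightarrow> 'v"
  assumes refl: "reflexive_space TYPE('v)"
    and D[measurable]: "\<And>x z. (\<lambda>\<omega>. D \<omega> x z) \<in> borel_measurable M"
    and f[measurable]: "\<And>z. (\<lambda>\<omega>. f \<omega> z) \<in> borel_measurable M"
    and G: "G \<in> sets M"
    and mono: "\<And>\<omega>. \<omega> \<in> G \<Longrightarrow> monotone_operator (D \<omega>)"
    and hemi: "\<And>\<omega>. \<omega> \<in> G \<Longrightarrow> hemicontinuous (D \<omega>)"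
    and bdd: "\<And>\<omega> \<rho>. \<omega> \<in> G \<Longrightarrow> \<exists>C. \<forall>x. norm x \<le> \<rho> \<longrightarrow> norm (D \<omega> x) \<le> C"
    and u: "\<And>\<omega>. \<omega> \<in> G \<Longrightarrow> u \<omega> \<in> annihilated L"
    and eq: "\<And>\<omega> v. \<omega> \<in> G \<Longrightarrow> v \<in> annihilated L \<Longrightarrow> (D \<omega> (u \<omega>)) v = f \<omega> v"
    and uniq: "\<And>\<omega> x. \<omega> \<in> G \<Longrightarrow> x \<in> annihilated L \<Longrightarrow>
      (\<And>v. v \<in> annihilated L \<Longrightarrow> D \<omega> x v = f \<omega> v) \<Longrightarrow> x = u \<omega>"
    and zero: "\<And>\<omega>. \<omega> \<in> space M - G \<Longrightarrow> u \<omega> = 0"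
  shows "u \<in> borel_measurable M"
proof (rule borel_measurable_cballI)
  fix a :: 'v and r :: real
  let ?S = "annihilated L"
  note S = subspace_annihilated[of L]
  have GM: "G \<subseteq> space M" using G by (rule sets.sets_into_space)
  obtain Y where Y: "countable Y" "Y \<subseteq> ?S" "?S \<subseteq> closure Y" by (rule countable_dense_subset)
  obtain X where X: "countable X" "X \<subseteq> ?S \<inter> cball a r" "?S \<inter> cball a r \<subseteq> closure X"
    by (rule countable_dense_subset)
  \<comment> \<open>The index sets are finite sets of pairs of a test point and a slack index, so
    there are only countably many of them.\<close>
  define \<F> where "\<F> = {F. F \<subseteq> Y \<times> (UNIV :: nat set) \<and> finite F}"
  have "countable (Y \<times> (UNIV :: nat set))" using Y(1) by simp
  then have "countable \<F>"
    using countable_Collect_finite_subset by (simp add: \<F>_def conj_commute)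
  let ?P = "\<lambda>\<omega> y (k::nat) x. D \<omega> y (y - x) - f \<omega> (y - x) \<ge> - 1 / real (Suc k)"
  define C where "C = {\<omega>\<in>space M. \<forall>F\<in>\<F>. \<exists>x\<in>X. \<forall>i\<in>F. ?P \<omega> (fst i) (snd i) x}"
  have CM: "C \<in> sets M"
    unfolding C_def
  proof (intro sets.sets_Collect_countable_All'[OF _ \<open>countable \<F>\<close>]
      sets.sets_Collect_countable_Ex'[OF _ \<open>countable X\<close>])
    fix F x assume "F \<in> \<F>"
    then have "countable F" by (simp add: \<F>_def countable_finite)
    then show "{\<omega> \<in> space M. \<forall>i\<in>F. ?P \<omega> (fst i) (snd i) x} \<in> sets M"
      by (intro sets.sets_Collect_countable_All') measurable
  qed
  have iff: "dist a (u \<omega>) \<le> r \<longleftrightarrow> \<omega> \<in> C" if \<omega>: "\<omega> \<in> G" for \<omega>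
  proof
    assume r: "dist a (u \<omega>) \<le> r"
    have "\<exists>x\<in>X. \<forall>i\<in>F. ?P \<omega> (fst i) (snd i) x" if F: "F \<in> \<F>" for F
    proof -
      have "u \<omega> \<in> closure X" using X(3) u[OF \<omega>] r by auto
      then obtain x where x: "\<And>n::nat. x n \<in> X" "x \<longlonglongrightarrow> u \<omega>"
        unfolding closure_sequential by auto
      have "\<forall>\<^sub>F n in sequentially. ?P \<omega> (fst i) (snd i) (x n)" if i: "i \<in> F" for i
      proof -
        let ?y = "fst i"
        have yS: "?y \<in> ?S" using F i Y(2) by (fastforce simp: \<F>_def)
        \<comment> \<open>By monotonicity and the equation, \<open>u \<omega>\<close> satisfies the
          inequality without slack, so points of \<open>X\<close> close to it satisfy the relaxed
          one, and finitely many of them simultaneously.\<close>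
        have "(D \<omega> ?y - D \<omega> (u \<omega>)) (?y - u \<omega>) \<ge> 0"
          using mono[OF \<omega>] unfolding monotone_operator_def by blast
        then have nonneg: "(D \<omega> ?y) (?y - u \<omega>) - f \<omega> (?y - u \<omega>) \<ge> 0"
          using eq[OF \<omega>, of "?y - u \<omega>"] yS u[OF \<omega>] S by (simp add: blinfun.diff_left subspace_diff)
        have "(\<lambda>n. (D \<omega> ?y) (?y - x n) - f \<omega> (?y - x n))
          \<longlonglongrightarrow> (D \<omega> ?y) (?y - u \<omega>) - f \<omega> (?y - u \<omega>)"
          by (intro tendsto_intros x)
        moreover have "- 1 / real (Suc (snd i)) < (D \<omega> ?y) (?y - u \<omega>) - f \<omega> (?y - u \<omega>)"
          using nonneg by (intro less_le_trans[OF _ nonneg]) simp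
        ultimately have "\<forall>\<^sub>F n in sequentially.
          - 1 / real (Suc (snd i)) < (D \<omega> ?y) (?y - x n) - f \<omega> (?y - x n)"
          by (rule order_tendstoD(1))
        then show ?thesis by eventually_elim simp
      qed
      moreover have "finite F" using F by (simp add: \<F>_def)
      ultimately have "\<forall>\<^sub>F n in sequentially. \<forall>i\<in>F. ?P \<omega> (fst i) (snd i) (x n)"
        by (simp add: eventually_ball_finite)
      then obtain n where "\<forall>i\<in>F. ?P \<omega> (fst i) (snd i) (x n)"
        using eventually_happens'[OF sequentially_bot] by blast
      then show ?thesis using x(1) by blast
    qed
    then show "\<omega> \<in> C" using \<omega> GM by (auto simp: C_def)
  next
    assume C: "\<omega> \<in> C"
    have "\<exists>x. norm (x - a) \<le> r \<and> (\<forall>\<phi>\<in>L. \<phi> x = 0) \<and> (\<forall>i\<in>Y \<times> UNIV.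
        (D \<omega> (fst i) - f \<omega>) x \<le> (D \<omega> (fst i) - f \<omega>) (fst i) + 1 / real (Suc (snd i)))"
    proof (rule weak_fip[OF refl])
      fix F assume "finite F" "F \<subseteq> Y \<times> (UNIV::nat set)"
      then have "F \<in> \<F>" by (simp add: \<F>_def)
      then obtain x where "x \<in> X" "\<forall>i\<in>F. ?P \<omega> (fst i) (snd i) x"
        using C by (auto simp: C_def)
      then show "\<exists>x. norm (x - a) \<le> r \<and> (\<forall>\<phi>\<in>L. \<phi> x = 0) \<and> (\<forall>i\<in>F.
        (D \<omega> (fst i) - f \<omega>) x \<le> (D \<omega> (fst i) - f \<omega>) (fst i) + 1 / real (Suc (snd i)))"
        using X(2) by (intro exI[of _ x])
          (auto simp: annihilated_def dist_norm norm_minus_commute blinfun.diff_left blinfun.diff_right algebra_simps)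
    qed
    then obtain x where x: "norm (x - a) \<le> r" "x \<in> ?S" and le: "\<And>y k. y \<in> Y \<Longrightarrow>
        (D \<omega> y - f \<omega>) x \<le> (D \<omega> y - f \<omega>) y + 1 / real (Suc k)"
      by (auto simp: annihilated_def)
    \<comment> \<open>For fixed \<open>y\<close> the slacks tend to zero. Demicontinuity then
      carries the inequality from \<open>Y\<close> to its closure, and Minty's lemma with uniqueness
      identifies the point found in the ball with \<open>u \<omega>\<close>.\<close>
    have Yge: "0 \<le> (D \<omega> y - f \<omega>) (y - x)" if y: "y \<in> Y" for y
    proof (rule LIMSEQ_le_const2)
      show "(\<lambda>k. - (1 / real (Suc k))) \<longlonglongrightarrow> 0"
        using tendsto_minus[OF LIMSEQ_inverse_real_of_nat] by (simp add: inverse_eq_divide)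
    qed (use le[OF y] in \<open>auto simp: blinfun.diff_right algebra_simps intro!: exI[of _ 0]\<close>)
    have demi: "demicontinuous (D \<omega>)"
      using mono[OF \<omega>] hemi[OF \<omega>] bdd[OF \<omega>] by (rule monotone_imp_demicontinuous)
    have ge: "0 \<le> (D \<omega> y - f \<omega>) (y - x)" if y: "y \<in> ?S" for y
    proof -
      have "y \<in> closure Y" using y Y(3) by blast
      then obtain z where z: "\<And>n::nat. z n \<in> Y" "z \<longlonglongrightarrow> y"
        unfolding closure_sequential by blast
      obtain \<rho> where \<rho>: "\<forall>n. norm (z n) \<le> \<rho>"
        using convergent_imp_Bseq[OF convergentI[OF z(2)]] unfolding Bseq_def by blast
      obtain c where c: "\<forall>x. norm x \<le> \<rho> \<longrightarrow> norm (D \<omega> x) \<le> c" using bdd[OF \<omega>] by blast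
      have "(\<lambda>n. (D \<omega> (z n) - f \<omega>) (z n - x)) \<longlonglongrightarrow> (D \<omega> y - f \<omega>) (y - x)"
        using c \<rho> by (intro demicontinuous_tendsto[OF demi z(2), of c]) blast
      then show ?thesis
        by (rule LIMSEQ_le_const) (use Yge[OF z(1)] in blast)
    qed
    have "x = u \<omega>"
      using Minty_subspace[OF hemi[OF \<omega>] S x(2) _ ge] by (intro uniq[OF \<omega> x(2)]) blast
    then show "dist a (u \<omega>) \<le> r" using x(1) by (simp add: dist_norm norm_minus_commute)
  qed
  have "{\<omega>\<in>space M. dist a (u \<omega>) \<le> r} = (C \<inter> G) \<union> (if dist a 0 \<le> r then space M - G else {})"
  proof (rule set_eqI)
    fix \<omega>
    show "\<omega> \<in> {\<omega>\<in>space M. dist a (u \<omega>) \<le> r} \<longleftrightarrow> \<omega> \<in> (C \<inter> G) \<union> (if dist a 0 \<le> r then space M - G else {})"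
      using iff[of \<omega>] zero[of \<omega>] GM by (cases "\<omega> \<in> G") auto
  qed
  then show "{\<omega>\<in>space M. dist a (u \<omega>) \<le> r} \<in> sets M"
    using CM G by auto
qed

section \<open>Hilbert--Schmidt operators, filtrations and noise increments\<close>

text \<open>Cauchy-Schwarz with a majorant of the square. The pointwise bound of
  \<open>norm (f x)\<close> by \<open>(a + h x / a) / 2\<close> gives integrability of the norm and
  the family \<open>quad\<close> of inequalities, which is then optimised over
  \<open>a\<close>.\<close>

lemma norm_integral_power2_le:
  fixes f :: "'a \<Rightarrow> 'b::{banach, second_countable_topology}"
  assumes fin: "finite_measure M" and f: "f \<in> borel_measurable M"
    and h: "integrable M h" and le: "AE x in M. (norm (f x))\<^sup>2 \<le> h x"
  shows "(norm (integral\<^sup>L M f))\<^sup>2 \<le> measure M (space M) * integral\<^sup>L M h"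
proof -
  interpret finite_measure M by fact
  define m where "m = measure M (space M)"
  define H where "H = integral\<^sup>L M h"
  define n where "n = norm (integral\<^sup>L M f)"
  have "AE x in M. 0 \<le> h x" using le by eventually_elim (rule order_trans[OF zero_le_power2])
  then have H: "0 \<le> H" unfolding H_def by (rule integral_nonneg_AE)
  have m: "0 \<le> m" by (simp add: m_def)
  have quad: "2 * a * n \<le> a\<^sup>2 * m + H" if a: "a > 0" for a
  proof -
    have "2 * a * n \<le> 2 * a * integral\<^sup>L M (\<lambda>x. (a + h x / a) / 2)"
    proof (rule mult_left_mono)
      have ae: "AE x in M. norm (f x) \<le> (a + h x / a) / 2"
        using le
      proof eventually_elim
        case (elim x)
        have "0 \<le> (norm (f x) - a)\<^sup>2" by simp
        also have "\<dots> \<le> h x + a\<^sup>2 - 2 * a * norm (f x)"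
          using elim by (simp add: power2_diff)
        finally have "norm (f x) \<le> (h x + a\<^sup>2) / (2 * a)" using a by (simp add: field_simps)
        also have "\<dots> = (a + h x / a) / 2" using a by (simp add: field_simps power2_eq_square)
        finally show ?case .
      qed
      have i: "integrable M (\<lambda>x. (a + h x / a) / 2)" using h by simp
      then have "integrable M (\<lambda>x. norm (f x))"
        by (rule Bochner_Integration.integrable_bound) (use f ae in \<open>auto elim!: eventually_mono\<close>)
      then have "integral\<^sup>L M (\<lambda>x. norm (f x)) \<le> integral\<^sup>L M (\<lambda>x. (a + h x / a) / 2)"
        using i ae by (intro integral_mono_AE)
      then show "n \<le> integral\<^sup>L M (\<lambda>x. (a + h x / a) / 2)"
        unfolding n_def by (rule order_trans[OF integral_norm_bound])
    qed (use a in simp)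
    also have "\<dots> = a\<^sup>2 * m + H"
      using h a by (simp add: m_def H_def field_simps power2_eq_square)
    finally show ?thesis .
  qed
  have "n\<^sup>2 \<le> m * H"
  proof (cases "n = 0")
    case True
    then show ?thesis using m H by simp
  next
    case False
    then have n: "n > 0" by (simp add: n_def)
    show ?thesis
    proof (cases "m = 0")
      case True
      \<comment> \<open>Without its quadratic term \<open>quad\<close> would give
        \<open>2 * (H + 1) \<le> H\<close> here, a contradiction.\<close>
      then show ?thesis using quad[of "(H + 1) / n"] n H by simp
    next
      case False
      \<comment> \<open>The value \<open>n / m\<close> maximises
        \<open>2 * a * n - a\<^sup>2 * m\<close>.\<close>
      then show ?thesis using quad[of "n / m"] n m by (simp add: field_simps power2_eq_square)
    qed
  qed
  then show ?thesis by (simp add: n_def m_def H_def)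
qed

lemma norm_add_power2_le:
  fixes a b :: "'a::real_normed_vector"
  shows "(norm (a + b))\<^sup>2 \<le> 2 * (norm a)\<^sup>2 + 2 * (norm b)\<^sup>2"
proof -
  have "(norm (a + b))\<^sup>2 \<le> (norm a + norm b)\<^sup>2"
    by (intro power_mono norm_triangle_ineq) simp
  also have "\<dots> \<le> 2 * (norm a)\<^sup>2 + 2 * (norm b)\<^sup>2"
    using sum_squares_bound[of "norm a" "norm b"] by (simp add: power2_sum)
  finally show ?thesis .
qed

lemma hs_ops_diff:
  assumes "R \<in> hs_ops J g" "S \<in> hs_ops J g"
  shows "R - S \<in> hs_ops J g"
proof -
  have "(\<lambda>k. 2 * (norm (R (g k)))\<^sup>2 + 2 * (norm (S (g k)))\<^sup>2) summable_on J"
    using assms by (intro summable_on_add summable_on_cmult_right) (auto simp: hs_ops_def)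
  then show ?thesis
    unfolding hs_ops_def mem_Collect_eq
    by (rule summable_on_comparison_test)
      (use norm_add_power2_le[of "R (g k)" "- S (g k)" for k] in \<open>auto simp: blinfun.diff_left\<close>)
qed

text \<open>On finite combinations of basis vectors this is Parseval and Cauchy-Schwarz; both sides
  are continuous in \<open>u\<close>, so it extends to the closure of the span.\<close>

lemma norm_apply_le_hs_norm:
  fixes S :: "'u::real_inner \<Rightarrow>\<^sub>L 'h::real_normed_vector"
  assumes J: "orthonormal_basis J g" and S: "S \<in> hs_ops J g"
  shows "norm (S u) \<le> hs_norm J g S * norm u"
proof -
  let ?C = "{u. norm (S u) \<le> hs_norm J g S * norm u}"
  have ortho: "g j \<bullet> g k = (if j = k then 1 else 0)" if "j \<in> J" "k \<in> J" for j k
    using J that by (auto simp: orthonormal_basis_def)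
  then have inj: "inj_on g J"
    by (metis (no_types, lifting) inj_onI zero_neq_one)
  have "span (g ` J) \<subseteq> ?C"
  proof
    fix u assume "u \<in> span (g ` J)"
    then obtain t r where t: "finite t" "t \<subseteq> g ` J" and u: "u = (\<Sum>a\<in>t. r a *\<^sub>R a)"
      unfolding span_explicit by blast
    obtain K where K: "K \<subseteq> J" "finite K" "t = g ` K"
      using t by (meson finite_subset_image)
    define c where "c k = r (g k)" for k
    have u: "u = (\<Sum>k\<in>K. c k *\<^sub>R g k)"
      unfolding u K(3) c_def using K(1) inj by (subst sum.reindex) (auto intro: inj_on_subset)
    have "(norm u)\<^sup>2 = (\<Sum>j\<in>K. \<Sum>k\<in>K. c j * c k * (g j \<bullet> g k))"
      unfolding u power2_norm_eq_inner
      by (simp add: inner_sum_left inner_sum_right sum_distrib_left mult_ac inner_commute)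
    also have "\<dots> = (\<Sum>j\<in>K. \<Sum>k\<in>K. if j = k then (c j)\<^sup>2 else 0)"
      using K(1) by (intro sum.cong refl) (auto simp: ortho subset_eq power2_eq_square)
    also have "\<dots> = (\<Sum>j\<in>K. (c j)\<^sup>2)" using K(2) by simp
    finally have norm_u: "(norm u)\<^sup>2 = (\<Sum>j\<in>K. (c j)\<^sup>2)" .
    have "norm (S u) \<le> (\<Sum>k\<in>K. \<bar>c k\<bar> * norm (S (g k)))"
      unfolding u by (simp add: blinfun.sum_right blinfun.scaleR_right sum_norm_le)
    then have "(norm (S u))\<^sup>2 \<le> (\<Sum>k\<in>K. \<bar>c k\<bar> * norm (S (g k)))\<^sup>2"
      by (intro power_mono) auto
    also have "\<dots> \<le> (\<Sum>k\<in>K. \<bar>c k\<bar>\<^sup>2) * (\<Sum>k\<in>K. (norm (S (g k)))\<^sup>2)"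
      by (rule Cauchy_Schwarz_ineq_sum)
    also have "\<dots> \<le> (norm u)\<^sup>2 * (\<Sum>\<^sub>\<infinity>k\<in>J. (norm (S (g k)))\<^sup>2)"
      using S K norm_u by (intro mult_mono finite_sum_le_infsum) (auto simp: hs_ops_def intro!: sum_nonneg)
    also have "\<dots> = (hs_norm J g S * norm u)\<^sup>2"
      by (simp add: hs_norm_def power_mult_distrib infsum_nonneg)
    finally show "u \<in> ?C"
      by (auto intro!: power2_le_imp_le mult_nonneg_nonneg simp: hs_norm_def infsum_nonneg)
  qed
  moreover have "closed ?C"
    by (intro closed_Collect_le continuous_intros)
  ultimately have "closure (span (g ` J)) \<subseteq> ?C" by (rule closure_minimal)
  then show ?thesis using J by (auto simp: orthonormal_basis_def)
qed

lemma space_hs_borel: "space (hs_borel J g) = hs_ops J g"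
  unfolding hs_borel_def by (rule space_measure_of) auto

text \<open>Evaluation at \<open>u\<close> is continuous for the Hilbert-Schmidt norm, so the
  preimage of an open set is one of the generators of \<open>hs_borel\<close>. Through this the
  coefficient \<open>B\<close> is reduced to functions with values in H.\<close>

lemma measurable_hs_borel_apply:
  fixes g :: "nat \<Rightarrow> 'u::real_inner"
  assumes J: "orthonormal_basis J g"
  shows "(\<lambda>S. blinfun_apply S u) \<in> borel_measurable (hs_borel J g :: ('u \<Rightarrow>\<^sub>L 'h::real_normed_vector) measure)"
proof (rule borel_measurableI)
  fix U :: "'h set" assume U: "open U"
  let ?G = "(\<lambda>S::'u \<Rightarrow>\<^sub>L 'h. S u) -` U \<inter> hs_ops J g"
  have "\<exists>r>0. \<forall>R\<in>hs_ops J g. hs_norm J g (R - S) < r \<longrightarrow> R \<in> ?G" if S: "S \<in> ?G" for S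
  proof -
    obtain \<epsilon> where \<epsilon>: "\<epsilon> > 0" "ball (S u) \<epsilon> \<subseteq> U"
      using S U by (auto elim: openE)
    have n: "norm u + 1 > 0" by (simp add: add_nonneg_pos)
    show ?thesis
    proof (intro exI[of _ "\<epsilon> / (norm u + 1)"] conjI ballI impI)
      show "\<epsilon> / (norm u + 1) > 0" using \<epsilon>(1) n by simp
      fix R assume R: "R \<in> hs_ops J g" "hs_norm J g (R - S) < \<epsilon> / (norm u + 1)"
      have "norm ((R - S) u) \<le> hs_norm J g (R - S) * norm u"
        using S R(1) by (intro norm_apply_le_hs_norm[OF J] hs_ops_diff) auto
      also have "\<dots> \<le> hs_norm J g (R - S) * (norm u + 1)"
        by (intro mult_left_mono) (auto simp: hs_norm_def infsum_nonneg)
      also have "\<dots> < \<epsilon>" using R(2) n by (simp add: less_divide_eq)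
      finally show "R \<in> ?G"
        using \<epsilon>(2) R(1) by (auto simp: blinfun.diff_left dist_norm norm_minus_commute subset_eq)
    qed
  qed
  then have "?G \<in> {G. G \<subseteq> hs_ops J g \<and>
         (\<forall>S\<in>G. \<exists>r>0. \<forall>R\<in>hs_ops J g. hs_norm J g (R - S) < r \<longrightarrow> R \<in> G)}" by blast
  then show "(\<lambda>S::'u \<Rightarrow>\<^sub>L 'h. S u) -` U \<inter> space (hs_borel J g) \<in> sets (hs_borel J g)"
    unfolding space_hs_borel unfolding hs_borel_def by (subst sets_measure_of) auto
qed

section \<open>Filtrations and joint measurability up to a fixed time\<close>

abbreviation upto :: "real \<Rightarrow> real measure" where
  "upto t \<equiv> restrict_space borel {0..t}"

context
  fixes T :: real and M :: "'w measure" and Fl :: "real \<Rightarrow> 'w measure"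
  assumes filt: "usual_filtration T M Fl"
begin

lemma filtration_subalgebra: "t \<in> {0..T} \<Longrightarrow> subalgebra M (Fl t)"
  using filt by (simp add: usual_filtration_def)

lemma filtration_space: "t \<in> {0..T} \<Longrightarrow> space (Fl t) = space M"
  using filtration_subalgebra by (simp add: subalgebra_def)

lemma filtration_mono: "0 \<le> s \<Longrightarrow> s \<le> t \<Longrightarrow> t \<le> T \<Longrightarrow> sets (Fl s) \<subseteq> sets (Fl t)"
  using filt by (simp add: usual_filtration_def)

lemma filtration_measurable_mono:
  assumes "f \<in> Fl s \<rightarrow>\<^sub>M N" "0 \<le> s" "s \<le> t" "t \<le> T"
  shows "f \<in> Fl t \<rightarrow>\<^sub>M N"
  using assms filtration_mono[of s t] filtration_space[of s] filtration_space[of t]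
  by (auto simp: measurable_def)

lemma filtration_measurable_M:
  assumes "f \<in> Fl t \<rightarrow>\<^sub>M N" "t \<in> {0..T}"
  shows "f \<in> M \<rightarrow>\<^sub>M N"
  using assms measurable_from_subalg[OF filtration_subalgebra] by blast

lemma filtration_null_sets: "t \<in> {0..T} \<Longrightarrow> null_sets M \<subseteq> sets (Fl t)"
  using filt filtration_mono[of 0 t] by (force simp: usual_filtration_def)

text \<open>Completeness makes every subset of a null set measurable, and \<open>Fl 0\<close>
  contains the null sets. Hence integral formulas that hold only almost surely still decide
  adaptedness of the discretised coefficients, whose defaults matter only on null sets.\<close>

lemma filtration_measurable_AE_eq:
  fixes f h :: "'w \<Rightarrow> 'b::topological_space"
  assumes t: "t \<in> {0..T}" and f: "f \<in> borel_measurable (Fl t)"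
    and eq: "AE \<omega> in M. f \<omega> = h \<omega>"
  shows "h \<in> borel_measurable (Fl t)"
proof (rule measurableI)
  have cm: "complete_measure M" using filt by (simp add: usual_filtration_def)
  obtain Z where Z: "Z \<in> null_sets M" "{\<omega>\<in>space M. f \<omega> \<noteq> h \<omega>} \<subseteq> Z"
    using AE_E[OF eq] by (metis (no_types, lifting) null_setsI)
  have null: "X \<in> sets (Fl t)" if "X \<subseteq> Z" for X
    using complete_measure.complete[OF cm that Z(1)] filtration_null_sets[OF t] Z(1) that
      complete_measure.complete2[OF cm that Z(1)] by (auto simp: null_sets_def)
  fix B assume B: "B \<in> sets (borel :: 'b measure)"
  have "h -` B \<inter> space (Fl t) = ((f -` B \<inter> space (Fl t)) - Z) \<union> (h -` B \<inter> Z \<inter> space M)"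
    using Z(2) filtration_space[OF t] by auto
  also have "\<dots> \<in> sets (Fl t)"
    using measurable_sets[OF f B] null[of Z] null[of "h -` B \<inter> Z \<inter> space M"] by auto
  finally show "h -` B \<inter> space (Fl t) \<in> sets (Fl t)" .
qed simp

lemma measurable_progressive_restrict:
  assumes t: "t \<in> {0..T}"
  shows "(\<lambda>x. x) \<in> upto t \<Otimes>\<^sub>M Fl t \<rightarrow>\<^sub>M progressive_sigma T M Fl"
  unfolding progressive_sigma_def
proof (rule measurable_measure_of)
  have sp: "space (upto t \<Otimes>\<^sub>M Fl t) = {0..t} \<times> space M"
    using filtration_space[OF t] by (simp add: space_pair_measure space_restrict_space)
  then show "(\<lambda>x. x) \<in> space (upto t \<Otimes>\<^sub>M Fl t) \<rightarrow> {0..T} \<times> space M"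
    using t by auto
  fix \<Gamma> assume "\<Gamma> \<in> {\<Gamma>. \<Gamma> \<subseteq> {0..T} \<times> space M \<and>
         (\<forall>t\<in>{0..T}. \<Gamma> \<inter> ({0..t} \<times> space M) \<in> sets (upto t \<Otimes>\<^sub>M Fl t))}"
  then show "(\<lambda>x. x) -` \<Gamma> \<inter> space (upto t \<Otimes>\<^sub>M Fl t)
      \<in> sets (upto t \<Otimes>\<^sub>M Fl t)"
    using t unfolding sp by auto
qed auto

text \<open>A generating rectangle beginning at a time s \<le> t has its random part in
  \<open>Fl s\<close>, hence in \<open>Fl t\<close>, and its time interval is cut at t; one
  beginning later misses [0, t]. So predictable and progressive coefficients are treated alike, as
  jointly measurable functions.\<close>

lemma measurable_predictable_restrict:
  assumes t: "t \<in> {0..T}"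
  shows "(\<lambda>x. x) \<in> upto t \<Otimes>\<^sub>M Fl t \<rightarrow>\<^sub>M predictable_sigma T M Fl"
  unfolding predictable_sigma_def
proof (rule measurable_measure_of)
  let ?R = "upto t \<Otimes>\<^sub>M Fl t"
  have sp: "space ?R = {0..t} \<times> space M"
    using filtration_space[OF t] by (simp add: space_pair_measure space_restrict_space)
  then show "(\<lambda>x. x) \<in> space ?R \<rightarrow> {0..T} \<times> space M"
    using t by auto
  have sub: "D \<subseteq> space M" if "D \<in> sets (Fl s)" "0 \<le> s" "s \<le> T" for D s
    using that sets.sets_into_space[OF that(1)] filtration_space[of s] by simp
  show "{{0} \<times> D | D. D \<in> sets (Fl 0)} \<union>
      {{s<..t} \<times> D | s t D. 0 \<le> s \<and> s < t \<and> t \<le> T \<and> D \<in> sets (Fl s)} \<subseteq> Pow ({0..T} \<times> space M)"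
    using t sub by fastforce
  fix \<Gamma> assume "\<Gamma> \<in> {{0} \<times> D | D. D \<in> sets (Fl 0)} \<union>
      {{s<..t} \<times> D | s t D. 0 \<le> s \<and> s < t \<and> t \<le> T \<and> D \<in> sets (Fl s)}"
  then consider D where "\<Gamma> = {0} \<times> D" "D \<in> sets (Fl 0)"
    | s r D where "\<Gamma> = {s<..r} \<times> D" "0 \<le> s" "s < r" "r \<le> T" "D \<in> sets (Fl s)" by blast
  then show "(\<lambda>x. x) -` \<Gamma> \<inter> space ?R \<in> sets ?R"
  proof cases
    case 1
    then have "D \<in> sets (Fl t)" using filtration_mono[of 0 t] t by auto
    moreover have "{0} \<in> sets (upto t)"
      using t by (simp add: sets_restrict_space_iff)
    moreover have "(\<lambda>x. x) -` \<Gamma> \<inter> space ?R = {0} \<times> D"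
      using 1 sub[of D 0] t unfolding sp by auto
    ultimately show ?thesis by simp
  next
    case 2
    show ?thesis
    proof (cases "s \<le> t")
      case True
      then have "D \<in> sets (Fl t)" using filtration_mono[of s t] 2 t by auto
      moreover have "{s<..min r t} \<in> sets (upto t)"
        using 2 by (auto simp: sets_restrict_space_iff)
      moreover have "(\<lambda>x. x) -` \<Gamma> \<inter> space ?R = {s<..min r t} \<times> D"
        using 2 sub[of D s] t unfolding sp by auto
      ultimately show ?thesis by simp
    next
      case False
      then have "(\<lambda>x. x) -` \<Gamma> \<inter> space ?R = {}" using 2 unfolding sp by auto
      then show ?thesis by simp
    qed
  qed
qed

end

section \<open>Moments of the increments and independence\<close>

lemma wiener_increment_square_integrable:
  assumes W: "cylindrical_wiener T M Fl W" and t: "0 \<le> s" "s < t" "t \<le> T" and u: "u \<noteq> 0"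
  shows "integrable M (\<lambda>\<omega>. (W t \<omega> u - W s \<omega> u)\<^sup>2)"
proof -
  have "distributed M lborel (\<lambda>\<omega>. W t \<omega> u - W s \<omega> u)
          (\<lambda>z. ennreal (normal_density 0 (sqrt (t - s) * norm u) z))"
    using W t u by (auto simp: cylindrical_wiener_def)
  from distributed_integrable[OF this, of "\<lambda>z. z\<^sup>2"]
  show ?thesis
    using integrable_normal_moment[of "sqrt (t - s) * norm u" 0 2] t u by simp
qed

text \<open>Independence makes a product of merely integrable factors integrable. It will be applied
  to the squared norm of a coefficient, known at the earlier time, and the square of an increment, a
  function of one of the generating variables \<open>Z i\<close>.\<close>

lemma indep_product_integrable:
  fixes X Y :: "'w \<Rightarrow> real"
  assumes M: "prob_space M" and F: "subalgebra M F"
    and indep: "prob_space.indep_set M (sets F) (generated_sets M I Z)"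
    and X: "X \<in> borel_measurable F" "integrable M X"
    and Y: "integrable M Y" "\<And>\<omega>. Y \<omega> = h (Z i \<omega>)" "h \<in> borel_measurable borel" "i \<in> I"
  shows "integrable M (\<lambda>\<omega>. X \<omega> * Y \<omega>)"
proof -
  interpret prob_space M by fact
  have "indep_var borel X borel Y"
    unfolding indep_var_eq
  proof (intro conjI)
    show "X \<in> borel_measurable M" "Y \<in> borel_measurable M" using X(2) Y(1) by (simp_all only: borel_measurable_integrable)
    have sp: "space F = space M" using F by (simp add: subalgebra_def)
    have "{X -` A \<inter> space M |A. A \<in> sets borel} \<subseteq> sets F"
      using measurable_sets[OF X(1)] unfolding sp by blast
    then have 1: "sigma_sets (space M) {X -` A \<inter> space M |A. A \<in> sets borel} \<subseteq> sets F"
      unfolding sp[symmetric] by (rule sets.sigma_sets_subset)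
    have "{Y -` A \<inter> space M |A. A \<in> sets borel} \<subseteq> {Z j -` B \<inter> space M |j B. j \<in> I \<and> B \<in> sets borel}"
    proof clarify
      fix A assume "A \<in> sets (borel :: real measure)"
      then have "h -` A \<in> sets borel" using measurable_sets[OF Y(3)] by simp
      moreover have "Y -` A \<inter> space M = Z i -` (h -` A) \<inter> space M" using Y(2) by auto
      ultimately show "\<exists>j B. Y -` A \<inter> space M = Z j -` B \<inter> space M \<and> j \<in> I \<and> B \<in> sets borel"
        using Y(4) by (intro exI[of _ i] exI[of _ "h -` A"]) simp
    qed
    then have "{Y -` A \<inter> space M |A. A \<in> sets borel} \<subseteq> generated_sets M I Z"
      unfolding generated_sets_def by (rule subset_trans) (rule sigma_sets_superset_generator)
    then have 2: "sigma_sets (space M) {Y -` A \<inter> space M |A. A \<in> sets borel} \<subseteq> generated_sets M I Z"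
      unfolding generated_sets_def by (rule sigma_sets_mono)
    show "indep_set (sigma_sets (space M) {X -` A \<inter> space M |A. A \<in> sets borel})
      (sigma_sets (space M) {Y -` A \<inter> space M |A. A \<in> sets borel})"
      unfolding indep_set_def
    proof (rule indep_sets_mono_sets[OF indep[unfolded indep_set_def]])
      fix b :: bool
      show "(case b of True \<Rightarrow> sigma_sets (space M) {X -` A \<inter> space M |A. A \<in> sets borel}
          | False \<Rightarrow> sigma_sets (space M) {Y -` A \<inter> space M |A. A \<in> sets borel})
        \<subseteq> (case b of True \<Rightarrow> sets F | False \<Rightarrow> generated_sets M I Z)"
        using 1 2 by (cases b) simp_all
    qed
  qed
  then show ?thesis using X(2) Y(1) by (rule indep_var_integrable)
qed

text \<open>Since \<open>real k \<le> 2 ^ k\<close>, the factor \<open>(real k)\<^sup>2\<close> is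
  at most \<open>4 ^ k\<close>, and the exponential series of \<open>4 * \<bar>c\<bar>\<close>
  dominates.\<close>

lemma summable_square_poisson: "summable (\<lambda>k. (real k)\<^sup>2 * (c ^ k / fact k * b :: real))"
proof -
  have "summable (\<lambda>k. (real k)\<^sup>2 * (c ^ k / fact k))"
  proof (rule summable_comparison_test')
    show "summable (\<lambda>k. (4 * \<bar>c\<bar>) ^ k / fact k)"
      using summable_exp[of "4 * \<bar>c\<bar>"] by (simp add: field_simps)
    fix k :: nat
    have "real k \<le> 2 ^ k" by (rule of_nat_less_two_power[THEN less_imp_le])
    then have "(real k)\<^sup>2 \<le> (2 ^ k)\<^sup>2" by (intro power_mono) auto
    also have "\<dots> = (2\<^sup>2) ^ k" by (simp only: power_mult[symmetric] mult.commute)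
    also have "\<dots> = 4 ^ k" by simp
    finally have "(real k)\<^sup>2 * (\<bar>c\<bar> ^ k / fact k) \<le> 4 ^ k * (\<bar>c\<bar> ^ k / fact k)"
      by (intro mult_right_mono) auto
    then show "norm ((real k)\<^sup>2 * (c ^ k / fact k)) \<le> (4 * \<bar>c\<bar>) ^ k / fact k"
      by (simp add: abs_mult power_abs power_mult_distrib)
  qed
  from summable_mult2[OF this, of b] show ?thesis by (simp add: mult.assoc)
qed

context
  fixes M :: "'w measure" and Z :: "'w \<Rightarrow> ennreal" and c :: real
  assumes M: "prob_space M" and Z[measurable]: "Z \<in> borel_measurable M"
    and Zval: "\<And>\<omega>. \<omega> \<in> space M \<Longrightarrow> Z \<omega> \<in> insert \<infinity> (range of_nat)"
    and c: "c \<ge> 0"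
    and pois: "\<And>k. measure M {\<omega> \<in> space M. Z \<omega> = of_nat k} = c ^ k / fact k * exp (- c)"
begin

text \<open>The second moment is expanded over the possible counts. The expansion is valid also
  where \<open>Z\<close> is infinite: \<open>enn2real\<close> is 0 there and every indicator
  vanishes.\<close>

lemma poisson_square_integrable: "integrable M (\<lambda>\<omega>. (enn2real (Z \<omega>))\<^sup>2)"
proof (rule integrableI_nonneg)
  interpret prob_space M by (rule M)
  have "(\<integral>\<^sup>+\<omega>. ennreal ((enn2real (Z \<omega>))\<^sup>2) \<partial>M)
    = (\<integral>\<^sup>+\<omega>. (\<Sum>k. ennreal ((real k)\<^sup>2) * indicator {\<omega> \<in> space M. Z \<omega> = of_nat k} \<omega>) \<partial>M)"
  proof (rule nn_integral_cong)
    fix \<omega> assume \<omega>: "\<omega> \<in> space M"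
    then consider "Z \<omega> = \<infinity>" | n where "Z \<omega> = of_nat n" using Zval by auto
    then show "ennreal ((enn2real (Z \<omega>))\<^sup>2)
      = (\<Sum>k. ennreal ((real k)\<^sup>2) * indicator {\<omega> \<in> space M. Z \<omega> = of_nat k} \<omega>)"
    proof cases
      case 1
      then show ?thesis by (simp add: \<omega>)
    next
      case (2 n)
      have "(\<Sum>k. ennreal ((real k)\<^sup>2) * indicator {\<omega> \<in> space M. Z \<omega> = of_nat k} \<omega>)
        = (\<Sum>k\<in>{n}. ennreal ((real k)\<^sup>2) * indicator {\<omega> \<in> space M. Z \<omega> = of_nat k} \<omega>)"
        by (rule suminf_finite) (auto simp: 2)
      then show ?thesis using \<omega> by (simp add: 2 enn2real_of_nat)
    qed
  qed
  also have "\<dots> = (\<Sum>k. \<integral>\<^sup>+\<omega>. ennreal ((real k)\<^sup>2) * indicator {\<omega> \<in> space M. Z \<omega> = of_nat k} \<omega> \<partial>M)"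
    by (rule nn_integral_suminf) measurable
  also have "\<dots> = (\<Sum>k. ennreal ((real k)\<^sup>2 * (c ^ k / fact k * exp (- c))))"
  proof (rule suminf_cong)
    fix k
    have "(\<integral>\<^sup>+\<omega>. ennreal ((real k)\<^sup>2) * indicator {\<omega> \<in> space M. Z \<omega> = of_nat k} \<omega> \<partial>M)
      = ennreal ((real k)\<^sup>2) * emeasure M {\<omega> \<in> space M. Z \<omega> = of_nat k}"
      by (rule nn_integral_cmult_indicator) measurable
    then show "(\<integral>\<^sup>+\<omega>. ennreal ((real k)\<^sup>2) * indicator {\<omega> \<in> space M. Z \<omega> = of_nat k} \<omega> \<partial>M)
      = ennreal ((real k)\<^sup>2 * (c ^ k / fact k * exp (- c)))"
      using c by (simp add: emeasure_eq_measure pois flip: ennreal_mult)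
  qed
  also have "\<dots> < \<infinity>"
    using summable_square_poisson[of c "exp (- c)"] c
    by (subst suminf_ennreal2) auto
  finally show "(\<integral>\<^sup>+\<omega>. ennreal ((enn2real (Z \<omega>))\<^sup>2) \<partial>M) < \<infinity>" .
qed (auto intro!: borel_measurable_power)

text \<open>The Poisson weights of the finite values already sum to 1.\<close>

lemma poisson_AE_finite: "AE \<omega> in M. Z \<omega> < \<infinity>"
proof -
  interpret prob_space M by (rule M)
  let ?A = "\<lambda>k::nat. {\<omega> \<in> space M. Z \<omega> = of_nat k}"
  have "(\<lambda>k. measure M (?A k)) sums measure M (\<Union>k. ?A k)"
    by (rule finite_measure_UNION) (auto simp: disjoint_family_on_def)
  moreover have "(\<lambda>k. measure M (?A k)) sums (exp c * exp (- c))"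
    unfolding pois using exp_converges[of c] by (intro sums_mult2) (simp add: field_simps)
  ultimately have "measure M (\<Union>k. ?A k) = 1"
    using sums_unique2 by (fastforce simp flip: exp_add)
  then have "AE \<omega> in M. \<omega> \<in> (\<Union>k. ?A k)"
    by (intro prob_eq_1[THEN iffD1]) auto
  then show ?thesis
    by eventually_elim (auto simp: of_nat_less_top)
qed

end

section \<open>Integrals over time intervals\<close>

abbreviation time :: "real \<Rightarrow> real \<Rightarrow> real measure" where
  "time a b \<equiv> restrict_space lborel {a..b}"

lemma finite_measure_time: "finite_measure (time a b)"
  by (intro finite_measureI, cases "a \<le> b") (simp_all add: emeasure_restrict_space space_restrict_space)

lemma measure_time_space:
  "a \<le> b \<Longrightarrow> measure (time a b) (space (time a b)) = b - a"
  by (simp add: space_restrict_space measure_restrict_space)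

lemma set_lebesgue_integral_time:
  fixes f :: "real \<Rightarrow> 'b::{banach, second_countable_topology}"
  shows "(LINT s:{a..b}|lborel. f s) = (\<integral>s. f s \<partial>time a b)"
  by (simp add: set_lebesgue_integral_def integral_restrict_space)

lemma integrable_time_subset:
  fixes f :: "real \<Rightarrow> 'b::{banach, second_countable_topology}"
  assumes f: "integrable (time 0 T) f" and "0 \<le> a" "b \<le> T"
  shows "integrable (time a b) f"
proof -
  have "set_integrable lborel {0..T} f"
    using f by (simp add: set_integrable_def integrable_restrict_space)
  then have "set_integrable lborel {a..b} f"
    by (rule set_integrable_subset) (use assms in auto)
  then show ?thesis
    by (simp add: set_integrable_def integrable_restrict_space)
qed

lemma integral_time_mono:
  fixes f :: "real \<Rightarrow> real"
  assumes f: "integrable (time 0 T) f" and ab: "0 \<le> a" "b \<le> T"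
    and nonneg: "\<And>t. t \<in> {0..T} \<Longrightarrow> 0 \<le> f t"
  shows "(\<integral>s. f s \<partial>time a b) \<le> (\<integral>s. f s \<partial>time 0 T)"
proof -
  have "(LINT s:{a..b}|lborel. f s) \<le> (LINT s:{0..T}|lborel. f s)"
    unfolding set_lebesgue_integral_def
  proof (rule integral_mono)
    show "integrable lborel (\<lambda>s. indicator {a..b} s *\<^sub>R f s)" "integrable lborel (\<lambda>s. indicator {0..T} s *\<^sub>R f s)"
      using f integrable_time_subset[OF f ab] by (simp_all add: integrable_restrict_space)
  qed (use nonneg ab in \<open>auto simp: indicator_def\<close>)
  then show ?thesis by (simp add: set_lebesgue_integral_time)
qed

lemma measurable_time:
  assumes "{a..b} \<subseteq> {0..t::real}"
  shows "(\<lambda>s. s) \<in> time a b \<rightarrow>\<^sub>M upto t"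
proof (rule measurable_restrict_space2)
  show "(\<lambda>s. s) \<in> space (time a b) \<rightarrow> {0..t}"
    using assms by (auto simp: space_restrict_space)
  show "(\<lambda>s. s) \<in> time a b \<rightarrow>\<^sub>M borel"
    by (rule measurable_restrict_space1) simp
qed

lemma measurable_time_section:
  assumes f: "f \<in> upto t \<Otimes>\<^sub>M N \<rightarrow>\<^sub>M K" and ab: "{a..b} \<subseteq> {0..t::real}" and \<omega>: "\<omega> \<in> space N"
  shows "(\<lambda>s. f (s, \<omega>)) \<in> time a b \<rightarrow>\<^sub>M K"
proof -
  have "(\<lambda>s. (s, \<omega>)) \<in> time a b \<rightarrow>\<^sub>M upto t \<Otimes>\<^sub>M N"
    by (intro measurable_Pair measurable_time[OF ab] measurable_const \<omega>)
  from measurable_compose[OF this f] show ?thesis .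
qed

lemma measurable_time_integral:
  fixes f :: "real \<times> 'w \<Rightarrow> 'b::{banach, second_countable_topology}"
  assumes f: "f \<in> borel_measurable (upto t \<Otimes>\<^sub>M N)" and ab: "{a..b} \<subseteq> {0..t}"
  shows "(\<lambda>\<omega>. \<integral>s. f (s, \<omega>) \<partial>time a b) \<in> borel_measurable N"
proof -
  interpret finite_measure "time a b" by (rule finite_measure_time)
  have "(\<lambda>x. (snd x, fst x)) \<in> N \<Otimes>\<^sub>M time a b \<rightarrow>\<^sub>M upto t \<Otimes>\<^sub>M N"
    by (intro measurable_Pair measurable_compose[OF measurable_snd measurable_time[OF ab]] measurable_fst)
  from measurable_compose[OF this f]
  have "(\<lambda>(\<omega>, s). f (s, \<omega>)) \<in> borel_measurable (N \<Otimes>\<^sub>M time a b)"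
    by (simp add: case_prod_unfold)
  then show ?thesis by (rule borel_measurable_lebesgue_integral)
qed

text \<open>Absolute continuity of the integral: split \<open>f\<close> into
  \<open>min (f s) n\<close>, which contributes at most \<open>n * (b - a)\<close>, and the excess,
  whose integral over [0, T] is below \<open>c / 2\<close> for large \<open>n\<close> by dominated
  convergence.\<close>

lemma small_time_integral:
  fixes f :: "real \<Rightarrow> real"
  assumes f: "integrable (time 0 T) f"
    and nonneg: "\<And>t. t \<in> {0..T} \<Longrightarrow> 0 \<le> f t" and c: "c > 0"
  shows "\<exists>\<delta>>0. \<forall>a b. 0 \<le> a \<longrightarrow> a \<le> b \<longrightarrow> b \<le> T \<longrightarrow> b - a \<le> \<delta> \<longrightarrow>
    (\<integral>s. f s \<partial>time a b) \<le> c"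
proof -
  let ?R = "time 0 T"
  have fm[measurable]: "f \<in> borel_measurable ?R" using f by simp
  have "(\<lambda>n::nat. \<integral>s. f s - min (f s) (real n) \<partial>?R) \<longlonglongrightarrow> (\<integral>s. 0 \<partial>?R)"
  proof (rule integral_dominated_convergence[where w = f])
    show "AE s in ?R. (\<lambda>n. f s - min (f s) (real n)) \<longlonglongrightarrow> 0"
    proof (rule AE_I2)
      fix s
      obtain n0 where n0: "f s \<le> real n0" using real_arch_simple by blast
      have "\<forall>\<^sub>F n in sequentially. f s - min (f s) (real n) = 0"
        using eventually_ge_at_top[of n0] by eventually_elim (use n0 in auto)
      then show "(\<lambda>n. f s - min (f s) (real n)) \<longlonglongrightarrow> 0" by (rule tendsto_eventually)
    qed
    show "AE s in ?R. norm (f s - min (f s) (real n)) \<le> f s" for n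
      using nonneg by (intro AE_I2) (auto simp: space_restrict_space min_def)
  qed (use f in auto)
  then have "(\<lambda>n::nat. \<integral>s. f s - min (f s) (real n) \<partial>?R) \<longlonglongrightarrow> 0" by simp
  then have "\<forall>\<^sub>F n in sequentially. (\<integral>s. f s - min (f s) (real n) \<partial>?R) < c / 2"
    by (rule order_tendstoD) (use c in simp)
  then obtain n :: nat where n: "(\<integral>s. f s - min (f s) (real n) \<partial>?R) < c / 2"
    using eventually_happens'[OF sequentially_bot] by blast
  have gi: "integrable ?R (\<lambda>s. f s - min (f s) (real n))"
  proof (rule Bochner_Integration.integrable_bound[OF f])
    show "AE s in ?R. norm (f s - min (f s) (real n)) \<le> norm (f s)"
      using nonneg by (intro AE_I2) (auto simp: space_restrict_space min_def)
  qed simp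
  show ?thesis
  \<comment> \<open>The length is chosen such that the truncated part contributes at most
    \<open>c / 2\<close>; adding 1 to \<open>n\<close> covers n = 0.\<close>
  proof (intro exI[of _ "c / (2 * (real n + 1))"] conjI allI impI)
    show "c / (2 * (real n + 1)) > 0" using c by (intro divide_pos_pos) auto
    fix a b assume ab: "0 \<le> a" "a \<le> b" "b \<le> T" "b - a \<le> c / (2 * (real n + 1))"
    interpret fm: finite_measure "time a b" by (rule finite_measure_time)
    have "(\<integral>s. f s \<partial>time a b)
      \<le> (\<integral>s. (f s - min (f s) (real n)) + real n \<partial>time a b)"
      using integrable_time_subset[OF f ab(1,3)] integrable_time_subset[OF gi ab(1,3)]
      by (intro integral_mono) auto
    also have "\<dots> = (\<integral>s. f s - min (f s) (real n) \<partial>time a b) + (b - a) * real n"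
      using integrable_time_subset[OF gi ab(1,3)] measure_time_space[OF ab(2)] by simp
    also have "\<dots> \<le> c / 2 + c / (2 * (real n + 1)) * (real n + 1)"
    proof (intro add_mono)
      have "(\<integral>s. f s - min (f s) (real n) \<partial>time a b)
          \<le> (\<integral>s. f s - min (f s) (real n) \<partial>?R)"
        using gi ab(1,3) by (rule integral_time_mono) auto
      then show "(\<integral>s. f s - min (f s) (real n) \<partial>time a b) \<le> c / 2"
        using n by simp
      show "(b - a) * real n \<le> c / (2 * (real n + 1)) * (real n + 1)"
        using ab c by (intro mult_mono) auto
    qed
    also have "\<dots> = c" by (simp add: field_simps)
    finally show "(\<integral>s. f s \<partial>time a b) \<le> c" .
  qed
qed

section \<open>The setting of the schemes\<close>

lemma grid_bounds:
  assumes "T > 0" "i \<le> m"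
  shows "0 \<le> grid T m i" "grid T m i \<le> T" "grid T m i \<in> {0..T}"
  using assms by (auto simp: grid_def divide_le_eq mult.commute)

lemma grid_mono: "T > 0 \<Longrightarrow> i \<le> j \<Longrightarrow> grid T m i \<le> grid T m j"
  by (simp add: grid_def mult_right_mono divide_right_mono)

lemma grid_step: "1 \<le> i \<Longrightarrow> grid T m i - grid T m (i - 1) = T / real m"
  by (simp add: grid_def of_nat_diff algebra_simps diff_divide_distrib)

locale implicit_schemes =
  fixes T p q \<alpha> :: real
    and \<iota> :: "'v::{banach, second_countable_topology}
               \<Rightarrow>\<^sub>L 'h::{real_inner, banach, second_countable_topology}"
    and J :: "nat set" and g :: "nat \<Rightarrow> 'u::{real_inner, banach}"
    and M :: "'w measure" and Fl :: "real \<Rightarrow> 'w measure"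
    and W :: "real \<Rightarrow> 'w \<Rightarrow> 'u \<Rightarrow> real"
    and \<nu> :: "'e::metric_space measure" and N :: "'w \<Rightarrow> (real \<times> 'e) measure"
    and A :: "real \<Rightarrow> 'w \<Rightarrow> 'v \<Rightarrow> ('v \<Rightarrow>\<^sub>L real)"
    and B :: "real \<Rightarrow> 'w \<Rightarrow> 'v \<Rightarrow> ('u \<Rightarrow>\<^sub>L 'h)"
    and F :: "real \<Rightarrow> 'w \<Rightarrow> 'v \<Rightarrow> 'e \<Rightarrow> 'h"
    and K1 K2 :: "real \<Rightarrow> 'w \<Rightarrow> real" and lam mu :: "real \<Rightarrow> real"
    and \<zeta> :: "'w \<Rightarrow> 'h"
    and P :: "nat \<Rightarrow> 'e set set"
  assumes reflexive: "reflexive_space TYPE('v)" and inj: "inj (blinfun_apply \<iota>)" and T: "T > 0"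
    and J: "orthonormal_basis J g"
    and filt: "usual_filtration T M Fl"
    and W: "cylindrical_wiener T M Fl W"
    and \<nu>_sets: "sets \<nu> = sets borel" and \<nu>_sf: "sigma_finite_measure \<nu>"
    and N: "poisson_random_measure T M Fl \<nu> N"
    and A_meas: "(\<lambda>((t, \<omega>), x). A t \<omega> x) \<in> borel_measurable (progressive_sigma T M Fl \<Otimes>\<^sub>M borel)"
    and B_meas: "(\<lambda>((t, \<omega>), x). B t \<omega> x) \<in> progressive_sigma T M Fl \<Otimes>\<^sub>M borel \<rightarrow>\<^sub>M hs_borel J g"
    and F_meas: "(\<lambda>((t, \<omega>), x, \<xi>). F t \<omega> x \<xi>)
           \<in> borel_measurable (predictable_sigma T M Fl \<Otimes>\<^sub>M (borel \<Otimes>\<^sub>M borel))"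
    and p: "p \<ge> 2" and pq: "1 / p + 1 / q = 1"
    and K_nonneg: "\<forall>t\<in>{0..T}. \<forall>\<omega>\<in>space M. K1 t \<omega> \<ge> 0 \<and> K2 t \<omega> \<ge> 0"
    and K1_int: "integrable (time 0 T \<Otimes>\<^sub>M M) (\<lambda>(t, \<omega>). K1 t \<omega>)"
    and K2_int: "integrable (time 0 T \<Otimes>\<^sub>M M) (\<lambda>(t, \<omega>). K2 t \<omega>)"
    and lam_mu: "\<forall>t\<in>{0..T}. lam t > 0 \<and> mu t \<ge> 0"
    and lam_int: "integrable (time 0 T) lam"
    and mu_int: "integrable (time 0 T) mu"
    and monotone: "AE \<omega> in M. \<forall>x y. \<forall>t\<in>{0..T}.
           integrable \<nu> (\<lambda>\<xi>. (norm (F t \<omega> x \<xi> - F t \<omega> y \<xi>))\<^sup>2) \<and>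
           2 * (A t \<omega> x - A t \<omega> y) (x - y)
             + (hs_norm J g (B t \<omega> x - B t \<omega> y))\<^sup>2
             + (\<integral>\<xi>. (norm (F t \<omega> x \<xi> - F t \<omega> y \<xi>))\<^sup>2 \<partial>\<nu>) \<le> 0"
    and coercive: "AE \<omega> in M. \<forall>x. \<forall>t\<in>{0..T}.
           integrable \<nu> (\<lambda>\<xi>. (norm (F t \<omega> x \<xi>))\<^sup>2) \<and>
           2 * A t \<omega> x x + (hs_norm J g (B t \<omega> x))\<^sup>2
             + (\<integral>\<xi>. (norm (F t \<omega> x \<xi>))\<^sup>2 \<partial>\<nu>) + lam t * norm x powr p
           \<le> K1 t \<omega> + mu t * (norm (\<iota> x))\<^sup>2"
    and \<alpha>: "\<alpha> > 0"
    and growth: "AE \<omega> in M. \<forall>x. \<forall>t\<in>{0..T}.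
           norm (A t \<omega> x) powr q
             \<le> \<alpha> * lam t powr q * norm x powr p + K2 t \<omega> * lam t powr (q - 1)"
    and hemi: "AE \<omega> in M. \<forall>x y z. \<forall>t\<in>{0..T}.
           ((\<lambda>r. (A t \<omega> (x + r *\<^sub>R y)) z) \<longlongrightarrow> A t \<omega> x z) (at 0)"
    and \<zeta>: "\<zeta> \<in> borel_measurable (Fl 0)" and \<zeta>_int: "integrable M (\<lambda>\<omega>. (norm (\<zeta> \<omega>))\<^sup>2)"
    and P_finite: "\<And>l. l \<ge> 1 \<Longrightarrow> finite (P l)"
    and P_cell: "\<And>l C. l \<ge> 1 \<Longrightarrow> C \<in> P l \<Longrightarrow> C \<in> sets \<nu> \<and> emeasure \<nu> C < \<infinity>"
begin

sublocale prob: prob_space M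
  using filt by (simp add: usual_filtration_def)

sublocale mark: sigma_finite_measure \<nu>
  by (rule \<nu>_sf)

text \<open>The second identity matches the powers of \<open>lam\<close> in the growth condition
  with those that Young's inequality produces in \<open>weighted_growth\<close>.\<close>

lemma q: "q > 1" and q_div_p: "q / p = q - 1"
proof -
  have q0: "q \<noteq> 0" using pq p by auto
  have *: "q + p = p * q" using pq p q0 by (simp add: field_simps)
  then have "q * (p - 1) = p" by (simp add: algebra_simps)
  then have qp: "q = p / (p - 1)" using p by (simp add: field_simps)
  show "q > 1" unfolding qp using p by (simp add: less_divide_eq)
  show "q / p = q - 1" using * p by (simp add: field_simps)
qed

text \<open>Collects the paths on which everything can be argued deterministically. Monotonicity is
  recorded for \<open>A\<close> alone, the other two terms of the assumption being nonnegative; time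
  integrability of \<open>K1\<close> and \<open>K2\<close> on a path comes from Fubini and therefore
  holds almost surely.\<close>

definition good :: "'w \<Rightarrow> bool" where
  "good \<omega> \<longleftrightarrow> \<omega> \<in> space M \<and>
     (\<forall>x y. \<forall>t\<in>{0..T}. (A t \<omega> x - A t \<omega> y) (x - y) \<le> 0) \<and>
     (\<forall>x. \<forall>t\<in>{0..T}. integrable \<nu> (\<lambda>\<xi>. (norm (F t \<omega> x \<xi>))\<^sup>2) \<and>
           2 * A t \<omega> x x + (hs_norm J g (B t \<omega> x))\<^sup>2
             + (\<integral>\<xi>. (norm (F t \<omega> x \<xi>))\<^sup>2 \<partial>\<nu>) + lam t * norm x powr p
           \<le> K1 t \<omega> + mu t * (norm (\<iota> x))\<^sup>2) \<and>
     (\<forall>x. \<forall>t\<in>{0..T}. norm (A t \<omega> x) powr q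
             \<le> \<alpha> * lam t powr q * norm x powr p + K2 t \<omega> * lam t powr (q - 1)) \<and>
     (\<forall>x y z. \<forall>t\<in>{0..T}.
           ((\<lambda>r. (A t \<omega> (x + r *\<^sub>R y)) z) \<longlongrightarrow> A t \<omega> x z) (at 0)) \<and>
     integrable (time 0 T) (\<lambda>t. K1 t \<omega>) \<and> integrable (time 0 T) (\<lambda>t. K2 t \<omega>)"

lemma pair_sigma_finite_time: "pair_sigma_finite (time 0 T) M"
proof -
  interpret t: finite_measure "time 0 T" by (rule finite_measure_time)
  show ?thesis by unfold_locales
qed

lemma AE_good: "AE \<omega> in M. good \<omega>"
proof -
  have K1: "AE \<omega> in M. integrable (time 0 T) (\<lambda>t. K1 t \<omega>)"
    by (rule pair_sigma_finite.AE_integrable_snd[OF pair_sigma_finite_time K1_int])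
  have K2: "AE \<omega> in M. integrable (time 0 T) (\<lambda>t. K2 t \<omega>)"
    by (rule pair_sigma_finite.AE_integrable_snd[OF pair_sigma_finite_time K2_int])
  have mono: "AE \<omega> in M. \<forall>x y. \<forall>t\<in>{0..T}. (A t \<omega> x - A t \<omega> y) (x - y) \<le> 0"
    using monotone
  proof eventually_elim
    case (elim \<omega>)
    show ?case
    proof (intro allI ballI)
      fix x y t assume t: "t \<in> {0..T}"
      have "0 \<le> (hs_norm J g (B t \<omega> x - B t \<omega> y))\<^sup>2" by simp
      moreover have "0 \<le> (\<integral>\<xi>. (norm (F t \<omega> x \<xi> - F t \<omega> y \<xi>))\<^sup>2 \<partial>\<nu>)"
        by (rule integral_nonneg_AE) simp
      moreover have "2 * (A t \<omega> x - A t \<omega> y) (x - y) + (hs_norm J g (B t \<omega> x - B t \<omega> y))\<^sup>2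
          + (\<integral>\<xi>. (norm (F t \<omega> x \<xi> - F t \<omega> y \<xi>))\<^sup>2 \<partial>\<nu>) \<le> 0"
        using elim t by blast
      ultimately show "(A t \<omega> x - A t \<omega> y) (x - y) \<le> 0"
        by linarith
    qed
  qed
  show ?thesis
    unfolding good_def
    by (rule eventually_conj[OF AE_space eventually_conj[OF mono eventually_conj[OF coercive
          eventually_conj[OF growth eventually_conj[OF hemi eventually_conj[OF K1 K2]]]]]])
qed

lemma good_space: "good \<omega> \<Longrightarrow> \<omega> \<in> space M"
  by (simp add: good_def)

lemma good_monotone:
  "good \<omega> \<Longrightarrow> t \<in> {0..T} \<Longrightarrow> (A t \<omega> x - A t \<omega> y) (x - y) \<le> 0"
  unfolding good_def by blast

lemma good_coercive:
  "good \<omega> \<Longrightarrow> t \<in> {0..T} \<Longrightarrow>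
    2 * A t \<omega> x x + (hs_norm J g (B t \<omega> x))\<^sup>2
      + (\<integral>\<xi>. (norm (F t \<omega> x \<xi>))\<^sup>2 \<partial>\<nu>) + lam t * norm x powr p
    \<le> K1 t \<omega> + mu t * (norm (\<iota> x))\<^sup>2"
  unfolding good_def by blast

lemma good_F_integrable:
  "good \<omega> \<Longrightarrow> t \<in> {0..T} \<Longrightarrow> integrable \<nu> (\<lambda>\<xi>. (norm (F t \<omega> x \<xi>))\<^sup>2)"
  unfolding good_def by blast

lemma good_growth:
  "good \<omega> \<Longrightarrow> t \<in> {0..T} \<Longrightarrow>
    norm (A t \<omega> x) powr q \<le> \<alpha> * lam t powr q * norm x powr p + K2 t \<omega> * lam t powr (q - 1)"
  unfolding good_def by blast

lemma good_hemi:
  "good \<omega> \<Longrightarrow> t \<in> {0..T} \<Longrightarrow>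
    ((\<lambda>r. (A t \<omega> (x + r *\<^sub>R y)) z) \<longlongrightarrow> A t \<omega> x z) (at 0)"
  unfolding good_def by blast

lemma good_K_integrable:
  assumes "good \<omega>"
  shows "integrable (time 0 T) (\<lambda>t. K1 t \<omega>)" "integrable (time 0 T) (\<lambda>t. K2 t \<omega>)"
  using assms unfolding good_def by blast+

lemma good_K_nonneg: "good \<omega> \<Longrightarrow> t \<in> {0..T} \<Longrightarrow> 0 \<le> K1 t \<omega> \<and> 0 \<le> K2 t \<omega>"
  using K_nonneg good_space by blast

lemma lam_pos: "t \<in> {0..T} \<Longrightarrow> 0 < lam t" and mu_nonneg: "t \<in> {0..T} \<Longrightarrow> 0 \<le> mu t"
  using lam_mu by blast+

text \<open>Young's inequality for \<open>(lam powr (- 1 / p) * norm A) * (lam powr (1 / p) * \<rho>)\<close>.\<close>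

lemma weighted_growth:
  assumes \<omega>: "good \<omega>" and t: "t \<in> {0..T}" and \<rho>: "0 \<le> \<rho>"
  shows "norm (A t \<omega> x) * \<rho> \<le> lam t * (\<alpha> * norm x powr p + \<rho> powr p) + K2 t \<omega>"
proof -
  define a where "a = norm (A t \<omega> x)"
  define l where "l = lam t"
  have l: "l > 0" unfolding l_def by (rule lam_pos[OF t])
  have a: "a \<ge> 0" by (simp add: a_def)
  have "a * \<rho> = (a * l powr (- 1 / p)) * (\<rho> * l powr (1 / p))"
    using l by (simp add: powr_minus field_simps)
  also have "\<dots> \<le> (a * l powr (- 1 / p)) powr q / q + (\<rho> * l powr (1 / p)) powr p / p"
    using p q pq a \<rho> by (intro Youngs_inequality) (auto simp: add.commute)
  also have "\<dots> \<le> (a * l powr (- 1 / p)) powr q + (\<rho> * l powr (1 / p)) powr p"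
    using p q by (intro add_mono) (auto simp: divide_le_eq mult_le_cancel_left1)
  also have "(\<rho> * l powr (1 / p)) powr p = l * \<rho> powr p"
    using p l \<rho> by (simp add: powr_mult powr_powr)
  \<comment> \<open>As q/p = q - 1, the weight is \<open>l powr (- (q - 1))\<close>: it reduces the
    two powers of \<open>l\<close> in the growth bound to \<open>l\<close> and to 1.\<close>
  also have "(a * l powr (- 1 / p)) powr q = a powr q * l powr (- (q - 1))"
    using a l q_div_p by (simp add: powr_mult powr_powr)
  also have "a powr q * l powr (- (q - 1))
      \<le> (\<alpha> * l powr q * norm x powr p + K2 t \<omega> * l powr (q - 1)) * l powr (- (q - 1))"
    using good_growth[OF \<omega> t] unfolding a_def l_def by (intro mult_right_mono) auto
  also have "\<dots> = \<alpha> * norm x powr p * (l powr q * l powr (- (q - 1))) + K2 t \<omega> * (l powr (q - 1) * l powr (- (q - 1)))"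
    by (simp add: algebra_simps)
  also have "\<dots> = \<alpha> * norm x powr p * l + K2 t \<omega>"
    using l by (simp flip: powr_add)
  finally show ?thesis unfolding a_def l_def by (simp add: algebra_simps)
qed

text \<open>What coercivity leaves for the two noise terms when
  \<open>- 2 * A t \<omega> x x\<close> is estimated by \<open>weighted_growth\<close> with \<rho> =
  \<open>norm x\<close>; this accounts for the coefficient \<open>2 * (\<alpha> + 1)\<close> and the
  doubled \<open>K2\<close>.\<close>

definition noise_bound :: "real \<Rightarrow> 'w \<Rightarrow> 'v \<Rightarrow> real" where
  "noise_bound t \<omega> x = K1 t \<omega> + 2 * K2 t \<omega> + mu t * (norm (\<iota> x))\<^sup>2
     + 2 * (\<alpha> + 1) * norm x powr p * lam t"

lemma noise_bound:
  assumes \<omega>: "good \<omega>" and t: "t \<in> {0..T}"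
  shows "(hs_norm J g (B t \<omega> x))\<^sup>2 \<le> noise_bound t \<omega> x"
    and "(\<integral>\<xi>. (norm (F t \<omega> x \<xi>))\<^sup>2 \<partial>\<nu>) \<le> noise_bound t \<omega> x"
    and "0 \<le> noise_bound t \<omega> x"
proof -
  have "- A t \<omega> x x \<le> norm (A t \<omega> x) * norm x"
    using norm_blinfun[of "A t \<omega> x" x] by simp
  also have "\<dots> \<le> lam t * (\<alpha> * norm x powr p + norm x powr p) + K2 t \<omega>"
    by (rule weighted_growth[OF \<omega> t]) simp
  finally have 1: "- 2 * A t \<omega> x x \<le> 2 * (\<alpha> + 1) * norm x powr p * lam t + 2 * K2 t \<omega>"
    by (simp add: algebra_simps)
  have 2: "0 \<le> lam t * norm x powr p" using lam_pos[OF t] by simp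
  have 3: "0 \<le> (\<integral>\<xi>. (norm (F t \<omega> x \<xi>))\<^sup>2 \<partial>\<nu>)" by (rule integral_nonneg_AE) simp
  show "(hs_norm J g (B t \<omega> x))\<^sup>2 \<le> noise_bound t \<omega> x"
    and F: "(\<integral>\<xi>. (norm (F t \<omega> x \<xi>))\<^sup>2 \<partial>\<nu>) \<le> noise_bound t \<omega> x"
    using good_coercive[OF \<omega> t, of x] 1 2 3 zero_le_power2[of "hs_norm J g (B t \<omega> x)"]
    unfolding noise_bound_def by linarith+
  show "0 \<le> noise_bound t \<omega> x" using F 3 by linarith
qed

lemma noise_bound_integrable:
  "good \<omega> \<Longrightarrow> integrable (time 0 T) (\<lambda>t. noise_bound t \<omega> x)"
  unfolding noise_bound_def using good_K_integrable lam_int mu_int by simp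

text \<open>Integrals over all of [0, T] are used, so that one constant serves every subinterval in
  \<open>noise_bound_integral_le\<close>.\<close>

definition noise_const :: real where
  "noise_const = (norm \<iota>)\<^sup>2 * (\<integral>t. mu t \<partial>time 0 T) + 2 * (\<alpha> + 1) * (\<integral>t. lam t \<partial>time 0 T)"

definition K_integral :: "'w \<Rightarrow> real" where
  "K_integral \<omega> = (\<integral>t. K1 t \<omega> \<partial>time 0 T) + 2 * (\<integral>t. K2 t \<omega> \<partial>time 0 T)"

lemma K_integral_integrable: "integrable M K_integral"
  unfolding K_integral_def
  using pair_sigma_finite.integrable_snd[OF pair_sigma_finite_time K1_int]
    pair_sigma_finite.integrable_snd[OF pair_sigma_finite_time K2_int] by simp

lemma integral_mu_nonneg: "0 \<le> (\<integral>t. mu t \<partial>time 0 T)" and integral_lam_nonneg: "0 \<le> (\<integral>t. lam t \<partial>time 0 T)"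
  by (intro integral_nonneg_AE AE_I2; simp add: space_restrict_space lam_pos mu_nonneg less_imp_le)+

text \<open>For \<open>norm x \<le> 1\<close> the square is at most 1; beyond that p \<ge> 2 lets
  the p-th power dominate it. This converts p-th moments in V into second moments in H.\<close>

lemma norm_embedding_power2_le: "(norm (\<iota> x))\<^sup>2 \<le> (norm \<iota>)\<^sup>2 * (1 + norm x powr p)"
proof -
  have "(norm (\<iota> x))\<^sup>2 \<le> (norm \<iota> * norm x)\<^sup>2"
    by (intro power_mono norm_blinfun) simp
  moreover have "(norm x)\<^sup>2 \<le> 1 + norm x powr p"
  proof (cases "norm x \<le> 1")
    case True
    then have "(norm x)\<^sup>2 \<le> 1" by (simp add: power_le_one)
    then show ?thesis by (smt (verit) powr_ge_zero)
  next
    case False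
    then have "norm x powr 2 \<le> norm x powr p" using p by (intro powr_mono) auto
    moreover have "norm x powr 2 = (norm x)\<^sup>2" using False by (subst powr_numeral) auto
    ultimately show ?thesis by simp
  qed
  ultimately show ?thesis
    by (smt (verit) mult_left_mono power_mult_distrib zero_le_power2)
qed

lemma noise_bound_integral_le:
  assumes \<omega>: "good \<omega>" and ab: "0 \<le> a" "b \<le> T"
  shows "(\<integral>t. noise_bound t \<omega> x \<partial>time a b) \<le> K_integral \<omega> + noise_const * (1 + norm x powr p)"
proof -
  have "(\<integral>t. noise_bound t \<omega> x \<partial>time a b) \<le> (\<integral>t. noise_bound t \<omega> x \<partial>time 0 T)"
    using noise_bound_integrable[OF \<omega>] ab noise_bound(3)[OF \<omega>] by (rule integral_time_mono)
  also have "\<dots> = K_integral \<omega> + (\<integral>t. mu t \<partial>time 0 T) * (norm (\<iota> x))\<^sup>2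
      + 2 * (\<alpha> + 1) * norm x powr p * (\<integral>t. lam t \<partial>time 0 T)"
    unfolding noise_bound_def K_integral_def using good_K_integrable[OF \<omega>] lam_int mu_int by simp
  also have "\<dots> \<le> K_integral \<omega> + (\<integral>t. mu t \<partial>time 0 T) * ((norm \<iota>)\<^sup>2 * (1 + norm x powr p))
      + 2 * (\<alpha> + 1) * (1 + norm x powr p) * (\<integral>t. lam t \<partial>time 0 T)"
    using integral_mu_nonneg integral_lam_nonneg \<alpha> norm_embedding_power2_le[of x]
    by (intro add_mono mult_right_mono mult_left_mono) auto
  also have "\<dots> = K_integral \<omega> + noise_const * (1 + norm x powr p)"
    unfolding noise_const_def by (simp add: algebra_simps)
  finally show ?thesis .
qed

section \<open>Measurability of the coefficients at random arguments\<close>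

lemma measurable_blinfun_eval: "(\<lambda>\<phi>. blinfun_apply \<phi> z) \<in> borel_measurable borel"
  by (intro borel_measurable_continuous_onI continuous_intros)

text \<open>The argument is a random variable because the noise coefficients are evaluated at the
  preceding solution; joint measurability in time, path and argument makes the composition
  measurable.\<close>

lemma measurable_argument:
  assumes t: "t \<in> {0..T}" and X: "X \<in> borel_measurable (Fl t)"
  shows "(\<lambda>x. (x, X (snd x))) \<in> upto t \<Otimes>\<^sub>M Fl t \<rightarrow>\<^sub>M progressive_sigma T M Fl \<Otimes>\<^sub>M borel"
  by (intro measurable_Pair measurable_progressive_restrict[OF filt t] measurable_compose[OF measurable_snd X])

lemma A_measurable:
  assumes t: "t \<in> {0..T}" and X: "X \<in> borel_measurable (Fl t)"
  shows "(\<lambda>x. (A (fst x) (snd x) (X (snd x))) z)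
    \<in> borel_measurable (upto t \<Otimes>\<^sub>M Fl t)"
  using measurable_compose[OF measurable_compose[OF measurable_argument[OF t X] A_meas] measurable_blinfun_eval]
  by (simp add: case_prod_unfold)

lemma B_measurable_hs:
  assumes t: "t \<in> {0..T}" and X: "X \<in> borel_measurable (Fl t)"
  shows "(\<lambda>x. B (fst x) (snd x) (X (snd x))) \<in> upto t \<Otimes>\<^sub>M Fl t \<rightarrow>\<^sub>M hs_borel J g"
  using measurable_compose[OF measurable_argument[OF t X] B_meas]
  by (simp add: case_prod_unfold)

lemma B_measurable:
  assumes t: "t \<in> {0..T}" and X: "X \<in> borel_measurable (Fl t)"
  shows "(\<lambda>x. (B (fst x) (snd x) (X (snd x))) z)
    \<in> borel_measurable (upto t \<Otimes>\<^sub>M Fl t)"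
  by (rule measurable_compose[OF B_measurable_hs[OF t X] measurable_hs_borel_apply[OF J]])

lemma F_measurable:
  assumes t: "t \<in> {0..T}" and X: "X \<in> borel_measurable (Fl t)"
  shows "(\<lambda>(x, \<xi>). F (fst x) (snd x) (X (snd x)) \<xi>)
    \<in> borel_measurable ((upto t \<Otimes>\<^sub>M Fl t) \<Otimes>\<^sub>M \<nu>)"
proof -
  have id: "(\<lambda>\<xi>. \<xi>) \<in> \<nu> \<rightarrow>\<^sub>M borel" using \<nu>_sets by (simp add: measurable_ident_sets)
  have "(\<lambda>y. (fst y, X (snd (fst y)), snd y)) \<in> (upto t \<Otimes>\<^sub>M Fl t) \<Otimes>\<^sub>M \<nu>
      \<rightarrow>\<^sub>M predictable_sigma T M Fl \<Otimes>\<^sub>M (borel \<Otimes>\<^sub>M borel)"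
    by (intro measurable_Pair measurable_compose[OF measurable_fst measurable_predictable_restrict[OF filt t]]
        measurable_compose[OF measurable_compose[OF measurable_fst measurable_snd] X]
        measurable_compose[OF measurable_snd id])
  from measurable_compose[OF this F_meas] show ?thesis
    by (simp add: case_prod_unfold)
qed

lemma space_Fl: "t \<in> {0..T} \<Longrightarrow> space (Fl t) = space M"
  by (rule filtration_space[OF filt])

lemma B_hs_ops: "\<omega> \<in> space M \<Longrightarrow> t \<in> {0..T} \<Longrightarrow> B t \<omega> x \<in> hs_ops J g"
  using measurable_space[OF B_measurable_hs[of T "\<lambda>_. x"], of "(t, \<omega>)"] T
  by (simp add: space_pair_measure space_restrict_space space_Fl space_hs_borel)

lemma A_time_measurable:
  assumes "\<omega> \<in> space M" "0 \<le> a" "b \<le> T"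
  shows "(\<lambda>s. A s \<omega> x z) \<in> borel_measurable (time a b)"
  using measurable_time_section[OF A_measurable[of T "\<lambda>_. x" z], of a b \<omega>] assms T
  by (simp add: space_Fl)

lemma B_time_measurable:
  assumes "\<omega> \<in> space M" "0 \<le> a" "b \<le> T"
  shows "(\<lambda>s. B s \<omega> x z) \<in> borel_measurable (time a b)"
  using measurable_time_section[OF B_measurable[of T "\<lambda>_. x" z], of a b \<omega>] assms T
  by (simp add: space_Fl)

end

section \<open>One implicit step\<close>

lemma H_to_dual_apply: "H_to_dual \<iota> h v = \<iota> v \<bullet> h"
  by (simp add: H_to_dual_def)

context implicit_schemes
begin

definition implicit_op :: "nat \<Rightarrow> nat \<Rightarrow> 'w \<Rightarrow> 'v \<Rightarrow> ('v \<Rightarrow>\<^sub>L real)" where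
  "implicit_op m i \<omega> x = H_to_dual \<iota> (\<iota> x) - (T / real m) *\<^sub>R A_disc T A m i \<omega> x"

context
  fixes m :: nat
  assumes m: "m \<ge> 1"
    and mu_small: "\<And>i. i \<in> {1..m} \<Longrightarrow>
      (\<integral>s. mu s \<partial>time (grid T m (i - 1)) (grid T m i)) \<le> 1"
begin

abbreviation step_time :: "nat \<Rightarrow> real measure" where
  "step_time i \<equiv> time (grid T m (i - 1)) (grid T m i)"

lemma step_size: "T / real m > 0"
  using T m by simp

context
  fixes i assumes i: "i \<in> {1..m}"
begin

lemma step_bounds: "0 \<le> grid T m (i - 1)" "grid T m i \<le> T" "grid T m (i - 1) < grid T m i"
    "grid T m (i - 1) \<in> {0..T}" "grid T m i \<in> {0..T}"
  using grid_bounds[OF T, of "i - 1" m] grid_bounds[OF T, of i m] grid_step[of i T m] i step_size by auto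

lemma step_space: "s \<in> space (step_time i) \<Longrightarrow> s \<in> {0..T}"
  using step_bounds by (auto simp: space_restrict_space)

text \<open>Young's inequality with \<rho> = 1 turns the growth of the q-th power into a bound of
  the norm itself by a function integrable in time.\<close>

lemma A_step_bound:
  assumes \<omega>: "good \<omega>" and s: "s \<in> {0..T}" and x: "norm x \<le> \<rho>"
  shows "norm (A s \<omega> x) \<le> lam s * (\<alpha> * \<rho> powr p + 1) + K2 s \<omega>"
proof -
  have "norm (A s \<omega> x) \<le> lam s * (\<alpha> * norm x powr p + 1) + K2 s \<omega>"
    using weighted_growth[OF \<omega> s, of 1 x] by simp
  also have "\<dots> \<le> lam s * (\<alpha> * \<rho> powr p + 1) + K2 s \<omega>"
    using x p \<alpha> lam_pos[OF s] by (intro add_mono mult_left_mono powr_mono2) auto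
  finally show ?thesis .
qed

lemma A_step_bound_integrable:
  assumes \<omega>: "good \<omega>"
  shows "integrable (step_time i) (\<lambda>s. lam s * c + K2 s \<omega>)"
  using integrable_time_subset[OF lam_int step_bounds(1,2)]
    integrable_time_subset[OF good_K_integrable(2)[OF \<omega>] step_bounds(1,2)] by simp

lemma A_step_measurable:
  assumes \<omega>: "good \<omega>"
  shows "(\<lambda>s. A s \<omega> x y) \<in> borel_measurable (step_time i)"
  by (rule A_time_measurable[OF good_space[OF \<omega>] step_bounds(1,2)])

lemma A_apply_bound:
  assumes \<omega>: "good \<omega>" and x: "norm x \<le> \<rho>" and s: "s \<in> space (step_time i)"
  shows "norm (A s \<omega> x y) \<le> norm y * (lam s * (\<alpha> * \<rho> powr p + 1) + K2 s \<omega>)"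
proof -
  have "norm (A s \<omega> x y) \<le> norm (A s \<omega> x) * norm y" by (rule norm_blinfun)
  also have "\<dots> \<le> (lam s * (\<alpha> * \<rho> powr p + 1) + K2 s \<omega>) * norm y"
    by (intro mult_right_mono A_step_bound[OF \<omega> step_space[OF s] x]) simp
  finally show ?thesis by (simp add: mult.commute)
qed

lemma A_step_integrable:
  assumes \<omega>: "good \<omega>"
  shows "integrable (step_time i) (\<lambda>s. A s \<omega> x y)"
proof (rule Bochner_Integration.integrable_bound)
  show "integrable (step_time i) (\<lambda>s. norm y * (lam s * (\<alpha> * norm x powr p + 1) + K2 s \<omega>))"
    using A_step_bound_integrable[OF \<omega>] by simp
  show "AE s in step_time i. norm (A s \<omega> x y)
      \<le> norm (norm y * (lam s * (\<alpha> * norm x powr p + 1) + K2 s \<omega>))"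
    unfolding real_norm_def
    by (intro AE_I2 order_trans[OF A_apply_bound[OF \<omega> order_refl, unfolded real_norm_def] abs_ge_self])
qed (rule A_step_measurable[OF \<omega>])

lemma A_disc_apply:
  assumes \<omega>: "good \<omega>"
  shows "T / real m * A_disc T A m i \<omega> x y = (\<integral>s. A s \<omega> x y \<partial>step_time i)"
proof -
  have "(op_integral (step_time i) (\<lambda>s. A s \<omega> x)) y = (\<integral>s. A s \<omega> x y \<partial>step_time i)"
    by (rule op_integral_apply[OF A_step_measurable[OF \<omega>]
          A_step_bound_integrable[OF \<omega>, of "\<alpha> * norm x powr p + 1"]])
      (intro AE_I2 A_step_bound[OF \<omega> step_space order_refl])
  moreover have "T / real m * A_disc T A m i \<omega> x y
      = (op_integral (step_time i) (\<lambda>s. A s \<omega> x)) y"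
    using T m by (simp add: A_disc_def blinfun.scaleR_left)
  ultimately show ?thesis by (rule trans[rotated])
qed

lemma implicit_op_apply:
  "good \<omega> \<Longrightarrow> implicit_op m i \<omega> x y
    = \<iota> y \<bullet> \<iota> x - (\<integral>s. A s \<omega> x y \<partial>step_time i)"
  unfolding implicit_op_def blinfun.diff_left blinfun.scaleR_left H_to_dual_apply real_scaleR_def
  by (simp only: A_disc_apply)

lemma implicit_op_strongly_monotone:
  assumes \<omega>: "good \<omega>"
  shows "(norm (\<iota> (x - y)))\<^sup>2 \<le> (implicit_op m i \<omega> x - implicit_op m i \<omega> y) (x - y)"
proof -
  have "(implicit_op m i \<omega> x - implicit_op m i \<omega> y) (x - y)
    = (norm (\<iota> (x - y)))\<^sup>2
      - (\<integral>s. A s \<omega> x (x - y) - A s \<omega> y (x - y) \<partial>step_time i)"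
    using A_step_integrable[OF \<omega>]
    by (simp only: blinfun.diff_left implicit_op_apply[OF \<omega>] integral_diff)
      (simp add: power2_norm_eq_inner blinfun.diff_right inner_diff_right)
  moreover have "(\<integral>s. A s \<omega> x (x - y) - A s \<omega> y (x - y) \<partial>step_time i) \<le> 0"
  proof -
    have "0 \<le> (\<integral>s. - (A s \<omega> x (x - y) - A s \<omega> y (x - y)) \<partial>step_time i)"
      using good_monotone[OF \<omega> step_space, of _ x y]
      by (intro integral_nonneg_AE AE_I2) (simp add: blinfun.diff_left)
    then show ?thesis by (simp only: integral_minus)
  qed
  ultimately show ?thesis by simp
qed

lemma implicit_op_monotone: "good \<omega> \<Longrightarrow> monotone_operator (implicit_op m i \<omega>)"
  unfolding monotone_operator_def
  by (meson implicit_op_strongly_monotone order_trans zero_le_power2)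

text \<open>Limits are taken along sequences so that dominated convergence applies. A convergent
  sequence \<open>X\<close> is bounded, hence all arguments have norm at most \<rho> and share one
  integrable majorant.\<close>

lemma implicit_op_hemicontinuous:
  assumes \<omega>: "good \<omega>"
  shows "hemicontinuous (implicit_op m i \<omega>)"
  unfolding hemicontinuous_def tendsto_at_iff_sequentially
proof (intro allI impI)
  fix x y z :: 'v and X :: "nat \<Rightarrow> real" assume X: "\<forall>n. X n \<in> UNIV - {0}" "X \<longlonglongrightarrow> 0"
  obtain c where c: "\<forall>n. norm (X n) \<le> c"
    using convergent_imp_Bseq[OF convergentI[OF X(2)]] unfolding Bseq_def by blast
  define \<rho> where "\<rho> = norm x + c * norm y"
  have \<rho>: "norm (x + X n *\<^sub>R y) \<le> \<rho>" for n
    unfolding \<rho>_def using c by (intro norm_triangle_le add_mono) (auto intro: mult_right_mono)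
  have lim1: "(\<lambda>n. \<integral>s. (A s \<omega> (x + X n *\<^sub>R y)) z \<partial>step_time i)
      \<longlonglongrightarrow> (\<integral>s. A s \<omega> x z \<partial>step_time i)"
  proof (rule integral_dominated_convergence[where w = "\<lambda>s. norm z * (lam s * (\<alpha> * \<rho> powr p + 1) + K2 s \<omega>)"])
    show "AE s in step_time i. (\<lambda>n. (A s \<omega> (x + X n *\<^sub>R y)) z) \<longlonglongrightarrow> A s \<omega> x z"
    proof (rule AE_I2)
      fix s assume "s \<in> space (step_time i)"
      from good_hemi[OF \<omega> step_space[OF this], of x y z] X
      show "(\<lambda>n. (A s \<omega> (x + X n *\<^sub>R y)) z) \<longlonglongrightarrow> A s \<omega> x z"
        unfolding tendsto_at_iff_sequentially comp_def by blast
    qed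
    show "AE s in step_time i. norm ((A s \<omega> (x + X n *\<^sub>R y)) z)
        \<le> norm z * (lam s * (\<alpha> * \<rho> powr p + 1) + K2 s \<omega>)" for n
      by (intro AE_I2 A_apply_bound[OF \<omega> \<rho>])
    show "integrable (step_time i) (\<lambda>s. norm z * (lam s * (\<alpha> * \<rho> powr p + 1) + K2 s \<omega>))"
      using A_step_bound_integrable[OF \<omega>] by simp
  qed (rule A_step_measurable[OF \<omega>])+
  have "(\<lambda>n. \<iota> z \<bullet> \<iota> (x + X n *\<^sub>R y))
      \<longlonglongrightarrow> \<iota> z \<bullet> \<iota> (x + 0 *\<^sub>R y)"
    by (intro tendsto_intros X(2))
  then have lim2: "(\<lambda>n. \<iota> z \<bullet> \<iota> (x + X n *\<^sub>R y))
      \<longlonglongrightarrow> \<iota> z \<bullet> \<iota> x" by simp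
  show "((\<lambda>r. (implicit_op m i \<omega> (x + r *\<^sub>R y)) z) \<circ> X) \<longlonglongrightarrow> implicit_op m i \<omega> x z"
    unfolding comp_def implicit_op_apply[OF \<omega>] by (rule tendsto_diff[OF lim2 lim1])
qed

text \<open>Provides the local boundedness from which demicontinuity is derived; the constant
  depends on the path through \<open>K2\<close>.\<close>

lemma implicit_op_bounded:
  assumes \<omega>: "good \<omega>"
  shows "\<exists>C. \<forall>x. norm x \<le> \<rho> \<longrightarrow> norm (implicit_op m i \<omega> x) \<le> C"
proof (intro exI allI impI)
  let ?h = "\<lambda>s. lam s * (\<alpha> * \<rho> powr p + 1) + K2 s \<omega>"
  fix x :: 'v assume x: "norm x \<le> \<rho>"
  have \<rho>: "0 \<le> \<rho>" using order_trans[OF norm_ge_zero x] .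
  have h: "integrable (step_time i) ?h" by (rule A_step_bound_integrable[OF \<omega>])
  have h0: "0 \<le> ?h s" if s: "s \<in> space (step_time i)" for s
    using order_trans[OF norm_ge_zero A_step_bound[OF \<omega> step_space[OF s] x]] .
  show "norm (implicit_op m i \<omega> x) \<le> norm \<iota> * (norm \<iota> * \<rho>) + integral\<^sup>L (step_time i) ?h"
  proof (rule norm_blinfun_bound)
    have "0 \<le> integral\<^sup>L (step_time i) ?h" using h0 by (intro integral_nonneg_AE AE_I2)
    then show "0 \<le> norm \<iota> * (norm \<iota> * \<rho>) + integral\<^sup>L (step_time i) ?h" using \<rho> by simp
    fix y
    have "\<bar>\<iota> y \<bullet> \<iota> x\<bar> \<le> norm (\<iota> y) * norm (\<iota> x)"
      by (rule Cauchy_Schwarz_ineq2)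
    also have "\<dots> \<le> (norm \<iota> * norm y) * (norm \<iota> * \<rho>)"
      using x \<rho> by (intro mult_mono norm_blinfun order_trans[OF norm_blinfun[of \<iota> x]] mult_left_mono) auto
    finally have 1: "\<bar>\<iota> y \<bullet> \<iota> x\<bar> \<le> norm \<iota> * (norm \<iota> * \<rho>) * norm y"
      by (simp add: ac_simps)
    have "norm (\<integral>s. A s \<omega> x y \<partial>step_time i) \<le> (\<integral>s. norm (A s \<omega> x y) \<partial>step_time i)"
      by (rule integral_norm_bound)
    also have "\<dots> \<le> (\<integral>s. norm y * ?h s \<partial>step_time i)"
    proof (rule integral_mono)
      show "integrable (step_time i) (\<lambda>s. norm (A s \<omega> x y))"
        by (intro integrable_norm A_step_integrable[OF \<omega>])
      show "integrable (step_time i) (\<lambda>s. norm y * ?h s)"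
        using h by (rule integrable_mult_right)
    qed (rule A_apply_bound[OF \<omega> x])
    also have "\<dots> = norm y * integral\<^sup>L (step_time i) ?h" using h by simp
    finally show "norm (implicit_op m i \<omega> x y)
        \<le> (norm \<iota> * (norm \<iota> * \<rho>) + integral\<^sup>L (step_time i) ?h) * norm y"
      using 1 unfolding implicit_op_apply[OF \<omega>] by (simp add: algebra_simps)
  qed
qed

definition lam_step :: real where
  "lam_step = (\<integral>s. lam s \<partial>step_time i)"

text \<open>A nonnegative function with vanishing integral is zero almost everywhere, which
  pointwise positivity of \<open>lam\<close> excludes on an interval of positive length.\<close>

lemma lam_step_pos: "0 < lam_step"
proof -
  have int: "integrable (step_time i) lam" by (rule integrable_time_subset[OF lam_int step_bounds(1,2)])
  have ge: "AE s in step_time i. 0 \<le> lam s"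
    by (intro AE_I2 less_imp_le lam_pos step_space)
  have "lam_step \<noteq> 0"
  proof
    assume "lam_step = 0"
    then have "AE s in step_time i. lam s = 0"
      using integral_nonneg_eq_0_iff_AE[OF int ge] by (simp add: lam_step_def)
    then have "AE s in step_time i. False"
      using AE_space by eventually_elim (use lam_pos step_space in fastforce)
    then have "emeasure (step_time i) (space (step_time i)) = 0"
      by (subst (asm) AE_iff_measurable[OF sets.top]) auto
    then show False
      using step_bounds by (simp add: space_restrict_space emeasure_restrict_space)
  qed
  moreover have "0 \<le> lam_step" unfolding lam_step_def using ge by (rule integral_nonneg_AE)
  ultimately show ?thesis by simp
qed

text \<open>Twice the identity part gives two copies of |x|_H^2. The \<open>mu\<close> term consumes
  at most one, its integral over the step being at most 1; the other is kept to absorb the inner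
  product with the data in \<open>implicit_step\<close>.\<close>

lemma implicit_op_coercive:
  assumes \<omega>: "good \<omega>"
  shows "(norm (\<iota> x))\<^sup>2 + lam_step * norm x powr p - K_integral \<omega>
    \<le> 2 * implicit_op m i \<omega> x x"
proof -
  note sub = integrable_time_subset[OF _ step_bounds(1,2)]
  have K1: "integrable (step_time i) (\<lambda>s. K1 s \<omega>)" by (rule sub[OF good_K_integrable(1)[OF \<omega>]])
  have mu: "integrable (step_time i) mu" by (rule sub[OF mu_int])
  have lam: "integrable (step_time i) lam" by (rule sub[OF lam_int])
  have "(\<integral>s. 2 * A s \<omega> x x \<partial>step_time i)
    \<le> (\<integral>s. K1 s \<omega> + mu s * (norm (\<iota> x))\<^sup>2 - lam s * norm x powr p \<partial>step_time i)"
  proof (rule integral_mono)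
    fix s assume "s \<in> space (step_time i)"
    note c = good_coercive[OF \<omega> step_space[OF this], of x]
    have "0 \<le> (\<integral>\<xi>. (norm (F s \<omega> x \<xi>))\<^sup>2 \<partial>\<nu>)" by (rule integral_nonneg_AE) simp
    then show "2 * A s \<omega> x x
        \<le> K1 s \<omega> + mu s * (norm (\<iota> x))\<^sup>2 - lam s * norm x powr p"
      using c zero_le_power2[of "hs_norm J g (B s \<omega> x)"] by linarith
  qed (use K1 mu lam A_step_integrable[OF \<omega>] in simp_all)
  also have "\<dots> = (\<integral>s. K1 s \<omega> \<partial>step_time i) + (\<integral>s. mu s \<partial>step_time i) * (norm (\<iota> x))\<^sup>2
      - lam_step * norm x powr p"
    using K1 mu lam by (simp add: lam_step_def)
  also have "\<dots> \<le> K_integral \<omega> + 1 * (norm (\<iota> x))\<^sup>2 - lam_step * norm x powr p"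
  proof -
    have "(\<integral>s. K1 s \<omega> \<partial>step_time i) \<le> (\<integral>s. K1 s \<omega> \<partial>time 0 T)"
      using good_K_integrable(1)[OF \<omega>] step_bounds(1,2) by (rule integral_time_mono) (use good_K_nonneg[OF \<omega>] in blast)
    moreover have "0 \<le> (\<integral>s. K2 s \<omega> \<partial>time 0 T)"
      using good_K_nonneg[OF \<omega>] by (intro integral_nonneg_AE AE_I2) (simp add: space_restrict_space)
    moreover have "(\<integral>s. mu s \<partial>step_time i) * (norm (\<iota> x))\<^sup>2 \<le> 1 * (norm (\<iota> x))\<^sup>2"
      using mu_small[OF i] by (intro mult_right_mono) auto
    ultimately show ?thesis unfolding K_integral_def by linarith
  qed
  finally have "2 * (\<integral>s. A s \<omega> x x \<partial>step_time i)
      \<le> K_integral \<omega> + (norm (\<iota> x))\<^sup>2 - lam_step * norm x powr p"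
    by simp
  then show ?thesis
    unfolding implicit_op_apply[OF \<omega>] by (simp add: power2_norm_eq_inner)
qed

lemma implicit_op_coercive_radius:
  fixes f :: "'v \<Rightarrow>\<^sub>L real"
  assumes \<omega>: "good \<omega>"
  shows "\<exists>R>0. \<forall>x. norm x = R \<longrightarrow> f x < implicit_op m i \<omega> x x"
proof -
  define c where "c = lam_step / 2"
  define K where "K = \<bar>K_integral \<omega>\<bar>"
  \<comment> \<open>Chosen so that \<open>c * R = c + K + norm f\<close>. As R \<ge> 1 and p \<ge>
    2, \<open>c * R powr p\<close> is at least \<open>(c + K + norm f) * R\<close>, which exceeds
    \<open>K + norm f * R\<close>. The half in \<open>c\<close> reflects that coercivity bounds
    twice the operator.\<close>
  define R where "R = 1 + (K + norm f) / c"
  have c: "c > 0" using lam_step_pos by (simp add: c_def)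
  have K: "K \<ge> 0" by (simp add: K_def)
  have R1: "R \<ge> 1" unfolding R_def using c K by simp
  have cR: "c * R = c + K + norm f" unfolding R_def using c by (simp add: field_simps)
  have "f x < implicit_op m i \<omega> x x" if x: "norm x = R" for x
  proof -
    have "K \<le> K * R" using R1 K by (simp add: mult_le_cancel_left1)
    have "R powr 2 \<le> R powr p" using p R1 by (intro powr_mono) auto
    then have "R * R \<le> R powr p" using R1 by (simp add: powr_numeral power2_eq_square)
    then have "c * (R * R) \<le> c * R powr p" using c by simp
    moreover have "c * (R * R) = c * R + K * R + norm f * R"
      by (simp add: mult.assoc[symmetric] cR distrib_right)
    moreover have "f x \<le> norm f * R"
      using norm_blinfun[of f x] x by simp
    moreover have "c * R > 0" using c R1 by simp
    moreover have "2 * (c * R powr p) - K \<le> 2 * implicit_op m i \<omega> x x"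
      using implicit_op_coercive[OF \<omega>, of x] zero_le_power2[of "norm (\<iota> x)"]
        abs_ge_self[of "K_integral \<omega>"] unfolding x K_def[symmetric] c_def by linarith
    ultimately show ?thesis using \<open>K \<le> K * R\<close> K by linarith
  qed
  then show ?thesis using R1 by (intro exI[of _ R]) auto
qed

lemma implicit_op_solution_exists:
  fixes f :: "'v \<Rightarrow>\<^sub>L real"
  assumes \<omega>: "good \<omega>"
  shows "\<exists>x\<in>annihilated L. \<forall>v\<in>annihilated L. implicit_op m i \<omega> x v = f v"
proof -
  obtain R where "R > 0" "\<forall>x. norm x = R \<longrightarrow> f x < implicit_op m i \<omega> x x"
    using implicit_op_coercive_radius[OF \<omega>] by blast
  then show ?thesis
    by (intro Browder_Minty[OF reflexive implicit_op_monotone[OF \<omega>] implicit_op_hemicontinuous[OF \<omega>]]) auto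
qed

lemma implicit_op_solution_unique:
  fixes f :: "'v \<Rightarrow>\<^sub>L real"
  assumes \<omega>: "good \<omega>" and xy: "x \<in> annihilated L" "y \<in> annihilated L"
    and x: "\<forall>v\<in>annihilated L. implicit_op m i \<omega> x v = f v"
    and y: "\<forall>v\<in>annihilated L. implicit_op m i \<omega> y v = f v"
  shows "x = y"
proof -
  have "x - y \<in> annihilated L" using xy by (simp add: subspace_diff subspace_annihilated)
  then have "(implicit_op m i \<omega> x - implicit_op m i \<omega> y) (x - y) = 0"
    using x y by (simp add: blinfun.diff_left)
  then have "(norm (\<iota> (x - y)))\<^sup>2 \<le> 0"
    using implicit_op_strongly_monotone[OF \<omega>, of x y] by simp
  then have "\<iota> x = \<iota> y" by (simp add: blinfun.diff_right)
  then show ?thesis using inj by (simp add: inj_eq)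
qed

text \<open>The integral formula is adapted on the whole space and agrees with the operator on good
  paths; on other paths \<open>op_integral\<close> may take its default value.\<close>

lemma implicit_op_measurable:
  "(\<lambda>\<omega>. implicit_op m i \<omega> x y) \<in> borel_measurable (Fl (grid T m i))"
proof (rule filtration_measurable_AE_eq[OF filt step_bounds(5)])
  have "(\<lambda>\<omega>. \<integral>s. A s \<omega> x y \<partial>step_time i) \<in> borel_measurable (Fl (grid T m i))"
    using measurable_time_integral[OF A_measurable[OF step_bounds(5), of "\<lambda>_. x" y],
        of "grid T m (i - 1)" "grid T m i"] step_bounds
    by simp
  then show "(\<lambda>\<omega>. \<iota> y \<bullet> \<iota> x - (\<integral>s. A s \<omega> x y \<partial>step_time i))
      \<in> borel_measurable (Fl (grid T m i))" by simp
  show "AE \<omega> in M. \<iota> y \<bullet> \<iota> x - (\<integral>s. A s \<omega> x y \<partial>step_time i)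
      = implicit_op m i \<omega> x y"
    using AE_good by eventually_elim (simp add: implicit_op_apply)
qed

text \<open>Solves one step on almost every path and at once supplies the moment that the next step
  needs: testing the equation with the solution itself bounds
  \<open>norm (u \<omega>) powr p\<close> by integrable quantities.\<close>

lemma implicit_step:
  assumes h: "h \<in> borel_measurable (Fl (grid T m i))" and h2: "integrable M (\<lambda>\<omega>. (norm (h \<omega>))\<^sup>2)"
  shows "\<exists>u\<in>borel_measurable (Fl (grid T m i)). integrable M (\<lambda>\<omega>. norm (u \<omega>) powr p) \<and>
    (\<forall>\<omega>. u \<omega> \<in> annihilated L) \<and>
    (AE \<omega> in M. \<forall>v\<in>annihilated L. (implicit_op m i \<omega> (u \<omega>)) v = \<iota> v \<bullet> h \<omega>)"
proof -
  obtain Z where Z: "{\<omega>\<in>space M. \<not> good \<omega>} \<subseteq> Z" "emeasure M Z = 0" "Z \<in> sets M"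
    using AE_E[OF AE_good] by blast
  then have Zn: "Z \<in> null_sets M" by auto
  define G where "G = space M - Z"
  have G: "G \<in> sets (Fl (grid T m i))"
    unfolding G_def space_Fl[OF step_bounds(5), symmetric]
    using filtration_null_sets[OF filt step_bounds(5)] Zn by blast
  have good: "good \<omega>" if "\<omega> \<in> G" for \<omega> using that Z(1) by (auto simp: G_def)
  \<comment> \<open>An arbitrary choice on each path suffices: uniqueness of the solution makes the
    chosen function measurable.\<close>
  define u where "u \<omega> = (if \<omega> \<in> G then (SOME x. x \<in> annihilated L \<and>
      (\<forall>v\<in>annihilated L. implicit_op m i \<omega> x v = (H_to_dual \<iota> (h \<omega>)) v)) else 0)" for \<omega>
  have u: "u \<omega> \<in> annihilated L \<and>
      (\<forall>v\<in>annihilated L. (implicit_op m i \<omega> (u \<omega>)) v = (H_to_dual \<iota> (h \<omega>)) v)"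
    if "\<omega> \<in> G" for \<omega>
  proof -
    have "\<exists>x. x \<in> annihilated L \<and>
      (\<forall>v\<in>annihilated L. implicit_op m i \<omega> x v = (H_to_dual \<iota> (h \<omega>)) v)"
      using implicit_op_solution_exists[OF good[OF that]] by blast
    from someI_ex[OF this] show ?thesis using that by (simp add: u_def)
  qed
  have uL: "u \<omega> \<in> annihilated L" for \<omega>
    using u[of \<omega>] subspace_0[OF subspace_annihilated] by (cases "\<omega> \<in> G") (auto simp: u_def)
  have um: "u \<in> borel_measurable (Fl (grid T m i))"
  proof (rule monotone_solution_measurable[where G = G and D = "implicit_op m i" and f = "\<lambda>\<omega>. H_to_dual \<iota> (h \<omega>)" and L = L])
    show "(\<lambda>\<omega>. (H_to_dual \<iota> (h \<omega>)) z) \<in> borel_measurable (Fl (grid T m i))" for z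
      unfolding H_to_dual_apply using h by simp
    show "x = u \<omega>" if "\<omega> \<in> G" "x \<in> annihilated L"
      "\<And>v. v \<in> annihilated L \<Longrightarrow> implicit_op m i \<omega> x v = (H_to_dual \<iota> (h \<omega>)) v" for \<omega> x
      using that u by (intro implicit_op_solution_unique[OF good]) auto
  qed (use reflexive implicit_op_measurable G implicit_op_monotone[OF good] implicit_op_hemicontinuous[OF good]
      implicit_op_bounded[OF good] u space_Fl[OF step_bounds(5)] in \<open>auto simp: u_def\<close>)
  have AE_G: "AE \<omega> in M. \<omega> \<in> G"
    using AE_not_in[OF Zn] AE_space by eventually_elim (simp add: G_def)
  \<comment> \<open>The copy of |u|_H^2 left by coercivity cancels against the one from
    \<open>2 * (\<iota> (u \<omega>) \<bullet> h \<omega>)\<close>, estimated by the sum of the two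
    squares.\<close>
  have bound: "norm (u \<omega>) powr p \<le> (K_integral \<omega> + (norm (h \<omega>))\<^sup>2) / lam_step" if \<omega>: "\<omega> \<in> G" for \<omega>
  proof -
    have "(norm (\<iota> (u \<omega>)))\<^sup>2 + lam_step * norm (u \<omega>) powr p - K_integral \<omega>
        \<le> 2 * (\<iota> (u \<omega>) \<bullet> h \<omega>)"
      using implicit_op_coercive[OF good[OF \<omega>], of "u \<omega>"] u[OF \<omega>] by (simp add: H_to_dual_apply)
    also have "\<dots> \<le> (norm (\<iota> (u \<omega>)))\<^sup>2 + (norm (h \<omega>))\<^sup>2"
    proof -
      have "0 \<le> (norm (\<iota> (u \<omega>) - h \<omega>))\<^sup>2" by simp
      then show ?thesis
        by (simp add: power2_norm_eq_inner inner_diff_left inner_diff_right inner_commute)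
    qed
    finally have "lam_step * norm (u \<omega>) powr p \<le> K_integral \<omega> + (norm (h \<omega>))\<^sup>2" by simp
    then show ?thesis using lam_step_pos by (simp add: pos_le_divide_eq mult.commute)
  qed
  have "integrable M (\<lambda>\<omega>. norm (u \<omega>) powr p)"
  proof (rule Bochner_Integration.integrable_bound)
    show "integrable M (\<lambda>\<omega>. (K_integral \<omega> + (norm (h \<omega>))\<^sup>2) / lam_step)"
      using K_integral_integrable h2 by simp
    have "u \<in> borel_measurable M" by (rule filtration_measurable_M[OF filt um step_bounds(5)])
    then show "(\<lambda>\<omega>. norm (u \<omega>) powr p) \<in> borel_measurable M" by simp
    show "AE \<omega> in M. norm (norm (u \<omega>) powr p) \<le> norm ((K_integral \<omega> + (norm (h \<omega>))\<^sup>2) / lam_step)"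
      using AE_G
    proof eventually_elim
      case (elim \<omega>)
      show ?case using order_trans[OF bound[OF elim] abs_ge_self] by simp
    qed
  qed
  moreover have "AE \<omega> in M. \<forall>v\<in>annihilated L. (implicit_op m i \<omega> (u \<omega>)) v = \<iota> v \<bullet> h \<omega>"
    using AE_G by eventually_elim (use u in \<open>simp add: H_to_dual_apply\<close>)
  ultimately show ?thesis using um uL by blast
qed

end

end

end

section \<open>The noise term\<close>

definition square_integrable :: "'w measure \<Rightarrow> ('w \<Rightarrow> 'b::{real_normed_vector, second_countable_topology}) \<Rightarrow> bool" where
  "square_integrable M f \<longleftrightarrow> f \<in> borel_measurable M \<and> integrable M (\<lambda>\<omega>. (norm (f \<omega>))\<^sup>2)"

lemma square_integrable_add:
  fixes f h :: "'w \<Rightarrow> 'b::{real_normed_vector, second_countable_topology}"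
  assumes f: "square_integrable M f" and h: "square_integrable M h"
  shows "square_integrable M (\<lambda>\<omega>. f \<omega> + h \<omega>)"
proof -
  have [measurable]: "f \<in> borel_measurable M" "h \<in> borel_measurable M"
    using f h by (simp_all add: square_integrable_def)
  have "integrable M (\<lambda>\<omega>. (norm (f \<omega> + h \<omega>))\<^sup>2)"
  proof (rule Bochner_Integration.integrable_bound)
    show "integrable M (\<lambda>\<omega>. 2 * (norm (f \<omega>))\<^sup>2 + 2 * (norm (h \<omega>))\<^sup>2)"
      using f h by (simp add: square_integrable_def)
    show "AE \<omega> in M. norm ((norm (f \<omega> + h \<omega>))\<^sup>2) \<le> norm (2 * (norm (f \<omega>))\<^sup>2 + 2 * (norm (h \<omega>))\<^sup>2)"
      by (intro AE_I2) (simp add: norm_add_power2_le)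
  qed measurable
  then show ?thesis by (simp add: square_integrable_def)
qed

lemma square_integrable_sum:
  assumes "finite I" "\<And>i. i \<in> I \<Longrightarrow> square_integrable M (f i)"
  shows "square_integrable M (\<lambda>\<omega>. \<Sum>i\<in>I. f i \<omega>)"
  using assms
proof (induction I rule: finite_induct)
  case empty
  then show ?case by (simp add: square_integrable_def)
next
  case (insert x I)
  then show ?case by (simp add: square_integrable_add)
qed

lemma square_integrable_cong_AE:
  assumes "square_integrable M f" "h \<in> borel_measurable M" "AE \<omega> in M. f \<omega> = h \<omega>"
  shows "square_integrable M h"
proof -
  have "integrable M (\<lambda>\<omega>. (norm (f \<omega>))\<^sup>2)" "f \<in> borel_measurable M"
    using assms(1) by (auto simp: square_integrable_def)
  then have "integrable M (\<lambda>\<omega>. (norm (h \<omega>))\<^sup>2)"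
    using assms(2,3) by (subst integrable_cong_AE[of _ _ "\<lambda>\<omega>. (norm (f \<omega>))\<^sup>2"]) (auto elim: eventually_mono)
  then show ?thesis using assms(2) by (simp add: square_integrable_def)
qed

text \<open>Finite mass of the strips over the cells makes both integrals honest finite sums. The
  result is linear in the values \<open>c\<close>, which gives measurability and later lets
  projections pass through the integral.\<close>

lemma compensated_integral_step:
  fixes c :: "'e set \<Rightarrow> 'b::{banach, second_countable_topology}"
  assumes n: "sets n = sets (time_mark T \<nu>)" and st: "0 \<le> s" "t \<le> T"
    and \<nu>: "space \<nu> = UNIV" and Q: "finite Q"
    and C: "\<And>C. C \<in> Q \<Longrightarrow> C \<in> sets \<nu> \<and> emeasure \<nu> C < \<infinity> \<and> emeasure n ({s<..t} \<times> C) < \<infinity>"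
  shows "compensated_integral \<nu> n s t (\<lambda>\<xi>. \<Sum>C\<in>Q. indicator C \<xi> *\<^sub>R c C)
    = (\<Sum>C\<in>Q. (measure n ({s<..t} \<times> C) - (t - s) * measure \<nu> C) *\<^sub>R c C)"
proof -
  have D: "{s<..t} \<times> C \<in> sets n" if "C \<in> Q" for C
    unfolding n using C[OF that] st by (intro pair_measureI) (auto simp: sets_restrict_space_iff)
  have "(LINT z:{s<..t} \<times> UNIV|n. (\<Sum>C\<in>Q. indicator C (snd z) *\<^sub>R c C))
      = (\<integral>z. (\<Sum>C\<in>Q. indicator ({s<..t} \<times> C) z *\<^sub>R c C) \<partial>n)"
    unfolding set_lebesgue_integral_def
  proof (intro Bochner_Integration.integral_cong refl)
    fix z
    show "indicator ({s<..t} \<times> UNIV) z *\<^sub>R (\<Sum>C\<in>Q. indicator C (snd z) *\<^sub>R c C)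
        = (\<Sum>C\<in>Q. indicator ({s<..t} \<times> C) z *\<^sub>R c C)"
      by (cases "fst z \<in> {s<..t}") (auto simp: indicator_def mem_Times_iff)
  qed
  also have "\<dots> = (\<Sum>C\<in>Q. measure n ({s<..t} \<times> C) *\<^sub>R c C)"
    using C D by (intro has_bochner_integral_integral_eq has_bochner_integral_sum has_bochner_integral_indicator) auto
  finally have 1: "(LINT z:{s<..t} \<times> UNIV|n. (\<Sum>C\<in>Q. indicator C (snd z) *\<^sub>R c C))
      = (\<Sum>C\<in>Q. measure n ({s<..t} \<times> C) *\<^sub>R c C)" .
  have 2: "(LINT \<xi>|\<nu>. (\<Sum>C\<in>Q. indicator C \<xi> *\<^sub>R c C)) = (\<Sum>C\<in>Q. measure \<nu> C *\<^sub>R c C)"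
    using C by (intro has_bochner_integral_integral_eq has_bochner_integral_sum has_bochner_integral_indicator) auto
  show ?thesis
    unfolding compensated_integral_def 1 2
    by (simp add: scaleR_diff_left sum_subtractf scaleR_sum_right)
qed

context implicit_schemes
begin

lemma space_\<nu>: "space \<nu> = UNIV"
  using sets_eq_imp_space_eq[OF \<nu>_sets] by simp

abbreviation (input) jump_integral ::
    "nat \<Rightarrow> nat \<Rightarrow> 'w \<Rightarrow> ('e \<Rightarrow> 'b::{banach, second_countable_topology}) \<Rightarrow> 'b" where
  "jump_integral m i \<omega> \<equiv> compensated_integral \<nu> (N \<omega>) (grid T m (i - 1)) (grid T m i)"

abbreviation (input) wiener_step :: "nat \<Rightarrow> nat \<Rightarrow> nat \<Rightarrow> 'w \<Rightarrow> 'u" where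
  "wiener_step m l i \<omega> \<equiv> wiener_trunc J g W l (grid T m i) \<omega> - wiener_trunc J g W l (grid T m (i - 1)) \<omega>"

definition noise_term :: "nat \<Rightarrow> nat \<Rightarrow> nat \<Rightarrow> 'w \<Rightarrow> 'v \<Rightarrow> 'h" where
  "noise_term m l i \<omega> x =
     blinfun_apply (B_disc T B m i \<omega> x)
       (wiener_step m l i \<omega>)
     + jump_integral m i \<omega> (F_disc T \<nu> F (P l) m i \<omega> x)"

text \<open>Removes the value \<open>u 0\<close> from the data of the first step, where only \<zeta>
  remains.\<close>

lemma noise_term_first: "noise_term m l 1 \<omega> x = 0"
  by (simp add: noise_term_def B_disc_def F_disc_def compensated_integral_def set_lebesgue_integral_def)

section \<open>Second moments of the noise term\<close>

context
  fixes m l i :: nat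
  assumes i: "2 \<le> i" "i \<le> m" and l: "l \<ge> 1"
begin

abbreviation (input) t_prev :: real where "t_prev \<equiv> grid T m (i - 1)"

abbreviation (input) t_cur :: real where "t_cur \<equiv> grid T m i"

abbreviation prev_time :: "real measure" where
  "prev_time \<equiv> time (grid T m (i - 2)) (grid T m (i - 1))"

lemma prev_bounds: "0 \<le> grid T m (i - 2)" "t_prev \<le> T" "grid T m (i - 2) < t_prev"
    "t_prev \<in> {0..T}" "t_cur \<in> {0..T}" "t_prev < t_cur" "0 \<le> t_prev"
    "t_cur \<le> T"
  and prev_length: "t_prev - grid T m (i - 2) = T / real m"
  and step_length_pos: "T / real m > 0"
proof -
  show 0: "T / real m > 0" using T i by simp
  have "i - 1 - 1 = i - 2" by simp
  then show 1: "t_prev - grid T m (i - 2) = T / real m"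
    using grid_step[of "i - 1" T m] i by simp
  have 2: "t_cur - t_prev = T / real m" using grid_step[of i T m] i by simp
  show "0 \<le> grid T m (i - 2)" "t_prev \<le> T" "grid T m (i - 2) < t_prev"
    "t_prev \<in> {0..T}" "t_cur \<in> {0..T}" "t_prev < t_cur" "0 \<le> t_prev"
    "t_cur \<le> T"
    using grid_bounds[OF T, of "i - 2" m] grid_bounds[OF T, of "i - 1" m] grid_bounds[OF T, of i m] 0 1 2 i
    by auto
qed

lemma prev_space: "s \<in> space prev_time \<Longrightarrow> s \<in> {0..T}"
  using prev_bounds by (auto simp: space_restrict_space)

lemma prev_sub: "{grid T m (i - 2)..t_prev} \<subseteq> {0..t_prev}"
  using prev_bounds by auto

lemma measure_prev_time: "measure prev_time (space prev_time) = T / real m"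
  using measure_time_space[of "grid T m (i - 2)" "t_prev"] prev_bounds prev_length by simp

text \<open>The available bound is on the square; \<open>h \<le> 1 + h\<^sup>2\<close> turns it into
  the integrable majorant of the norm that \<open>op_integral_apply\<close> requires.\<close>

lemma norm_B_le:
  assumes \<omega>: "good \<omega>" and s: "s \<in> {0..T}"
  shows "norm (B s \<omega> x) \<le> 1 + noise_bound s \<omega> x"
proof -
  let ?h = "hs_norm J g (B s \<omega> x)"
  have "norm (B s \<omega> x) \<le> ?h"
    by (rule norm_blinfun_bound)
      (use norm_apply_le_hs_norm[OF J B_hs_ops[OF good_space[OF \<omega>] s]] in \<open>auto simp: hs_norm_def infsum_nonneg\<close>)
  also have "?h \<le> 1 + ?h\<^sup>2"
  proof -
    have "0 \<le> ?h" by (simp add: hs_norm_def infsum_nonneg)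
    moreover have "2 * ?h \<le> 1 + ?h\<^sup>2"
      using zero_le_power2[of "?h - 1"] by (simp add: power2_diff)
    ultimately show ?thesis by linarith
  qed
  finally show ?thesis using noise_bound(1)[OF \<omega> s, of x] by simp
qed

lemma noise_bound_prev_integrable:
  "good \<omega> \<Longrightarrow> integrable prev_time (\<lambda>s. noise_bound s \<omega> x)"
  by (rule integrable_time_subset[OF noise_bound_integrable prev_bounds(1,2)])

lemma B_disc_apply:
  assumes \<omega>: "good \<omega>"
  shows "B_disc T B m i \<omega> x z
    = (1 / (T / real m)) *\<^sub>R (\<integral>s. B s \<omega> x z \<partial>prev_time)"
proof -
  interpret fm: finite_measure prev_time by (rule finite_measure_time)
  have "(op_integral prev_time (\<lambda>s. B s \<omega> x)) z = (\<integral>s. B s \<omega> x z \<partial>prev_time)"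
  proof (rule op_integral_apply)
    show "integrable prev_time (\<lambda>s. 1 + noise_bound s \<omega> x)"
      by (intro Bochner_Integration.integrable_add noise_bound_prev_integrable[OF \<omega>] fm.integrable_const)
    show "AE s in prev_time. norm (B s \<omega> x) \<le> 1 + noise_bound s \<omega> x"
      by (intro AE_I2 norm_B_le[OF \<omega> prev_space])
  qed (rule B_time_measurable[OF good_space[OF \<omega>] prev_bounds(1,2)])
  then show ?thesis using i by (simp add: B_disc_def blinfun.scaleR_left)
qed

text \<open>The squared time average is at most the average of the squares. Values at basis vectors
  are enough, since a truncated Wiener increment is a finite combination of them.\<close>

lemma norm_B_disc_power2_le:
  assumes \<omega>: "good \<omega>" and k: "k \<in> J"
  shows "(norm (B_disc T B m i \<omega> x (g k)))\<^sup>2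
    \<le> (1 / (T / real m)) * (K_integral \<omega> + noise_const * (1 + norm x powr p))"
proof -
  let ?d = "T / real m"
  have "g k \<bullet> g k = 1" using J k by (auto simp: orthonormal_basis_def)
  then have gk: "norm (g k) = 1" by (simp add: norm_eq_1)
  have le: "AE s in prev_time. (norm (B s \<omega> x (g k)))\<^sup>2 \<le> noise_bound s \<omega> x"
  proof (rule AE_I2)
    fix s assume s: "s \<in> space prev_time"
    have "norm (B s \<omega> x (g k)) \<le> hs_norm J g (B s \<omega> x)"
      using norm_apply_le_hs_norm[OF J B_hs_ops[OF good_space[OF \<omega>] prev_space[OF s]], of x "g k"] gk by simp
    then have "(norm (B s \<omega> x (g k)))\<^sup>2 \<le> (hs_norm J g (B s \<omega> x))\<^sup>2"
      by (intro power_mono) auto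
    also have "\<dots> \<le> noise_bound s \<omega> x" by (rule noise_bound(1)[OF \<omega> prev_space[OF s]])
    finally show "(norm (B s \<omega> x (g k)))\<^sup>2 \<le> noise_bound s \<omega> x" .
  qed
  have "(norm (\<integral>s. B s \<omega> x (g k) \<partial>prev_time))\<^sup>2
      \<le> measure prev_time (space prev_time) * (\<integral>s. noise_bound s \<omega> x \<partial>prev_time)"
    using finite_measure_time B_time_measurable[OF good_space[OF \<omega>] prev_bounds(1,2)]
      noise_bound_prev_integrable[OF \<omega>] le by (rule norm_integral_power2_le)
  also have "\<dots> \<le> ?d * (K_integral \<omega> + noise_const * (1 + norm x powr p))"
    unfolding measure_prev_time
    using noise_bound_integral_le[OF \<omega> prev_bounds(1,2)] step_length_pos by (intro mult_left_mono) auto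
  finally have "(1 / ?d)\<^sup>2 * (norm (\<integral>s. B s \<omega> x (g k) \<partial>prev_time))\<^sup>2
      \<le> (1 / ?d)\<^sup>2 * (?d * (K_integral \<omega> + noise_const * (1 + norm x powr p)))"
    by (rule mult_left_mono) simp
  also have "\<dots> = (1 / ?d) * (K_integral \<omega> + noise_const * (1 + norm x powr p))"
    using step_length_pos by (simp add: power2_eq_square)
  finally show ?thesis
    unfolding B_disc_apply[OF \<omega>] norm_scaleR power_mult_distrib by (simp only: real_norm_def power2_abs)
qed

definition cell_coeff :: "'e set \<Rightarrow> 'w \<Rightarrow> 'v \<Rightarrow> 'h" where
  "cell_coeff C \<omega> x = (1 / ((T / real m) * measure \<nu> C)) *\<^sub>R
     (\<integral>s. (LINT \<eta>:C|\<nu>. F s \<omega> x \<eta>) \<partial>prev_time)"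

lemma F_disc_eq: "F_disc T \<nu> F (P l) m i \<omega> x = (\<lambda>\<xi>. \<Sum>C\<in>P l. indicator C \<xi> *\<^sub>R cell_coeff C \<omega> x)"
  using i by (auto simp: F_disc_def cell_coeff_def set_lebesgue_integral_time)

lemma F_cell_measurable:
  assumes t: "t \<in> {0..T}" and X: "X \<in> borel_measurable (Fl t)" and C: "C \<in> sets \<nu>"
  shows "(\<lambda>x. LINT \<eta>:C|\<nu>. F (fst x) (snd x) (X (snd x)) \<eta>) \<in> borel_measurable (upto t \<Otimes>\<^sub>M Fl t)"
  unfolding set_lebesgue_integral_def
proof (rule mark.borel_measurable_lebesgue_integral)
  note [measurable] = F_measurable[OF t X] C
  show "(\<lambda>(x, \<eta>). indicator C \<eta> *\<^sub>R F (fst x) (snd x) (X (snd x)) \<eta>)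
      \<in> borel_measurable ((upto t \<Otimes>\<^sub>M Fl t) \<Otimes>\<^sub>M \<nu>)"
    using F_measurable[OF t X] by (simp add: case_prod_unfold)
qed

lemma F_time_measurable:
  assumes \<omega>: "\<omega> \<in> space M" and s: "s \<in> {0..T}"
  shows "(\<lambda>\<xi>. F s \<omega> x \<xi>) \<in> borel_measurable \<nu>"
proof -
  have "(\<lambda>\<xi>. ((s, \<omega>), \<xi>)) \<in> \<nu> \<rightarrow>\<^sub>M (upto T \<Otimes>\<^sub>M Fl T) \<Otimes>\<^sub>M \<nu>"
    using T \<omega> s space_Fl[of T] by (intro measurable_Pair measurable_const measurable_ident)
      (auto simp: space_pair_measure space_restrict_space)
  from measurable_compose[OF this F_measurable[of T "\<lambda>_. x"]] show ?thesis using T by simp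
qed

text \<open>Cauchy-Schwarz over the cell and then over time; the resulting factors cancel one power
  of \<open>measure \<nu> C\<close> and one of the step size in the squared normalisation.\<close>

lemma norm_cell_coeff_power2_le:
  assumes \<omega>: "good \<omega>" and C: "C \<in> sets \<nu>" "emeasure \<nu> C < \<infinity>"
  shows "(norm (cell_coeff C \<omega> x))\<^sup>2
    \<le> (1 / ((T / real m) * measure \<nu> C)) * (K_integral \<omega> + noise_const * (1 + norm x powr p))"
proof -
  let ?d = "T / real m" and ?c = "measure \<nu> C" and ?K = "K_integral \<omega> + noise_const * (1 + norm x powr p)"
  have F: "(norm (LINT \<eta>:C|\<nu>. F s \<omega> x \<eta>))\<^sup>2 \<le> ?c * noise_bound s \<omega> x" if s: "s \<in> space prev_time" for s
  proof -
    let ?R = "restrict_space \<nu> C"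
    have sT: "s \<in> {0..T}" by (rule prev_space[OF s])
    have Fi: "integrable \<nu> (\<lambda>\<eta>. (norm (F s \<omega> x \<eta>))\<^sup>2)" by (rule good_F_integrable[OF \<omega> sT])
    have "finite_measure ?R"
      using C by (intro finite_measureI) (simp add: space_restrict_space emeasure_restrict_space space_\<nu>)
    moreover have "(\<lambda>\<eta>. F s \<omega> x \<eta>) \<in> borel_measurable ?R"
      by (rule measurable_restrict_space1[OF F_time_measurable[OF good_space[OF \<omega>] sT]])
    moreover have Ci: "integrable \<nu> (\<lambda>\<eta>. indicator C \<eta> *\<^sub>R (norm (F s \<omega> x \<eta>))\<^sup>2)"
      using C Fi by (intro integrable_mult_indicator)
    then have "integrable ?R (\<lambda>\<eta>. (norm (F s \<omega> x \<eta>))\<^sup>2)"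
      using C by (simp add: integrable_restrict_space)
    ultimately have "(norm (\<integral>\<eta>. F s \<omega> x \<eta> \<partial>?R))\<^sup>2 \<le> measure ?R (space ?R) * (\<integral>\<eta>. (norm (F s \<omega> x \<eta>))\<^sup>2 \<partial>?R)"
      by (rule norm_integral_power2_le) simp
    also have "measure ?R (space ?R) = ?c"
      using C by (simp add: space_restrict_space measure_restrict_space space_\<nu>)
    also have "(\<integral>\<eta>. (norm (F s \<omega> x \<eta>))\<^sup>2 \<partial>?R) \<le> noise_bound s \<omega> x"
    proof -
      have "(\<integral>\<eta>. (norm (F s \<omega> x \<eta>))\<^sup>2 \<partial>?R) = (\<integral>\<eta>. indicator C \<eta> *\<^sub>R (norm (F s \<omega> x \<eta>))\<^sup>2 \<partial>\<nu>)"
        using C by (simp add: integral_restrict_space)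
      also have "\<dots> \<le> (\<integral>\<eta>. (norm (F s \<omega> x \<eta>))\<^sup>2 \<partial>\<nu>)"
        using Ci Fi by (rule integral_mono) (auto simp: indicator_def)
      also have "\<dots> \<le> noise_bound s \<omega> x" by (rule noise_bound(2)[OF \<omega> sT])
      finally show ?thesis .
    qed
    finally show ?thesis
      using C by (simp add: integral_restrict_space set_lebesgue_integral_def mult_left_mono)
  qed
  have "(\<lambda>s. LINT \<eta>:C|\<nu>. F s \<omega> x \<eta>) \<in> borel_measurable prev_time"
    using measurable_time_section[OF F_cell_measurable[of "t_prev" "\<lambda>_. x", OF prev_bounds(4) _ C(1)] prev_sub, of \<omega>]
      good_space[OF \<omega>] space_Fl[OF prev_bounds(4)] by simp
  then have "(norm (\<integral>s. (LINT \<eta>:C|\<nu>. F s \<omega> x \<eta>) \<partial>prev_time))\<^sup>2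
      \<le> measure prev_time (space prev_time) * (\<integral>s. ?c * noise_bound s \<omega> x \<partial>prev_time)"
    by (rule norm_integral_power2_le[OF finite_measure_time])
      (use noise_bound_prev_integrable[OF \<omega>] F in \<open>auto intro!: AE_I2\<close>)
  also have "\<dots> = ?d * (?c * (\<integral>s. noise_bound s \<omega> x \<partial>prev_time))"
    unfolding measure_prev_time by simp
  also have "\<dots> \<le> ?d * (?c * ?K)"
    using noise_bound_integral_le[OF \<omega> prev_bounds(1,2)] step_length_pos by (intro mult_left_mono) auto
  finally have "(1 / (?d * ?c))\<^sup>2 * (norm (\<integral>s. (LINT \<eta>:C|\<nu>. F s \<omega> x \<eta>) \<partial>prev_time))\<^sup>2
      \<le> (1 / (?d * ?c))\<^sup>2 * (?d * (?c * ?K))"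
    by (rule mult_left_mono) simp
  \<comment> \<open>For a cell of measure zero both sides are 0, division by zero being
    zero.\<close>
  also have "\<dots> = (1 / (?d * ?c)) * ?K"
    using step_length_pos by (cases "?c = 0") (simp_all add: power2_eq_square)
  finally show ?thesis
    unfolding cell_coeff_def norm_scaleR power_mult_distrib by (simp only: real_norm_def power2_abs)
qed

lemma poisson_cell:
  assumes C: "C \<in> sets \<nu>" "emeasure \<nu> C < \<infinity>"
  defines "Z \<equiv> \<lambda>\<omega>. emeasure (N \<omega>) ({t_prev<..t_cur} \<times> C)"
  shows "Z \<in> borel_measurable (Fl t_cur)" "AE \<omega> in M. Z \<omega> < \<infinity>"
    "integrable M (\<lambda>\<omega>. (enn2real (Z \<omega>))\<^sup>2)"
proof -
  let ?s = "t_prev" and ?t = "t_cur"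
  let ?D = "{?s<..?t} \<times> C"
  have I: "{?s<..?t} \<in> sets (time 0 T)"
    using prev_bounds by (auto simp: sets_restrict_space_iff)
  then have D: "?D \<in> sets (time_mark T \<nu>)" using C(1) by simp
  interpret t: finite_measure "time 0 T" by (rule finite_measure_time)
  have "emeasure (time_mark T \<nu>) ?D = emeasure (time 0 T) {?s<..?t} * emeasure \<nu> C"
    by (rule mark.emeasure_pair_measure_Times[OF I C(1)])
  then have fin: "emeasure (time_mark T \<nu>) ?D \<noteq> \<infinity>"
    using C(2) t.emeasure_finite[of "{?s<..?t}"] by (simp add: ennreal_mult_eq_top_iff less_top)
  have "?D \<subseteq> {0..?t} \<times> UNIV" using prev_bounds by auto
  then show Zm: "Z \<in> borel_measurable (Fl ?t)"
    unfolding Z_def using N D prev_bounds(5) by (simp add: poisson_random_measure_def)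
  have ZM: "Z \<in> borel_measurable M" by (rule filtration_measurable_M[OF filt Zm prev_bounds(5)])
  have val: "Z \<omega> \<in> insert \<infinity> (range of_nat)" if "\<omega> \<in> space M" for \<omega>
    unfolding Z_def using N D that by (simp add: poisson_random_measure_def)
  have pois: "measure M {\<omega> \<in> space M. Z \<omega> = of_nat k}
      = measure (time_mark T \<nu>) ?D ^ k / fact k * exp (- measure (time_mark T \<nu>) ?D)" for k
  proof -
    have "\<forall>D\<in>sets (time_mark T \<nu>).
        if emeasure (time_mark T \<nu>) D = \<infinity> then AE \<omega> in M. emeasure (N \<omega>) D = \<infinity>
        else \<forall>k. measure M {\<omega> \<in> space M. emeasure (N \<omega>) D = of_nat k} =
                 measure (time_mark T \<nu>) D ^ k / fact k * exp (- measure (time_mark T \<nu>) D)"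
      by (rule N[unfolded poisson_random_measure_def, THEN conjunct2, THEN conjunct2, THEN conjunct1])
    from bspec[OF this D] fin show ?thesis unfolding Z_def by simp
  qed
  show "AE \<omega> in M. Z \<omega> < \<infinity>"
    by (rule poisson_AE_finite[OF prob.prob_space_axioms ZM val measure_nonneg pois])
  show "integrable M (\<lambda>\<omega>. (enn2real (Z \<omega>))\<^sup>2)"
    by (rule poisson_square_integrable[OF prob.prob_space_axioms ZM val measure_nonneg pois])
qed

context
  fixes X :: "'w \<Rightarrow> 'v"
  assumes X: "X \<in> borel_measurable (Fl t_prev)"
begin

text \<open>Averaging over the preceding interval makes the coefficient known at
  \<open>t_prev\<close>, hence independent of the increment over the following one.\<close>

lemma B_disc_measurable:
  "(\<lambda>\<omega>. (B_disc T B m i \<omega> (X \<omega>)) z) \<in> borel_measurable (Fl t_prev)"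
proof (rule filtration_measurable_AE_eq[OF filt prev_bounds(4)])
  have "(\<lambda>\<omega>. \<integral>s. (B s \<omega> (X \<omega>)) z \<partial>prev_time) \<in> borel_measurable (Fl t_prev)"
    using measurable_time_integral[OF B_measurable[OF prev_bounds(4) X, of z] prev_sub] by simp
  then show "(\<lambda>\<omega>. (1 / (T / real m)) *\<^sub>R (\<integral>s. (B s \<omega> (X \<omega>)) z \<partial>prev_time))
      \<in> borel_measurable (Fl t_prev)" by (intro borel_measurable_scaleR) auto
  show "AE \<omega> in M. (1 / (T / real m)) *\<^sub>R (\<integral>s. (B s \<omega> (X \<omega>)) z \<partial>prev_time)
      = (B_disc T B m i \<omega> (X \<omega>)) z"
    using AE_good by eventually_elim (simp only: B_disc_apply)
qed

lemma cell_coeff_measurable: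
  assumes C: "C \<in> sets \<nu>"
  shows "(\<lambda>\<omega>. cell_coeff C \<omega> (X \<omega>)) \<in> borel_measurable (Fl t_prev)"
  unfolding cell_coeff_def
  using measurable_time_integral[OF F_cell_measurable[OF prev_bounds(4) X C] prev_sub]
  by (intro borel_measurable_scaleR) auto

context
  assumes Xp: "integrable M (\<lambda>\<omega>. norm (X \<omega>) powr p)"
begin

lemma moment_bound_integrable: "integrable M (\<lambda>\<omega>. c * (K_integral \<omega> + noise_const * (1 + norm (X \<omega>) powr p)))"
  using K_integral_integrable Xp by simp

lemma noise_coeff_integrable:
  fixes b :: "'w \<Rightarrow> 'h"
  assumes b: "b \<in> borel_measurable (Fl t_prev)"
    and le: "\<And>\<omega>. good \<omega> \<Longrightarrow> (norm (b \<omega>))\<^sup>2 \<le> c * (K_integral \<omega> + noise_const * (1 + norm (X \<omega>) powr p))"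
  shows "integrable M (\<lambda>\<omega>. (norm (b \<omega>))\<^sup>2)"
proof (rule Bochner_Integration.integrable_bound[OF moment_bound_integrable])
  show "(\<lambda>\<omega>. (norm (b \<omega>))\<^sup>2) \<in> borel_measurable M"
    using filtration_measurable_M[OF filt b prev_bounds(4)] by simp
  show "AE \<omega> in M. norm ((norm (b \<omega>))\<^sup>2) \<le> norm (c * (K_integral \<omega> + noise_const * (1 + norm (X \<omega>) powr p)))"
    using AE_good
  proof eventually_elim
    case (elim \<omega>)
    show ?case using order_trans[OF le[OF elim] abs_ge_self] by simp
  qed
qed

lemma independent_scaleR_square_integrable:
  fixes b :: "'w \<Rightarrow> 'h" and Y :: "'w \<Rightarrow> real"
  assumes b: "b \<in> borel_measurable (Fl t_prev)" "integrable M (\<lambda>\<omega>. (norm (b \<omega>))\<^sup>2)"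
    and indep: "prob.indep_set (sets (Fl t_prev)) (generated_sets M I Z)"
    and Y: "Y \<in> borel_measurable M" "integrable M (\<lambda>\<omega>. (Y \<omega>)\<^sup>2)" "\<And>\<omega>. Y \<omega> = h (Z j \<omega>)" "h \<in> borel_measurable borel" "j \<in> I"
  shows "square_integrable M (\<lambda>\<omega>. Y \<omega> *\<^sub>R b \<omega>)"
proof -
  have "integrable M (\<lambda>\<omega>. (norm (b \<omega>))\<^sup>2 * (Y \<omega>)\<^sup>2)"
  proof (rule indep_product_integrable[OF prob.prob_space_axioms filtration_subalgebra[OF filt prev_bounds(4)] indep])
    show "(\<lambda>\<omega>. (norm (b \<omega>))\<^sup>2) \<in> borel_measurable (Fl t_prev)" using b(1) by simp
    show "(Y \<omega>)\<^sup>2 = (\<lambda>z. (h z)\<^sup>2) (Z j \<omega>)" for \<omega> using Y(3) by simp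
    show "(\<lambda>z. (h z)\<^sup>2) \<in> borel_measurable borel" using Y(4) by simp
  qed (use b Y in auto)
  moreover have "b \<in> borel_measurable M" by (rule filtration_measurable_M[OF filt b(1) prev_bounds(4)])
  ultimately show ?thesis
    using Y(1) by (simp add: square_integrable_def power_mult_distrib mult.commute)
qed

lemma wiener_term:
  assumes k: "k \<in> J"
  defines "f \<equiv> \<lambda>\<omega>. (W t_cur \<omega> (g k) - W t_prev \<omega> (g k)) *\<^sub>R
      (B_disc T B m i \<omega> (X \<omega>)) (g k)"
  shows "square_integrable M f" "f \<in> borel_measurable (Fl t_cur)"
proof -
  let ?s = "t_prev" and ?t = "t_cur"
  have "g k \<bullet> g k = 1" using J k by (auto simp: orthonormal_basis_def)
  then have gk: "g k \<noteq> 0" by auto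
  have W_meas: "(\<lambda>\<omega>. W t \<omega> (g k)) \<in> borel_measurable (Fl t)" if "t \<in> {0..T}" for t
    using W that by (auto simp: cylindrical_wiener_def)
  have Y: "(\<lambda>\<omega>. W ?t \<omega> (g k) - W ?s \<omega> (g k)) \<in> borel_measurable (Fl ?t)"
    using W_meas[OF prev_bounds(5)] filtration_measurable_mono[OF filt W_meas[OF prev_bounds(4)], of ?t] prev_bounds
    by (intro borel_measurable_diff) auto
  show "f \<in> borel_measurable (Fl ?t)"
    unfolding f_def
    using Y filtration_measurable_mono[OF filt B_disc_measurable, of ?t] prev_bounds
    by (intro borel_measurable_scaleR) auto
  have indep: "prob.indep_set (sets (Fl ?s)) (generated_sets M UNIV (\<lambda>u \<omega>. W ?t \<omega> u - W ?s \<omega> u))"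
    using W prev_bounds by (simp add: cylindrical_wiener_def)
  show "square_integrable M f"
    unfolding f_def
  proof (rule independent_scaleR_square_integrable[OF B_disc_measurable _ indep])
    show "integrable M (\<lambda>\<omega>. (norm ((B_disc T B m i \<omega> (X \<omega>)) (g k)))\<^sup>2)"
      by (rule noise_coeff_integrable[OF B_disc_measurable norm_B_disc_power2_le[OF _ k]])
    show "(\<lambda>\<omega>. W ?t \<omega> (g k) - W ?s \<omega> (g k)) \<in> borel_measurable M"
      by (rule filtration_measurable_M[OF filt Y prev_bounds(5)])
    show "integrable M (\<lambda>\<omega>. (W ?t \<omega> (g k) - W ?s \<omega> (g k))\<^sup>2)"
      by (rule wiener_increment_square_integrable[OF W prev_bounds(7,6,8) gk])
    show "W ?t \<omega> (g k) - W ?s \<omega> (g k) = (\<lambda>y. y) ((\<lambda>u \<omega>. W ?t \<omega> u - W ?s \<omega> u) (g k) \<omega>)" for \<omega> by simp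
  qed auto
qed

lemma poisson_term:
  assumes C: "C \<in> sets \<nu>" "emeasure \<nu> C < \<infinity>"
  defines "f \<equiv> \<lambda>\<omega>. (measure (N \<omega>) ({t_prev<..t_cur} \<times> C)
      - (t_cur - t_prev) * measure \<nu> C) *\<^sub>R cell_coeff C \<omega> (X \<omega>)"
  shows "square_integrable M f" "f \<in> borel_measurable (Fl t_cur)"
proof -
  let ?s = "t_prev" and ?t = "t_cur"
  let ?D = "{?s<..?t} \<times> C" and ?c = "(t_cur - t_prev) * measure \<nu> C"
  let ?Y = "\<lambda>\<omega>. enn2real (emeasure (N \<omega>) ?D) - ?c"
  have f_eq: "f = (\<lambda>\<omega>. ?Y \<omega> *\<^sub>R cell_coeff C \<omega> (X \<omega>))" by (simp add: f_def measure_def)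
  have Y: "?Y \<in> borel_measurable (Fl ?t)" using poisson_cell(1)[OF C] by simp
  show "f \<in> borel_measurable (Fl ?t)"
    unfolding f_eq
    using Y filtration_measurable_mono[OF filt cell_coeff_measurable[OF C(1)], of ?t] prev_bounds
    by (intro borel_measurable_scaleR) auto
  have indep: "prob.indep_set (sets (Fl ?s))
      (generated_sets M (sets \<nu>) (\<lambda>\<Gamma> \<omega>. emeasure (N \<omega>) ({?s<..?t} \<times> \<Gamma>)))"
    using N prev_bounds by (simp add: poisson_random_measure_def)
  have YM: "?Y \<in> borel_measurable M" by (rule filtration_measurable_M[OF filt Y prev_bounds(5)])
  show "square_integrable M f"
    unfolding f_eq
  proof (rule independent_scaleR_square_integrable[OF cell_coeff_measurable[OF C(1)] _ indep YM])
    show "integrable M (\<lambda>\<omega>. (norm (cell_coeff C \<omega> (X \<omega>)))\<^sup>2)"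
      by (rule noise_coeff_integrable[OF cell_coeff_measurable[OF C(1)] norm_cell_coeff_power2_le[OF _ C]])
    have "square_integrable M (\<lambda>\<omega>. enn2real (emeasure (N \<omega>) ?D) + (- ?c))"
      using poisson_cell(3)[OF C] filtration_measurable_M[OF filt poisson_cell(1)[OF C] prev_bounds(5)]
      by (intro square_integrable_add) (simp_all add: square_integrable_def)
    then show "integrable M (\<lambda>\<omega>. (?Y \<omega>)\<^sup>2)" by (simp add: square_integrable_def)
    show "?Y \<omega> = (\<lambda>z. enn2real z - ?c) ((\<lambda>\<Gamma> \<omega>. emeasure (N \<omega>) ({?s<..?t} \<times> \<Gamma>)) C \<omega>)" for \<omega> by simp
  qed (use C in auto)
qed

end

end

text \<open>One null set serves all families \<open>c\<close>, which may therefore depend on the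
  path and on the unknown. The value type is left open because the formula is used with values in H
  and in V.\<close>

lemma AE_compensated_integral:
  "AE \<omega> in M. \<forall>c :: 'e set \<Rightarrow> 'b::{banach, second_countable_topology}.
    jump_integral m i \<omega> (\<lambda>\<xi>. \<Sum>C\<in>P l. indicator C \<xi> *\<^sub>R c C)
    = (\<Sum>C\<in>P l. (measure (N \<omega>) ({t_prev<..t_cur} \<times> C)
        - (t_cur - t_prev) * measure \<nu> C) *\<^sub>R c C)"
proof -
  have "AE \<omega> in M. \<forall>C\<in>P l. emeasure (N \<omega>) ({t_prev<..t_cur} \<times> C) < \<infinity>"
    using P_finite[OF l] P_cell[OF l] poisson_cell(2) by (intro AE_finite_allI) auto
  then show ?thesis
    using AE_space
  proof eventually_elim
    case (elim \<omega>)
    have "sets (N \<omega>) = sets (time_mark T \<nu>)"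
      using N elim by (simp add: poisson_random_measure_def)
    then show ?case
      using elim P_cell[OF l] by (intro allI compensated_integral_step[OF _ prev_bounds(7,8) space_\<nu> P_finite[OF l]]) auto
  qed
qed

lemma noise_term_square_integrable:
  assumes X: "X \<in> borel_measurable (Fl t_prev)" and Xp: "integrable M (\<lambda>\<omega>. norm (X \<omega>) powr p)"
  shows "(\<lambda>\<omega>. noise_term m l i \<omega> (X \<omega>)) \<in> borel_measurable (Fl t_cur)"
    and "square_integrable M (\<lambda>\<omega>. noise_term m l i \<omega> (X \<omega>))"
proof -
  let ?f = "\<lambda>\<omega>. (\<Sum>k\<in>J \<inter> {1..l}. (W t_cur \<omega> (g k) - W t_prev \<omega> (g k)) *\<^sub>R
      (B_disc T B m i \<omega> (X \<omega>)) (g k))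
    + (\<Sum>C\<in>P l. (measure (N \<omega>) ({t_prev<..t_cur} \<times> C)
        - (t_cur - t_prev) * measure \<nu> C) *\<^sub>R cell_coeff C \<omega> (X \<omega>))"
  have eq: "AE \<omega> in M. ?f \<omega> = noise_term m l i \<omega> (X \<omega>)"
    using AE_compensated_integral[where 'b = 'h]
  proof eventually_elim
    case (elim \<omega>)
    have "wiener_step m l i \<omega>
        = (\<Sum>k\<in>J \<inter> {1..l}. (W t_cur \<omega> (g k) - W t_prev \<omega> (g k)) *\<^sub>R g k)"
      by (simp add: wiener_trunc_def sum_subtractf scaleR_diff_left)
    then show ?case
      unfolding noise_term_def F_disc_eq elim[rule_format]
      by (simp add: blinfun.sum_right blinfun.scaleR_right)
  qed
  have fm: "?f \<in> borel_measurable (Fl t_cur)"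
    using wiener_term(2)[OF X Xp] poisson_term(2)[OF X Xp] P_cell[OF l]
    by (intro borel_measurable_add borel_measurable_sum) auto
  have fs: "square_integrable M ?f"
    using wiener_term(1)[OF X Xp] poisson_term(1)[OF X Xp] P_cell[OF l] P_finite[OF l]
    by (intro square_integrable_add square_integrable_sum) auto
  show nm: "(\<lambda>\<omega>. noise_term m l i \<omega> (X \<omega>)) \<in> borel_measurable (Fl t_cur)"
    by (rule filtration_measurable_AE_eq[OF filt prev_bounds(5) fm eq])
  show "square_integrable M (\<lambda>\<omega>. noise_term m l i \<omega> (X \<omega>))"
    by (rule square_integrable_cong_AE[OF fs filtration_measurable_M[OF filt nm prev_bounds(5)] eq])
qed

end

end

section \<open>The two schemes\<close>

lemma Pi_proj_add: "Pi_proj d e (\<phi> + \<psi>) = Pi_proj d e \<phi> + Pi_proj d e \<psi>"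
  by (simp add: Pi_proj_def blinfun.add_left scaleR_add_left sum.distrib)

lemma Pi_proj_scaleR: "Pi_proj d e (c *\<^sub>R \<phi>) = c *\<^sub>R Pi_proj d e \<phi>"
  by (simp add: Pi_proj_def blinfun.scaleR_left scaleR_sum_right)

lemma linear_Pi_proj: "linear (Pi_proj d e)"
  by (intro linearI Pi_proj_add Pi_proj_scaleR)

lemma linear_H_to_dual: "linear (H_to_dual \<iota>)"
  by (intro linearI blinfun_eqI)
    (simp_all add: H_to_dual_apply blinfun.add_left blinfun.scaleR_left inner_add_right)

lemma Pi_proj_in_span: "Pi_proj d e \<phi> \<in> span (e ` {1..d})"
  unfolding Pi_proj_def by (intro span_sum span_scale span_base) auto

context
  fixes \<iota> :: "'v::real_normed_vector \<Rightarrow>\<^sub>L 'h::real_inner" and d :: nat and e :: "nat \<Rightarrow> 'v"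
  assumes ortho: "\<forall>j\<in>{1..d}. \<forall>k\<in>{1..d}.
    \<iota> (e j) \<bullet> \<iota> (e k) = (if j = k then 1 else 0)"
begin

lemma inner_Pi_proj:
  assumes k: "k \<in> {1..d}"
  shows "\<iota> (e k) \<bullet> \<iota> (Pi_proj d e \<phi>) = \<phi> (e k)"
proof -
  have "\<iota> (e k) \<bullet> \<iota> (Pi_proj d e \<phi>)
      = (\<Sum>j=1..d. \<phi> (e j) * (\<iota> (e k) \<bullet> \<iota> (e j)))"
    by (simp add: Pi_proj_def blinfun.sum_right blinfun.scaleR_right inner_sum_right)
  also have "\<dots> = (\<Sum>j=1..d. if k = j then \<phi> (e j) else 0)"
    using ortho k by (intro sum.cong) auto
  also have "\<dots> = \<phi> (e k)" using k by simp
  finally show ?thesis .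
qed

text \<open>Pairing with \<open>e k\<close> in H recovers the k-th coefficient, so an equation
  between projections is an equation of functionals tested on the span.\<close>

lemma Pi_proj_eq_iff:
  "Pi_proj d e \<phi> = Pi_proj d e \<psi> \<longleftrightarrow> (\<forall>v\<in>span (e ` {1..d}). \<phi> v = \<psi> v)"
proof
  assume eq: "Pi_proj d e \<phi> = Pi_proj d e \<psi>"
  have "\<phi> v = \<psi> v" if "v \<in> e ` {1..d}" for v
    using that inner_Pi_proj[of _ \<phi>] inner_Pi_proj[of _ \<psi>] eq by auto
  then show "\<forall>v\<in>span (e ` {1..d}). \<phi> v = \<psi> v"
    using linear_eq_on_span[of "blinfun_apply \<phi>" "blinfun_apply \<psi>" "e ` {1..d}"]
    by (metis blinfun.bounded_linear_right bounded_linear.linear)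
next
  assume "\<forall>v\<in>span (e ` {1..d}). \<phi> v = \<psi> v"
  moreover have "e k \<in> span (e ` {1..d})" if "k \<in> {1..d}" for k
    using that by (intro span_base imageI)
  ultimately show "Pi_proj d e \<phi> = Pi_proj d e \<psi>"
    unfolding Pi_proj_def by (intro sum.cong refl) simp
qed

lemma Pi_proj_span:
  assumes x: "x \<in> span (e ` {1..d})"
  shows "Pi_proj d e (H_to_dual \<iota> (\<iota> x)) = x"
proof -
  have lin: "linear (\<lambda>x. Pi_proj d e (H_to_dual \<iota> (\<iota> x)))"
    using linear_compose[OF linear_compose[OF bounded_linear.linear[OF blinfun.bounded_linear_right[of \<iota>]]
          linear_H_to_dual[of \<iota>]] linear_Pi_proj[of d e]]
    by (simp add: comp_def)
  have "Pi_proj d e (H_to_dual \<iota> (\<iota> (e j))) = e j" if j: "j \<in> {1..d}" for j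
  proof -
    have "Pi_proj d e (H_to_dual \<iota> (\<iota> (e j))) = (\<Sum>k=1..d. if j = k then e k else 0)"
      unfolding Pi_proj_def H_to_dual_apply using ortho j by (intro sum.cong) auto
    then show ?thesis using j by simp
  qed
  then have "Pi_proj d e (H_to_dual \<iota> (\<iota> v)) = v" if "v \<in> e ` {1..d}" for v
    using that by blast
  from linear_eq_on_span[OF lin linear_ident this x] show ?thesis .
qed

text \<open>The span is the common kernel of the functionals \<open>\<phi> - \<phi> \<circ> \<Pi>\<close>.\<close>

definition span_functionals :: "('v \<Rightarrow>\<^sub>L real) set" where
  "span_functionals = range (\<lambda>\<phi>. \<phi> - (\<Sum>k=1..d. blinfun_apply \<phi> (e k) *\<^sub>R H_to_dual \<iota> (\<iota> (e k))))"

text \<open>Each functional of the family takes the value \<open>\<phi> (x - ?\<Pi> x)\<close> at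
  \<open>x\<close>. Choosing as \<phi> the pairing with \<open>x - ?\<Pi> x\<close> itself shows
  that its H-norm vanishes, and the embedding is injective.\<close>

lemma annihilated_span_functionals:
  assumes inj: "inj (blinfun_apply \<iota>)"
  shows "annihilated span_functionals = span (e ` {1..d})"
proof -
  let ?\<Pi> = "\<lambda>x. Pi_proj d e (H_to_dual \<iota> (\<iota> x))"
  have eval: "(\<phi> - (\<Sum>k=1..d. \<phi> (e k) *\<^sub>R H_to_dual \<iota> (\<iota> (e k)))) x
      = \<phi> (x - ?\<Pi> x)" for \<phi> :: "'v \<Rightarrow>\<^sub>L real" and x
    by (simp add: blinfun.diff_left blinfun.diff_right blinfun.sum_left blinfun.sum_right blinfun.scaleR_left
        blinfun.scaleR_right Pi_proj_def H_to_dual_apply inner_commute mult.commute)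
  have "x \<in> span (e ` {1..d})" if x: "x \<in> annihilated span_functionals" for x
  proof -
    have "\<phi> (x - ?\<Pi> x) = 0" for \<phi> :: "'v \<Rightarrow>\<^sub>L real"
      unfolding eval[of \<phi> x, symmetric] using x unfolding annihilated_def span_functionals_def by blast
    from this[of "H_to_dual \<iota> (\<iota> (x - ?\<Pi> x))"] have "\<iota> (x - ?\<Pi> x) = 0" by (simp add: H_to_dual_apply)
    then have "\<iota> x = \<iota> (?\<Pi> x)" by (simp add: blinfun.diff_right)
    then have "x = ?\<Pi> x" using inj by (simp add: inj_eq)
    then show ?thesis using Pi_proj_in_span by metis
  qed
  moreover have "x \<in> annihilated span_functionals" if "x \<in> span (e ` {1..d})" for x
  proof -
    have "\<phi> (x - ?\<Pi> x) = 0" for \<phi> :: "'v \<Rightarrow>\<^sub>L real"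
      using Pi_proj_span[OF that] by simp
    then show ?thesis unfolding annihilated_def span_functionals_def eval[symmetric] by blast
  qed
  ultimately show ?thesis by blast
qed

end

section \<open>The recursion along the grid\<close>

context implicit_schemes
begin

definition step_data :: "nat \<Rightarrow> nat \<Rightarrow> (nat \<Rightarrow> 'w \<Rightarrow> 'v) \<Rightarrow> nat \<Rightarrow> 'w \<Rightarrow> 'h" where
  "step_data m l u i \<omega> =
     (if i = 1 then \<zeta> \<omega> else \<iota> (u (i - 1) \<omega>)) + noise_term m l i \<omega> (u (i - 1) \<omega>)"

text \<open>The weak form shared by both schemes: \<open>L = {}\<close> tests against all of V,
  \<open>span_kernel\<close> against the Galerkin space.\<close>

definition solves_step :: "nat \<Rightarrow> nat \<Rightarrow> ('v \<Rightarrow>\<^sub>L real) set \<Rightarrow> (nat \<Rightarrow> 'w \<Rightarrow> 'v) \<Rightarrow> nat \<Rightarrow> 'w \<Rightarrow> bool" where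
  "solves_step m l L u i \<omega> \<longleftrightarrow>
     (\<forall>v\<in>annihilated L. (implicit_op m i \<omega> (u i \<omega>)) v = \<iota> v \<bullet> step_data m l u i \<omega>)"

context
  fixes m l :: nat and L :: "('v \<Rightarrow>\<^sub>L real) set"
  assumes m: "m \<ge> 1" and l: "l \<ge> 1"
    and mu_small: "\<And>i. i \<in> {1..m} \<Longrightarrow>
      (\<integral>s. mu s \<partial>time (grid T m (i - 1)) (grid T m i)) \<le> 1"
begin

lemma step_data_square_integrable:
  assumes i: "i \<in> {1..m}"
    and u: "i \<noteq> 1 \<Longrightarrow> u (i - 1) \<in> borel_measurable (Fl (grid T m (i - 1))) \<and>
      integrable M (\<lambda>\<omega>. norm (u (i - 1) \<omega>) powr p)"
  shows "step_data m l u i \<in> borel_measurable (Fl (grid T m i))"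
    and "integrable M (\<lambda>\<omega>. (norm (step_data m l u i \<omega>))\<^sup>2)"
proof -
  have t: "grid T m i \<in> {0..T}" "0 \<le> grid T m (i - 1)" "grid T m (i - 1) \<le> T"
    using grid_bounds[OF T, of i m] grid_bounds[OF T, of "i - 1" m] i by auto
  have mono: "grid T m (i - 1) \<le> grid T m i" using T by (intro grid_mono) auto
  have "step_data m l u i \<in> borel_measurable (Fl (grid T m i)) \<and> square_integrable M (step_data m l u i)"
  proof (cases "i = 1")
    case True
    have "step_data m l u i = \<zeta>"
      unfolding step_data_def True by (simp add: noise_term_first[unfolded One_nat_def])
    moreover have "\<zeta> \<in> borel_measurable (Fl (grid T m i))"
      using filtration_measurable_mono[OF filt \<zeta>, of "grid T m i"] t by auto
    moreover have "\<zeta> \<in> borel_measurable M"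
      using filtration_measurable_M[OF filt \<zeta>] T by simp
    ultimately show ?thesis using \<zeta>_int by (simp add: square_integrable_def)
  next
    case False
    then have i2: "2 \<le> i" "i \<le> m" using i by auto
    have um: "u (i - 1) \<in> borel_measurable (Fl (grid T m (i - 1)))"
      and up: "integrable M (\<lambda>\<omega>. norm (u (i - 1) \<omega>) powr p)" using u[OF False] by auto
    have \<iota>_meas: "blinfun_apply \<iota> \<in> borel_measurable borel"
      by (intro borel_measurable_continuous_onI continuous_intros)
    have iu: "(\<lambda>\<omega>. \<iota> (u (i - 1) \<omega>)) \<in> borel_measurable (Fl (grid T m i))"
      using measurable_compose[OF filtration_measurable_mono[OF filt um t(2) mono] \<iota>_meas] t by auto
    have "square_integrable M (\<lambda>\<omega>. \<iota> (u (i - 1) \<omega>))"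
      unfolding square_integrable_def
    proof (intro conjI)
      show iuM: "(\<lambda>\<omega>. \<iota> (u (i - 1) \<omega>)) \<in> borel_measurable M"
        by (rule filtration_measurable_M[OF filt iu t(1)])
      show "integrable M (\<lambda>\<omega>. (norm (\<iota> (u (i - 1) \<omega>)))\<^sup>2)"
      proof (rule Bochner_Integration.integrable_bound)
        show "integrable M (\<lambda>\<omega>. (norm \<iota>)\<^sup>2 * (1 + norm (u (i - 1) \<omega>) powr p))"
          using up by simp
        show "AE \<omega> in M. norm ((norm (\<iota> (u (i - 1) \<omega>)))\<^sup>2)
            \<le> norm ((norm \<iota>)\<^sup>2 * (1 + norm (u (i - 1) \<omega>) powr p))"
          using norm_embedding_power2_le by (intro AE_I2) simp
      qed (use iuM in simp)
    qed
    then have "square_integrable M (step_data m l u i)"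
      unfolding step_data_def using False noise_term_square_integrable(2)[OF i2 l um up]
      by (simp add: square_integrable_add)
    moreover have "step_data m l u i \<in> borel_measurable (Fl (grid T m i))"
      unfolding step_data_def using False iu noise_term_square_integrable(1)[OF i2 l um up] by simp
    ultimately show ?thesis by blast
  qed
  then show "step_data m l u i \<in> borel_measurable (Fl (grid T m i))"
    and "integrable M (\<lambda>\<omega>. (norm (step_data m l u i \<omega>))\<^sup>2)"
    by (auto simp: square_integrable_def)
qed

text \<open>The initial entry \<open>u0\<close> is left free, as step 1 draws its data from \<zeta>
  directly: one scheme fills it with a placeholder, the other with the projection of
  \<zeta>.\<close>

lemma recursion_exists:
  "\<exists>u. u 0 = u0 \<and> (\<forall>i\<in>{1..m}. u i \<in> borel_measurable (Fl (grid T m i)) \<and>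
    integrable M (\<lambda>\<omega>. norm (u i \<omega>) powr p) \<and> (\<forall>\<omega>. u i \<omega> \<in> annihilated L) \<and>
    (AE \<omega> in M. solves_step m l L u i \<omega>))"
proof -
  let ?Q = "\<lambda>u i. u i \<in> borel_measurable (Fl (grid T m i)) \<and>
    integrable M (\<lambda>\<omega>. norm (u i \<omega>) powr p) \<and> (\<forall>\<omega>. u i \<omega> \<in> annihilated L) \<and>
    (AE \<omega> in M. solves_step m l L u i \<omega>)"
  have "n \<le> m \<Longrightarrow> \<exists>u. u 0 = u0 \<and> (\<forall>i\<in>{1..n}. ?Q u i)" for n
  proof (induction n)
    case 0
    show ?case by (rule exI[of _ "\<lambda>_. u0"]) simp
  next
    case (Suc n)
    then obtain u where u0: "u 0 = u0" and u: "\<And>i. i \<in> {1..n} \<Longrightarrow> ?Q u i" by auto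
    have i: "Suc n \<in> {1..m}" using Suc by simp
    have data: "step_data m l u (Suc n) \<in> borel_measurable (Fl (grid T m (Suc n)))"
        "integrable M (\<lambda>\<omega>. (norm (step_data m l u (Suc n) \<omega>))\<^sup>2)"
      using u[of n] by (intro step_data_square_integrable[OF i]; simp)+
    obtain x where x: "x \<in> borel_measurable (Fl (grid T m (Suc n)))"
        "integrable M (\<lambda>\<omega>. norm (x \<omega>) powr p)" "\<forall>\<omega>. x \<omega> \<in> annihilated L"
        "AE \<omega> in M. \<forall>v\<in>annihilated L. (implicit_op m (Suc n) \<omega> (x \<omega>)) v
          = \<iota> v \<bullet> step_data m l u (Suc n) \<omega>"
      using implicit_step[OF m mu_small i data, of L] by auto
    define u' where "u' = u(Suc n := x)"
    have "solves_step m l L u' j \<omega> = solves_step m l L u j \<omega>" if "j \<in> {1..n}" for j \<omega>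
      using that by (auto simp: solves_step_def step_data_def u'_def)
    then have Q_prev: "?Q u' j" if "j \<in> {1..n}" for j using u[OF that] that by (simp add: u'_def)
    have "step_data m l u' (Suc n) = step_data m l u (Suc n)"
      by (rule ext) (simp add: step_data_def u'_def)
    then have Q_last: "?Q u' (Suc n)"
      using x by (simp add: solves_step_def u'_def)
    have "\<forall>j\<in>{1..Suc n}. ?Q u' j"
    proof
      fix j assume "j \<in> {1..Suc n}"
      then consider "j \<in> {1..n}" | "j = Suc n" by (auto simp: le_Suc_eq)
      then show "?Q u' j"
      proof cases
        case 1
        then show ?thesis by (rule Q_prev)
      next
        case 2
        show ?thesis unfolding 2 by (rule Q_last)
      qed
    qed
    moreover have "u' 0 = u0" using u0 by (simp add: u'_def)
    ultimately show ?case by blast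
  qed
  then show ?thesis by blast
qed

lemma recursion_unique:
  assumes u: "\<And>i. i \<in> {1..m} \<Longrightarrow> AE \<omega> in M. u i \<omega> \<in> annihilated L \<and> solves_step m l L u i \<omega>"
    and u': "\<And>i. i \<in> {1..m} \<Longrightarrow> AE \<omega> in M. u' i \<omega> \<in> annihilated L \<and> solves_step m l L u' i \<omega>"
    and i: "i \<in> {1..m}"
  shows "AE \<omega> in M. u' i \<omega> = u i \<omega>"
  using i
proof (induction i)
  case (Suc n)
  \<comment> \<open>The two solutions may differ at index 0; \<open>noise_term_first\<close> shows
    that the first step does not see this.\<close>
  have eq: "AE \<omega> in M. n \<noteq> 0 \<longrightarrow> u' n \<omega> = u n \<omega>"
    using Suc by (cases "n = 0") auto
  show ?case
    using eq AE_good u[OF Suc.prems] u'[OF Suc.prems]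
  proof eventually_elim
    case (elim \<omega>)
    have "step_data m l u' (Suc n) \<omega> = step_data m l u (Suc n) \<omega>"
      using elim(1) noise_term_first by (cases "n = 0") (simp_all add: step_data_def)
    then show ?case
      using elim
      by (intro implicit_op_solution_unique[OF m mu_small Suc.prems elim(2), where L = L
            and f = "H_to_dual \<iota> (step_data m l u (Suc n) \<omega>)"])
        (auto simp: solves_step_def H_to_dual_apply)
  qed
qed simp

end

lemma solves_scheme_iff:
  "solves_scheme T M \<iota> A B F J g W \<nu> N P \<zeta> m l u \<longleftrightarrow> (\<forall>i\<in>{1..m}. AE \<omega> in M. solves_step m l {} u i \<omega>)"
proof -
  have ext: "\<phi> = \<psi> \<longleftrightarrow> (\<forall>v. \<phi> v = \<psi> v)" for \<phi> \<psi> :: "'v \<Rightarrow>\<^sub>L real"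
    by (auto intro: blinfun_eqI)
  have "(H_to_dual \<iota> (\<iota> (u i \<omega>)) =
          H_to_dual \<iota> (if i = 1 then \<zeta> \<omega> else \<iota> (u (i - 1) \<omega>))
          + (T / real m) *\<^sub>R A_disc T A m i \<omega> (u i \<omega>)
          + H_to_dual \<iota> (blinfun_apply (B_disc T B m i \<omega> (u (i - 1) \<omega>))
              (wiener_step m l i \<omega>))
          + H_to_dual \<iota> (jump_integral m i \<omega> (F_disc T \<nu> F (P l) m i \<omega> (u (i - 1) \<omega>)))) \<longleftrightarrow> solves_step m l {} u i \<omega>" for i \<omega>
    unfolding solves_step_def ext annihilated_def implicit_op_def step_data_def noise_term_def
    by (simp add: blinfun.add_left blinfun.diff_left H_to_dual_apply inner_add_right algebra_simps)
  then show ?thesis by (simp only: solves_scheme_def)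
qed

section \<open>The scheme with space projection\<close>

context
  fixes d :: nat and e :: "nat \<Rightarrow> 'v"
  assumes ortho: "\<forall>j\<in>{1..d}. \<forall>k\<in>{1..d}.
    \<iota> (e j) \<bullet> \<iota> (e k) = (if j = k then 1 else 0)"
begin

abbreviation span_kernel :: "('v \<Rightarrow>\<^sub>L real) set" where
  "span_kernel \<equiv> span_functionals \<iota> d e"

abbreviation proj :: "'h \<Rightarrow> 'v" where
  "proj h \<equiv> Pi_proj d e (H_to_dual \<iota> h)"

abbreviation (input) projected_rhs :: "nat \<Rightarrow> nat \<Rightarrow> (nat \<Rightarrow> 'w \<Rightarrow> 'v) \<Rightarrow> nat \<Rightarrow> 'w \<Rightarrow> 'v" where
  "projected_rhs m l u i \<omega> \<equiv> u (i - 1) \<omega>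
          + (T / real m) *\<^sub>R Pi_proj d e (A_disc T A m i \<omega> (u i \<omega>))
          + proj (blinfun_apply (B_disc T B m i \<omega> (u (i - 1) \<omega>))
              (wiener_step m l i \<omega>))
          + jump_integral m i \<omega> (\<lambda>\<xi>. proj (F_disc T \<nu> F (P l) m i \<omega> (u (i - 1) \<omega>) \<xi>))"

lemma annihilated_span_kernel: "annihilated span_kernel = span (e ` {1..d})"
  by (rule annihilated_span_functionals[OF ortho inj])

lemma linear_proj: "linear proj"
  using linear_compose[OF linear_H_to_dual linear_Pi_proj] by (simp add: comp_def)

text \<open>Almost surely both integrals are finite sums over the cells, and the projected integrand
  is again a step function, with projected values; linearity of \<open>proj\<close> does the
  rest.\<close>

lemma AE_compensated_integral_proj:
  assumes i: "i \<in> {1..m}" and l: "l \<ge> 1"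
  shows "AE \<omega> in M. \<forall>x. jump_integral m i \<omega> (\<lambda>\<xi>. proj (F_disc T \<nu> F (P l) m i \<omega> x \<xi>))
      = proj (jump_integral m i \<omega> (F_disc T \<nu> F (P l) m i \<omega> x))"
proof (cases "i = 1")
  case True
  show ?thesis
    unfolding True using linear_0[OF linear_proj]
    by (simp add: F_disc_def compensated_integral_def set_lebesgue_integral_def)
next
  case False
  then have i2: "2 \<le> i" "i \<le> m" using i by auto
  show ?thesis
    using AE_compensated_integral[OF i2 l, where 'b = 'h] AE_compensated_integral[OF i2 l, where 'b = 'v]
  proof eventually_elim
    case (elim \<omega>)
    show ?case
    proof
      fix x
      have "(\<lambda>\<xi>. proj (F_disc T \<nu> F (P l) m i \<omega> x \<xi>))
          = (\<lambda>\<xi>. \<Sum>C\<in>P l. indicator C \<xi> *\<^sub>R proj (cell_coeff m i C \<omega> x))"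
        unfolding F_disc_eq[OF i2 l]
        by (simp only: linear_sum[OF linear_proj] linear_scale[OF linear_proj])
      then show "jump_integral m i \<omega> (\<lambda>\<xi>. proj (F_disc T \<nu> F (P l) m i \<omega> x \<xi>))
          = proj (jump_integral m i \<omega> (F_disc T \<nu> F (P l) m i \<omega> x))"
        unfolding F_disc_eq[OF i2 l]
        by (simp only: elim[rule_format] linear_sum[OF linear_proj] linear_scale[OF linear_proj])
    qed
  qed
qed

text \<open>The assumption \<open>prev\<close> unites two cases: for i = 1 it is the initial
  condition, and later it holds because the projection fixes elements of the span.\<close>

lemma projected_step_iff:
  assumes ui: "u i \<omega> \<in> span (e ` {1..d})"
    and prev: "u (i - 1) \<omega> = proj (if i = 1 then \<zeta> \<omega> else \<iota> (u (i - 1) \<omega>))"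
    and CI: "jump_integral m i \<omega> (\<lambda>\<xi>. proj (F_disc T \<nu> F (P l) m i \<omega> (u (i - 1) \<omega>) \<xi>))
      = proj (jump_integral m i \<omega> (F_disc T \<nu> F (P l) m i \<omega> (u (i - 1) \<omega>)))"
  shows "u i \<omega> = projected_rhs m l u i \<omega>
    \<longleftrightarrow> solves_step m l span_kernel u i \<omega>"
proof -
  have "projected_rhs m l u i \<omega> = Pi_proj d e (H_to_dual \<iota> (step_data m l u i \<omega>) + (T / real m) *\<^sub>R A_disc T A m i \<omega> (u i \<omega>))"
    unfolding CI step_data_def noise_term_def
    by (subst (1) prev) (simp only: linear_add[OF linear_H_to_dual] Pi_proj_add Pi_proj_scaleR add_ac)
  then have "u i \<omega> = projected_rhs m l u i \<omega> \<longleftrightarrow> proj (\<iota> (u i \<omega>))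
      = Pi_proj d e (H_to_dual \<iota> (step_data m l u i \<omega>) + (T / real m) *\<^sub>R A_disc T A m i \<omega> (u i \<omega>))"
    by (simp only: Pi_proj_span[OF ortho ui])
  also have "\<dots> \<longleftrightarrow> solves_step m l span_kernel u i \<omega>"
    unfolding Pi_proj_eq_iff[OF ortho] solves_step_def annihilated_span_kernel implicit_op_def
    by (simp add: blinfun.add_left blinfun.diff_left H_to_dual_apply algebra_simps)
  finally show ?thesis .
qed

lemma solves_projected_scheme_iff:
  assumes l: "l \<ge> 1"
  shows "solves_projected_scheme T M \<iota> A B F J g W \<nu> N P \<zeta> d e m l u \<longleftrightarrow>
    (\<forall>i\<in>{0..m}. \<forall>\<omega>\<in>space M. u i \<omega> \<in> span (e ` {1..d})) \<and> (AE \<omega> in M. u 0 \<omega> = proj (\<zeta> \<omega>)) \<and>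
    (\<forall>i\<in>{1..m}. AE \<omega> in M. solves_step m l span_kernel u i \<omega>)"
  unfolding solves_projected_scheme_def
proof (rule conj_cong[OF refl conj_cong[OF refl ball_cong[OF refl]]])
  fix i
  assume u: "\<forall>i\<in>{0..m}. \<forall>\<omega>\<in>space M. u i \<omega> \<in> span (e ` {1..d})"
    and u0: "AE \<omega> in M. u 0 \<omega> = proj (\<zeta> \<omega>)" and i: "i \<in> {1..m}"
  have "AE \<omega> in M. (u i \<omega> = projected_rhs m l u i \<omega>)
    \<longleftrightarrow> solves_step m l span_kernel u i \<omega>"
    using AE_compensated_integral_proj[OF i l] u0 AE_space
  proof eventually_elim
    case (elim \<omega>)
    have "u i \<omega> \<in> span (e ` {1..d})" "u (i - 1) \<omega> \<in> span (e ` {1..d})"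
      using u i elim(3) by auto
    then show ?case
      using elim(1,2) by (intro projected_step_iff) (auto simp: Pi_proj_span[OF ortho])
  qed
  then show "(AE \<omega> in M. u i \<omega> = projected_rhs m l u i \<omega>)
    \<longleftrightarrow> (AE \<omega> in M. solves_step m l span_kernel u i \<omega>)"
    by (rule eventually_subst)
qed

end

text \<open>By absolute continuity of the integral of \<open>mu\<close>, a mesh below some \<delta>
  suffices. The threshold depends on \<open>mu\<close> and \<open>T\<close> alone, hence is uniform
  in \<open>l\<close>, \<open>n\<close> and the path.\<close>

lemma fine_grid:
  "\<exists>m0\<ge>1. \<forall>m\<ge>m0. \<forall>i\<in>{1..m}. (\<integral>s. mu s \<partial>time (grid T m (i - 1)) (grid T m i)) \<le> 1"
proof -
  obtain \<delta> where \<delta>: "\<delta> > 0" and small: "\<And>a b. 0 \<le> a \<Longrightarrow> a \<le> b \<Longrightarrow> b \<le> T \<Longrightarrow> b - a \<le> \<delta> \<Longrightarrow>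
      (\<integral>s. mu s \<partial>time a b) \<le> 1"
    using small_time_integral[OF mu_int mu_nonneg, of 1] by auto
  obtain k :: nat where k: "T / \<delta> \<le> real k" using real_arch_simple by blast
  show ?thesis
  proof (intro exI[of _ "max 1 k"] conjI allI impI ballI)
    fix m i assume m: "max 1 k \<le> m" and i: "i \<in> {1..m}"
    have "T / \<delta> \<le> real m" using k m by (simp add: order_trans)
    then have "T / real m \<le> \<delta>" using \<delta> m by (simp add: field_simps)
    then show "(\<integral>s. mu s \<partial>time (grid T m (i - 1)) (grid T m i)) \<le> 1"
      using i T grid_step[of i T m] grid_bounds[OF T, of i m] grid_bounds[OF T, of "i - 1" m]
      by (intro small grid_mono) auto
  qed simp
qed

text \<open>Uniqueness is up to null sets and is claimed in the large class of
  \<open>M\<close>-measurable competitors, adapted or not and with no moments prescribed.\<close>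

abbreviation (input) uniquely_solvable :: "nat \<Rightarrow> ((nat \<Rightarrow> 'w \<Rightarrow> 'v) \<Rightarrow> bool) \<Rightarrow> bool" where
  "uniquely_solvable m solves \<equiv> \<exists>u. solves u \<and>
     (\<forall>i\<in>{1..m}. u i \<in> borel_measurable (Fl (grid T m i)) \<and> integrable M (\<lambda>\<omega>. norm (u i \<omega>) powr p)) \<and>
     (\<forall>u'. (\<forall>i\<in>{1..m}. u' i \<in> borel_measurable M) \<and> solves u' \<longrightarrow>
        (\<forall>i\<in>{1..m}. AE \<omega> in M. u' i \<omega> = u i \<omega>))"

theorem scheme_well_posed:
  "\<exists>m0\<ge>1. \<forall>m\<ge>m0. \<forall>l\<ge>1. uniquely_solvable m (solves_scheme T M \<iota> A B F J g W \<nu> N P \<zeta> m l)"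
proof -
  obtain m0 where m0: "m0 \<ge> 1" and small: "\<And>m i. m \<ge> m0 \<Longrightarrow> i \<in> {1..m} \<Longrightarrow>
      (\<integral>s. mu s \<partial>time (grid T m (i - 1)) (grid T m i)) \<le> 1"
    using fine_grid by blast
  show ?thesis
  proof (intro exI[of _ m0] conjI allI impI)
    fix m l :: nat assume m: "m \<ge> m0" and l: "l \<ge> 1"
    have m1: "m \<ge> 1" using m m0 by simp
    note L = recursion_exists[OF m1 l small[OF m], of _ "{}"] recursion_unique[OF m1 l small[OF m], of _ "{}"]
    have all: "x \<in> annihilated {}" for x :: 'v by (simp add: annihilated_def)
    obtain u where u: "\<And>i. i \<in> {1..m} \<Longrightarrow> u i \<in> borel_measurable (Fl (grid T m i)) \<and>
        integrable M (\<lambda>\<omega>. norm (u i \<omega>) powr p) \<and> (AE \<omega> in M. solves_step m l {} u i \<omega>)"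
      \<comment> \<open>The first scheme puts no condition on \<open>u 0\<close>; zero is a
        placeholder.\<close>
      using L(1)[of "\<lambda>_. 0"] by blast
    show "uniquely_solvable m (solves_scheme T M \<iota> A B F J g W \<nu> N P \<zeta> m l)"
    proof (intro exI[of _ u] conjI allI impI)
      show "solves_scheme T M \<iota> A B F J g W \<nu> N P \<zeta> m l u" using u by (simp add: solves_scheme_iff)
      show "\<forall>i\<in>{1..m}. u i \<in> borel_measurable (Fl (grid T m i)) \<and> integrable M (\<lambda>\<omega>. norm (u i \<omega>) powr p)"
        using u by blast
      fix u' assume "(\<forall>i\<in>{1..m}. u' i \<in> borel_measurable M) \<and> solves_scheme T M \<iota> A B F J g W \<nu> N P \<zeta> m l u'"
      then show "\<forall>i\<in>{1..m}. AE \<omega> in M. u' i \<omega> = u i \<omega>"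
        using u all by (intro ballI L(2)) (auto simp: solves_scheme_iff)
    qed
  qed (rule m0)
qed

theorem projected_scheme_well_posed:
  fixes d :: "nat \<Rightarrow> nat" and e :: "nat \<Rightarrow> nat \<Rightarrow> 'v"
  assumes ortho: "\<And>n. n \<ge> 1 \<Longrightarrow> \<forall>j\<in>{1..d n}. \<forall>k\<in>{1..d n}.
    \<iota> (e n j) \<bullet> \<iota> (e n k) = (if j = k then 1 else 0)"
  shows "\<exists>m0\<ge>1. \<forall>m\<ge>m0. \<forall>n\<ge>1. \<forall>l\<ge>1. uniquely_solvable m (solves_projected_scheme T M \<iota> A B F J g W \<nu> N P \<zeta> (d n) (e n) m l)"
proof -
  obtain m0 where m0: "m0 \<ge> 1" and small: "\<And>m i. m \<ge> m0 \<Longrightarrow> i \<in> {1..m} \<Longrightarrow>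
      (\<integral>s. mu s \<partial>time (grid T m (i - 1)) (grid T m i)) \<le> 1"
    using fine_grid by blast
  show ?thesis
  proof (intro exI[of _ m0] conjI allI impI)
    fix m n l :: nat assume m: "m \<ge> m0" and n: "n \<ge> 1" and l: "l \<ge> 1"
    have m1: "m \<ge> 1" using m m0 by simp
    let ?L = "span_functionals \<iota> (d n) (e n)"
    note L = recursion_exists[OF m1 l small[OF m], of _ ?L] recursion_unique[OF m1 l small[OF m], of _ ?L]
    note iff = solves_projected_scheme_iff[OF ortho[OF n] l]
    note ann = annihilated_span_kernel[OF ortho[OF n]]
    obtain u where u0: "u 0 = (\<lambda>\<omega>. Pi_proj (d n) (e n) (H_to_dual \<iota> (\<zeta> \<omega>)))"
      and u: "\<And>i. i \<in> {1..m} \<Longrightarrow> u i \<in> borel_measurable (Fl (grid T m i)) \<and>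
        integrable M (\<lambda>\<omega>. norm (u i \<omega>) powr p) \<and> (\<forall>\<omega>. u i \<omega> \<in> annihilated ?L) \<and>
        (AE \<omega> in M. solves_step m l ?L u i \<omega>)"
      using L(1)[of "\<lambda>\<omega>. Pi_proj (d n) (e n) (H_to_dual \<iota> (\<zeta> \<omega>))"] by blast
    have span: "u i \<omega> \<in> span (e n ` {1..d n})" if "i \<in> {0..m}" for i \<omega>
      using u[of i] u0 that Pi_proj_in_span unfolding ann by (cases "i = 0") auto
    show "uniquely_solvable m (solves_projected_scheme T M \<iota> A B F J g W \<nu> N P \<zeta> (d n) (e n) m l)"
    proof (intro exI[of _ u] conjI allI impI)
      show "solves_projected_scheme T M \<iota> A B F J g W \<nu> N P \<zeta> (d n) (e n) m l u"
        unfolding iff using u u0 span by simp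
      show "\<forall>i\<in>{1..m}. u i \<in> borel_measurable (Fl (grid T m i)) \<and> integrable M (\<lambda>\<omega>. norm (u i \<omega>) powr p)"
        using u by blast
      fix u' assume "(\<forall>i\<in>{1..m}. u' i \<in> borel_measurable M) \<and> solves_projected_scheme T M \<iota> A B F J g W \<nu> N P \<zeta> (d n) (e n) m l u'"
      then have u': "\<forall>i\<in>{0..m}. \<forall>\<omega>\<in>space M. u' i \<omega> \<in> annihilated ?L"
          "\<forall>i\<in>{1..m}. AE \<omega> in M. solves_step m l ?L u' i \<omega>"
        unfolding iff ann by simp_all
      show "\<forall>i\<in>{1..m}. AE \<omega> in M. u' i \<omega> = u i \<omega>"
      proof (intro ballI L(2))
        fix i assume i: "i \<in> {1..m}"
        show "AE \<omega> in M. u i \<omega> \<in> annihilated ?L \<and> solves_step m l ?L u i \<omega>"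
          using u[OF i] by simp
        have "AE \<omega> in M. solves_step m l ?L u' i \<omega>" using u'(2) i by blast
        then show "AE \<omega> in M. u' i \<omega> \<in> annihilated ?L \<and> solves_step m l ?L u' i \<omega>"
          using AE_space by eventually_elim (use u'(1) i in simp)
      qed
    qed
  qed (rule m0)
qed

end

theorem theorem3p4:
  fixes T p q \<alpha> :: real
    and \<iota> :: "'v::{banach, second_countable_topology}
               \<Rightarrow>\<^sub>L 'h::{real_inner, banach, second_countable_topology}"
    and J :: "nat set" and g :: "nat \<Rightarrow> 'u::{real_inner, banach}"
    and M :: "'w measure" and Fl :: "real \<Rightarrow> 'w measure"
    and W :: "real \<Rightarrow> 'w \<Rightarrow> 'u \<Rightarrow> real"
    and \<nu> :: "'e::metric_space measure" and N :: "'w \<Rightarrow> (real \<times> 'e) measure"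
    and A :: "real \<Rightarrow> 'w \<Rightarrow> 'v \<Rightarrow> ('v \<Rightarrow>\<^sub>L real)"
    and B :: "real \<Rightarrow> 'w \<Rightarrow> 'v \<Rightarrow> ('u \<Rightarrow>\<^sub>L 'h)"
    and F :: "real \<Rightarrow> 'w \<Rightarrow> 'v \<Rightarrow> 'e \<Rightarrow> 'h"
    and K1 K2 :: "real \<Rightarrow> 'w \<Rightarrow> real" and lam mu :: "real \<Rightarrow> real"
    and \<zeta> :: "'w \<Rightarrow> 'h"
    and El :: "nat \<Rightarrow> 'e set" and P :: "nat \<Rightarrow> 'e set set" and \<epsilon> :: "nat \<Rightarrow> real"
    and V :: "nat \<Rightarrow> 'v set" and d :: "nat \<Rightarrow> nat" and e :: "nat \<Rightarrow> nat \<Rightarrow> 'v"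
  \<comment> \<open>setting\<close>
  assumes "reflexive_space TYPE('v)" and "dense_embedding \<iota>" and "T > 0"
    and "orthonormal_basis J g"
    and "usual_filtration T M Fl"
    and "cylindrical_wiener T M Fl W"
    and "sets \<nu> = sets borel" and "sigma_finite_measure \<nu>"
    and "poisson_random_measure T M Fl \<nu> N"
    and "independent_noises T M \<nu> W N"
    and "(\<lambda>((t, \<omega>), x). A t \<omega> x) \<in> borel_measurable (progressive_sigma T M Fl \<Otimes>\<^sub>M borel)"
    and "(\<lambda>((t, \<omega>), x). B t \<omega> x) \<in> progressive_sigma T M Fl \<Otimes>\<^sub>M borel \<rightarrow>\<^sub>M hs_borel J g"
    and "(\<lambda>((t, \<omega>), x, \<xi>). F t \<omega> x \<xi>)
           \<in> borel_measurable (predictable_sigma T M Fl \<Otimes>\<^sub>M (borel \<Otimes>\<^sub>M borel))"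
  \<comment> \<open>parameters\<close>
    and "p \<ge> 2" and "1 / p + 1 / q = 1"
    and "\<forall>t\<in>{0..T}. \<forall>\<omega>\<in>space M. K1 t \<omega> \<ge> 0 \<and> K2 t \<omega> \<ge> 0"
    and "integrable (restrict_space lborel {0..T} \<Otimes>\<^sub>M M) (\<lambda>(t, \<omega>). K1 t \<omega>)"
    and "integrable (restrict_space lborel {0..T} \<Otimes>\<^sub>M M) (\<lambda>(t, \<omega>). K2 t \<omega>)"
    and "\<forall>t\<in>{0..T}. lam t > 0 \<and> mu t \<ge> 0"
    and "integrable (restrict_space lborel {0..T}) lam"
    and "integrable (restrict_space lborel {0..T}) mu"
  \<comment> \<open>(1) monotonicity\<close>
    and "AE \<omega> in M. \<forall>x y. \<forall>t\<in>{0..T}.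
           integrable \<nu> (\<lambda>\<xi>. (norm (F t \<omega> x \<xi> - F t \<omega> y \<xi>))\<^sup>2) \<and>
           2 * blinfun_apply (A t \<omega> x - A t \<omega> y) (x - y)
             + (hs_norm J g (B t \<omega> x - B t \<omega> y))\<^sup>2
             + (\<integral>\<xi>. (norm (F t \<omega> x \<xi> - F t \<omega> y \<xi>))\<^sup>2 \<partial>\<nu>) \<le> 0"
  \<comment> \<open>(2) coercivity\<close>
    and "AE \<omega> in M. \<forall>x. \<forall>t\<in>{0..T}.
           integrable \<nu> (\<lambda>\<xi>. (norm (F t \<omega> x \<xi>))\<^sup>2) \<and>
           2 * blinfun_apply (A t \<omega> x) x + (hs_norm J g (B t \<omega> x))\<^sup>2
             + (\<integral>\<xi>. (norm (F t \<omega> x \<xi>))\<^sup>2 \<partial>\<nu>) + lam t * norm x powr p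
           \<le> K1 t \<omega> + mu t * (norm (blinfun_apply \<iota> x))\<^sup>2"
  \<comment> \<open>(3) growth\<close>
    and "\<alpha> > 0"
    and "AE \<omega> in M. \<forall>x. \<forall>t\<in>{0..T}.
           norm (A t \<omega> x) powr q
             \<le> \<alpha> * lam t powr q * norm x powr p + K2 t \<omega> * lam t powr (q - 1)"
  \<comment> \<open>(4) hemicontinuity\<close>
    and "AE \<omega> in M. \<forall>x y z. \<forall>t\<in>{0..T}.
           ((\<lambda>r. blinfun_apply (A t \<omega> (x + r *\<^sub>R y)) z) \<longlongrightarrow> blinfun_apply (A t \<omega> x) z) (at 0)"
  \<comment> \<open>(5) initial value\<close>
    and "\<zeta> \<in> borel_measurable (Fl 0)" and "integrable M (\<lambda>\<omega>. (norm (\<zeta> \<omega>))\<^sup>2)"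
  \<comment> \<open>(6) exhaustion of the mark space\<close>
    and "\<forall>l\<ge>1. compact (El l) \<and> emeasure \<nu> (El l) < \<infinity> \<and> El l \<subseteq> El (l + 1)"
    and "(\<Union>l\<in>{1..}. El l) = UNIV"
  \<comment> \<open>partitions of the sets \<open>El l\<close>\<close>
    and "\<forall>l\<ge>1. finite (P l) \<and> P l \<subseteq> sets borel \<and> partition_on (El l) (P l)"
    and "\<forall>l\<ge>1. \<forall>C\<in>P l. (\<exists>k\<in>{1..l}. C \<subseteq> El k - (if k = 1 then {} else El (k - 1)))
           \<and> diameter C < \<epsilon> l"
    and "\<forall>l\<ge>1. \<epsilon> (l + 1) \<le> \<epsilon> l" and "\<epsilon> \<longlonglongrightarrow> 0"
  \<comment> \<open>finite-dimensional subspaces\<close>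
    and "\<forall>n\<ge>1. V n = span (e n ` {1..d n}) \<and> V n \<subseteq> V (n + 1)"
    and "\<forall>n\<ge>1. \<forall>j\<in>{1..d n}. \<forall>k\<in>{1..d n}.
           blinfun_apply \<iota> (e n j) \<bullet> blinfun_apply \<iota> (e n k) = (if j = k then 1 else 0)"
    and "closure (\<Union>n\<in>{1..}. V n) = UNIV"
  shows "(\<exists>m0\<ge>1. \<forall>m\<ge>m0. \<forall>l\<ge>1. \<exists>u.
            solves_scheme T M \<iota> A B F J g W \<nu> N P \<zeta> m l u \<and>
            (\<forall>i\<in>{1..m}. u i \<in> borel_measurable (Fl (grid T m i)) \<and>
                        integrable M (\<lambda>\<omega>. norm (u i \<omega>) powr p)) \<and>
            (\<forall>u'. (\<forall>i\<in>{1..m}. u' i \<in> borel_measurable M) \<and>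
                  solves_scheme T M \<iota> A B F J g W \<nu> N P \<zeta> m l u' \<longrightarrow>
                  (\<forall>i\<in>{1..m}. AE \<omega> in M. u' i \<omega> = u i \<omega>)))
       \<and> (\<exists>m0\<ge>1. \<forall>m\<ge>m0. \<forall>n\<ge>1. \<forall>l\<ge>1. \<exists>u.
            solves_projected_scheme T M \<iota> A B F J g W \<nu> N P \<zeta> (d n) (e n) m l u \<and>
            (\<forall>i\<in>{1..m}. u i \<in> borel_measurable (Fl (grid T m i)) \<and>
                        integrable M (\<lambda>\<omega>. norm (u i \<omega>) powr p)) \<and>
            (\<forall>u'. (\<forall>i\<in>{1..m}. u' i \<in> borel_measurable M) \<and>
                  solves_projected_scheme T M \<iota> A B F J g W \<nu> N P \<zeta> (d n) (e n) m l u' \<longrightarrow>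
                  (\<forall>i\<in>{1..m}. AE \<omega> in M. u' i \<omega> = u i \<omega>)))"
proof -
  have filt: "usual_filtration T M Fl" and \<nu>: "sets \<nu> = sets borel"
    and El: "\<forall>l\<ge>1. compact (El l) \<and> emeasure \<nu> (El l) < \<infinity> \<and> El l \<subseteq> El (l + 1)"
    and P: "\<forall>l\<ge>1. finite (P l) \<and> P l \<subseteq> sets borel \<and> partition_on (El l) (P l)"
    and ortho: "\<forall>n\<ge>1. \<forall>j\<in>{1..d n}. \<forall>k\<in>{1..d n}.
           blinfun_apply \<iota> (e n j) \<bullet> blinfun_apply \<iota> (e n k) = (if j = k then 1 else 0)"
    by fact+
  have cell: "C \<in> sets \<nu> \<and> emeasure \<nu> C < \<infinity>" if l: "l \<ge> 1" and C: "C \<in> P l" for l C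
  proof
    show "C \<in> sets \<nu>" using P l C \<nu> by auto
    have "C \<subseteq> El l" using P l C by (auto simp: partition_on_def)
    moreover have "El l \<in> sets \<nu>" using El l \<nu> by (simp add: borel_compact)
    ultimately have "emeasure \<nu> C \<le> emeasure \<nu> (El l)" by (rule emeasure_mono)
    then show "emeasure \<nu> C < \<infinity>" using El l by (auto intro: le_less_trans)
  qed
  interpret implicit_schemes T p q \<alpha> \<iota> J g M Fl W \<nu> N A B F K1 K2 lam mu \<zeta> P
  proof (rule implicit_schemes.intro)
    show "inj (blinfun_apply \<iota>)" using \<open>dense_embedding \<iota>\<close> by (simp add: dense_embedding_def)
    show "finite (P l)" if "l \<ge> 1" for l using P that by blast
  qed (fact cell | fact)+
  show ?thesis
    by (rule conjI[OF scheme_well_posed projected_scheme_well_posed[OF ortho[THEN spec, THEN mp]]])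
qed

end
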